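(* Let $N\ge3$ and let $\Omega\subset\mathbb{R}^N$ be a smooth domain with $0\in\partial\Omega$. There exists $r_0=r_0(\Omega)>0$ such that $\mu(\Omega_r)=\frac{N^2}{4}$ for all $r\in(0,r_0)$; let $r\in(0,r_0)$. Let $N-1<c\le\frac{N^2}{4}$, $p>1$, and let $u\in L^p_{loc}(\Omega_r)$ be non-negative and satisfy $$-\Delta u-\frac{c}{|x|^2}u\ge u^p\quad\text{in }\mathcal{D}'(\Omega_r),$$ i.e. $\int u(-\Delta\varphi-c|x|^{-2}\varphi)\,dx\ge\int u^p\varphi\,dx$ for all non-negative $\varphi\in C_c^\infty(\Omega_r)$. If $p\ge p_{\mathbb{S}^{N-1}_+}$ then $u\equiv0$.
   Context: $\Omega_r=\Omega\cap B_r(0)$. For an open set $D$, $\mu(D)=\inf_{u\in C_c^\infty(D)}\frac{\int_D|\nabla u|^2dx}{\int_D|x|^{-2}u^2dx}$. $p_{\mathbb{S}^{N-1}_+}=1+\frac{2}{\alpha}$ where $\alpha=\frac{N-2}{2}-\sqrt{\frac{N^2}{4}-c}$ (positive for $c>N-1$). *)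

theory Defs
  imports "HOL-Analysis.Analysis"
begin

definition pd :: "('a::euclidean_space \<Rightarrow> real) \<Rightarrow> 'a \<Rightarrow> 'a \<Rightarrow> real" where
  "pd f b x = frechet_derivative f (at x) b"

fun Ck_on :: "nat \<Rightarrow> 'a::euclidean_space set \<Rightarrow> ('a \<Rightarrow> real) \<Rightarrow> bool" where
  "Ck_on 0 U f = continuous_on U f"
| "Ck_on (Suc k) U f = (continuous_on U f \<and> f differentiable_on U \<and>
       (\<forall>b\<in>Basis. Ck_on k U (pd f b)))"

definition smooth_on :: "'a::euclidean_space set \<Rightarrow> ('a \<Rightarrow> real) \<Rightarrow> bool" where
  "smooth_on U f = (\<forall>k. Ck_on k U f)"

definition tsupport :: "('a::euclidean_space \<Rightarrow> real) \<Rightarrow> 'a set" where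
  "tsupport f = closure {x. f x \<noteq> 0}"

definition test_fun :: "'a::euclidean_space set \<Rightarrow> ('a \<Rightarrow> real) \<Rightarrow> bool" where
  "test_fun D f = (smooth_on UNIV f \<and> compact (tsupport f) \<and> tsupport f \<subseteq> D)"

definition laplacian :: "('a::euclidean_space \<Rightarrow> real) \<Rightarrow> 'a \<Rightarrow> real" where
  "laplacian f x = (\<Sum>b\<in>Basis. pd (pd f b) b x)"

definition grad_sq :: "('a::euclidean_space \<Rightarrow> real) \<Rightarrow> 'a \<Rightarrow> real" where
  "grad_sq f x = (\<Sum>b\<in>Basis. (pd f b x)\<^sup>2)"

definition smooth_domain :: "'a::euclidean_space set \<Rightarrow> bool" where
  "smooth_domain \<Omega> = (open \<Omega> \<and> connected \<Omega> \<and> \<Omega> \<noteq> {} \<and>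
     (\<forall>z\<in>frontier \<Omega>. \<exists>U \<rho>. open U \<and> z \<in> U \<and> smooth_on U \<rho> \<and>
        (\<forall>x\<in>U. frechet_derivative \<rho> (at x) \<noteq> (\<lambda>_. 0)) \<and>
        \<Omega> \<inter> U = {x\<in>U. \<rho> x < 0}))"

definition hardy_mu :: "'a::euclidean_space set \<Rightarrow> real" where
  "hardy_mu D = Inf {(LINT x|lebesgue. grad_sq u x) / (LINT x|lebesgue. u x ^ 2 / (norm x)\<^sup>2) |
                      u. test_fun D u \<and> (\<exists>x. u x \<noteq> 0)}"

definition Lp_loc :: "real \<Rightarrow> 'a::euclidean_space set \<Rightarrow> ('a \<Rightarrow> real) \<Rightarrow> bool" where
  "Lp_loc p D u = (u \<in> borel_measurable lebesgue \<and>
     (\<forall>K. compact K \<and> K \<subseteq> D \<longrightarrow> set_integrable lebesgue K (\<lambda>x. \<bar>u x\<bar> powr p)))"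

definition alpha_exp :: "real \<Rightarrow> real \<Rightarrow> real" where
  "alpha_exp N c = (N - 2) / 2 - sqrt (N\<^sup>2 / 4 - c)"

definition p_half_sphere :: "real \<Rightarrow> real \<Rightarrow> real" where
  "p_half_sphere N c = 1 + 2 / alpha_exp N c"

end

theory Submission
  imports Defs "HOL-Computational_Algebra.Polynomial"
begin

text \<open>An inversion straightens a ball touching \<open>\<partial>\<Omega>\<close> at the origin into a half-space, and the Kelvin
  transform turns the Hardy operator into itself up to a lower order perturbation of the potential.
  Products of the half-space coordinate with a function \<open>g\<close> of \<open>\<tau> = ln |z|\<close> (times \<open>|z|\<close> to the power \<open>-N/2\<close>)
  reduce everything to the operator \<open>g'' - \<kappa>\<^sup>2 g\<close> with \<open>\<kappa>\<^sup>2 = N\<^sup>2/4 - c\<close>.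

  For an exterior ball, \<open>g = 1 - exp (- \<tau>/2)\<close> gives a positive supersolution, hence \<open>\<mu> \<ge> N\<^sup>2/4\<close>. For an interior
  ball, a wide bump \<open>g\<close> gives a compactly supported subsolution for every \<open>c > N\<^sup>2/4\<close>, hence \<open>\<mu> \<le> N\<^sup>2/4\<close>.

  For the nonexistence, take \<open>g = exp (\<kappa>\<tau>) Q \<zeta>\<close> with a subsolution profile \<open>Q\<close> (bounded if \<open>\<kappa> > 0\<close>, linear
  if \<open>\<kappa> = 0\<close>) and a cutoff \<open>\<zeta>\<close> of logarithmic width \<open>L\<close>. Testing with it and applying Young's inequality
  bounds \<open>\<integral> u\<^sup>p \<phi>\<close> by a constant times \<open>L\<close> to the power \<open>1 - p'\<close>, with \<open>p'\<close> conjugate to \<open>p\<close>, exactly when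
  \<open>p \<ge> 1 + 2/\<alpha>\<close>; letting \<open>L\<close> tend to infinity, \<open>u\<close> vanishes on a small ball. A Hopf-type bump spreads the
  vanishing over \<open>\<Omega>\<^sub>r\<close>, which is star-shaped, hence connected.\<close>

section \<open>Calculus of smooth functions\<close>

text \<open>The obstacle is that the test functions must be smooth with compact support while every
  error is absorbed pointwise. All profiles are therefore built from exp(-1/v): its derivatives are
  itself times polynomials in 1/v, hence dominated by any power of it with exponent below 1, which
  is what Young's inequality asks for. Three errors compete. Replacing |x|^(-2) by |z|^2 costs a
  relative error of order exp(-tau); it is paid by the slack exp(-tau/2), by epsilon, or by the
  strictness of the subsolution Q. Smoothing the positive part of the half-space coordinate at scale
  d^3 costs d^2 times a power of w, the reciprocal distance to the end of the cutoff; d of order 1/L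
  makes this comparable with the second derivative of the cutoff. The cutoff itself costs the factor
  1/L that wins in the end. On a half-space the Hardy operator has the solutions cos(theta)
  |x|^(-(N-2)/2 + kappa) and cos(theta) |x|^(-(N-2)/2 - kappa); the nonexistence proof follows the
  second, more singular one.\<close>

lemma Ck_on_imp_continuous: "Ck_on k U f \<Longrightarrow> continuous_on U f"
  by (cases k) auto

lemma pd_has_derivative: "(f has_derivative D) (at x) \<Longrightarrow> pd f b x = D b"
  unfolding pd_def using frechet_derivative_at by metis

text \<open>Agreement on a neighbourhood is required because \<open>pd\<close> is a full derivative
  at the point.\<close>

lemma pd_cong_open:
  assumes "open U" "x \<in> U" "\<And>y. y \<in> U \<Longrightarrow> f y = g y"
  shows "pd f b x = pd g b x"
proof -
  \<comment> \<open>The choice inside \<open>frechet_derivative\<close> then picks the same value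
    for both functions, even where no derivative exists.\<close>
  have "(f has_derivative D) (at x) \<longleftrightarrow> (g has_derivative D) (at x)" for D
    using assms has_derivative_transform_within_open[of f D x UNIV U g]
      has_derivative_transform_within_open[of g D x UNIV U f] by auto
  then show ?thesis
    unfolding pd_def frechet_derivative_def by simp
qed

lemma Ck_on_cong:
  assumes "open U" "\<And>y. y \<in> U \<Longrightarrow> f y = g y"
  shows "Ck_on k U f \<longleftrightarrow> Ck_on k U g"
  using assms(2)
proof (induction k arbitrary: f g)
  case 0
  then show ?case by (simp cong: continuous_on_cong)
next
  case (Suc k)
  have "Ck_on k U (pd f b) \<longleftrightarrow> Ck_on k U (pd g b)" for b
    by (rule Suc.IH) (rule pd_cong_open[OF assms(1) _ Suc.prems])
  moreover have "f differentiable_on U \<longleftrightarrow> g differentiable_on U"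
    using Suc.prems unfolding differentiable_on_def
    by (metis differentiable_transform_within zero_less_one)
  ultimately show ?case
    using continuous_on_cong[OF refl, of U f g] Suc.prems by auto
qed

lemma Ck_on_Suc_imp: "Ck_on (Suc k) U f \<Longrightarrow> Ck_on k U f"
  by (induction k arbitrary: f) auto

lemma Ck_on_subset: "Ck_on k U f \<Longrightarrow> V \<subseteq> U \<Longrightarrow> Ck_on k V f"
  by (induction k arbitrary: f)
    (auto intro: continuous_on_subset differentiable_on_subset)

lemma Ck_on_Un:
  assumes "open U" "open V"
  shows "Ck_on k U f \<Longrightarrow> Ck_on k V f \<Longrightarrow> Ck_on k (U \<union> V) f"
proof (induction k arbitrary: f)
  case 0
  then show ?case using assms continuous_on_open_Un by auto
next
  case (Suc k)
  then show ?case
    using assms continuous_on_open_Un[of U V f]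
    by (auto simp: differentiable_on_eq_differentiable_at open_Un)
qed

lemma Ck_on_differentiable:
  "open U \<Longrightarrow> Ck_on (Suc k) U f \<Longrightarrow> x \<in> U \<Longrightarrow> (f has_derivative (\<lambda>v. pd f v x)) (at x)"
  using frechet_derivative_works[of f "at x"]
  by (simp add: differentiable_on_eq_differentiable_at pd_def[abs_def])

text \<open>Trades the choice-based \<open>pd\<close> for an explicit derivative; the closure
  properties below go through this rule.\<close>

lemma Ck_on_SucI:
  assumes "open U" "\<And>x. x \<in> U \<Longrightarrow> (f has_derivative D x) (at x)"
    and "\<And>b. b \<in> Basis \<Longrightarrow> Ck_on k U (\<lambda>x. D x b)"
  shows "Ck_on (Suc k) U f"
proof -
  have "Ck_on k U (pd f b)" if "b \<in> Basis" for b
    using assms(3)[OF that] Ck_on_cong[OF assms(1), of "pd f b" "\<lambda>x. D x b"]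
      pd_has_derivative[OF assms(2)] by auto
  moreover have "f differentiable_on U"
    unfolding differentiable_on_def
    using assms(2) differentiable_def has_derivative_at_withinI by blast
  ultimately show ?thesis
    by (simp add: differentiable_imp_continuous_on)
qed

lemma Ck_on_const: "open U \<Longrightarrow> Ck_on k U (\<lambda>x. c)"
proof (induction k arbitrary: c)
  case (Suc k)
  show ?case
    by (rule Ck_on_SucI[where D = "\<lambda>x v. 0"]) (use Suc in auto)
qed auto

lemma Ck_on_inner_left: "open U \<Longrightarrow> Ck_on k U (\<lambda>x. x \<bullet> e)"
  by (cases k) (auto intro!: continuous_intros Ck_on_SucI[where D = "\<lambda>x v. v \<bullet> e"] derivative_eq_intros Ck_on_const simp del: Ck_on.simps(2))

lemma Ck_on_add:
  assumes "open U"
  shows "Ck_on k U f \<Longrightarrow> Ck_on k U g \<Longrightarrow> Ck_on k U (\<lambda>x. f x + g x)"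
proof (induction k arbitrary: f g)
  case (Suc k)
  show ?case
    by (rule Ck_on_SucI[where D = "\<lambda>x v. pd f v x + pd g v x"])
      (use Suc assms in \<open>auto intro!: derivative_intros Ck_on_differentiable simp del: Ck_on.simps(2)\<close>,
       use Suc in auto)
qed (auto intro: continuous_intros)

lemma Ck_on_mult:
  assumes "open U"
  shows "Ck_on k U f \<Longrightarrow> Ck_on k U g \<Longrightarrow> Ck_on k U (\<lambda>x. f x * g x)"
proof (induction k arbitrary: f g)
  case (Suc k)
  show ?case
  proof (rule Ck_on_SucI[where D = "\<lambda>x v. f x * pd g v x + pd f v x * g x"])
    fix b :: 'a assume b: "b \<in> Basis"
    have "Ck_on k U f" "Ck_on k U g" using Suc.prems Ck_on_Suc_imp by blast+
    then show "Ck_on k U (\<lambda>x. f x * pd g b x + pd f b x * g x)"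
      using Suc b by (intro Ck_on_add Suc.IH assms) auto
  qed (use Suc assms in \<open>auto intro!: has_derivative_mult Ck_on_differentiable simp del: Ck_on.simps(2)\<close>)
qed (auto intro: continuous_intros)

lemma Ck_on_sum:
  assumes "open U" "finite I" "\<And>i. i \<in> I \<Longrightarrow> Ck_on k U (f i)"
  shows "Ck_on k U (\<lambda>x. \<Sum>i\<in>I. f i x)"
  using assms(2,3)
  by (induction I rule: finite_induct) (auto intro!: Ck_on_const Ck_on_add assms(1))

text \<open>The outer function comes as a whole sequence of successive derivatives: the chain rule
  replaces \<open>G n\<close> by \<open>G (Suc n)\<close>, so the induction on \<open>k\<close> has
  to leave \<open>n\<close> arbitrary.\<close>

lemma Ck_on_compose:
  assumes "open U" "\<And>n y. y \<in> S \<Longrightarrow> (G n has_real_derivative G (Suc n) y) (at y)"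
    and "\<And>x. x \<in> U \<Longrightarrow> f x \<in> S"
  shows "Ck_on k U f \<Longrightarrow> Ck_on k U (\<lambda>x. G n (f x))"
proof (induction k arbitrary: n)
  case 0
  have "continuous_on S (G n)"
    by (metis DERIV_isCont assms(2) continuous_at_imp_continuous_on)
  with 0 show ?case
    using assms(3) continuous_on_compose2[of S "G n" U f] by auto
next
  case (Suc k)
  show ?case
  proof (rule Ck_on_SucI[where D = "\<lambda>x v. G (Suc n) (f x) * pd f v x"])
    fix b :: 'a assume b: "b \<in> Basis"
    show "Ck_on k U (\<lambda>x. G (Suc n) (f x) * pd f b x)"
      using Suc b Ck_on_Suc_imp by (intro Ck_on_mult assms Suc.IH) auto
  next
    fix x assume x: "x \<in> U"
    show "((\<lambda>x. G n (f x)) has_derivative (\<lambda>v. G (Suc n) (f x) * pd f v x)) (at x)"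
      using has_derivative_compose[OF Ck_on_differentiable[OF assms(1) Suc.prems x]
          assms(2)[OF assms(3)[OF x], unfolded has_field_derivative_def]] by simp
  qed (fact assms)
qed

lemma smooth_on_subset: "smooth_on U f \<Longrightarrow> V \<subseteq> U \<Longrightarrow> smooth_on V f"
  unfolding smooth_on_def using Ck_on_subset by blast

lemma smooth_on_cong:
  "open U \<Longrightarrow> (\<And>y. y \<in> U \<Longrightarrow> f y = g y) \<Longrightarrow> smooth_on U f \<longleftrightarrow> smooth_on U g"
  unfolding smooth_on_def using Ck_on_cong by blast

lemma smooth_on_Un: "open U \<Longrightarrow> open V \<Longrightarrow> smooth_on U f \<Longrightarrow> smooth_on V f \<Longrightarrow> smooth_on (U \<union> V) f"
  unfolding smooth_on_def using Ck_on_Un by blast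

lemma smooth_on_const: "open U \<Longrightarrow> smooth_on U (\<lambda>x. c)"
  unfolding smooth_on_def using Ck_on_const by blast

lemma smooth_on_inner: "open U \<Longrightarrow> smooth_on U (\<lambda>x. x \<bullet> e)"
  unfolding smooth_on_def using Ck_on_inner_left by blast

lemma smooth_on_add: "open U \<Longrightarrow> smooth_on U f \<Longrightarrow> smooth_on U g \<Longrightarrow> smooth_on U (\<lambda>x. f x + g x)"
  unfolding smooth_on_def using Ck_on_add by blast

lemma smooth_on_mult: "open U \<Longrightarrow> smooth_on U f \<Longrightarrow> smooth_on U g \<Longrightarrow> smooth_on U (\<lambda>x. f x * g x)"
  unfolding smooth_on_def using Ck_on_mult by blast

lemma smooth_on_diff: 
  assumes "open U" "smooth_on U f" "smooth_on U g" shows "smooth_on U (\<lambda>x. f x - g x)"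
  using smooth_on_add[OF assms(1,2) smooth_on_mult[OF assms(1) smooth_on_const[OF assms(1), of "-1"] assms(3)]]
  by simp

lemma smooth_on_compose:
  assumes "open U" "\<And>n y. y \<in> S \<Longrightarrow> (G n has_real_derivative G (Suc n) y) (at y)"
    and "\<And>x. x \<in> U \<Longrightarrow> f x \<in> S" "smooth_on U f"
  shows "smooth_on U (\<lambda>x. G n (f x))"
  unfolding smooth_on_def
proof
  fix k show "Ck_on k U (\<lambda>x. G n (f x))"
    using Ck_on_compose[of U S G f k n] assms unfolding smooth_on_def by blast
qed

lemma smooth_on_pd: "smooth_on U f \<Longrightarrow> b \<in> Basis \<Longrightarrow> smooth_on U (pd f b)"
  unfolding smooth_on_def by (metis Ck_on.simps(2))

lemma smooth_on_continuous: "smooth_on U f \<Longrightarrow> continuous_on U f"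
  unfolding smooth_on_def using Ck_on_imp_continuous by blast

lemma smooth_on_has_derivative:
  "open U \<Longrightarrow> smooth_on U f \<Longrightarrow> x \<in> U \<Longrightarrow> (f has_derivative (\<lambda>v. pd f v x)) (at x)"
  unfolding smooth_on_def using Ck_on_differentiable by blast

lemma smooth_on_inner_self: "open U \<Longrightarrow> smooth_on U (\<lambda>x. x \<bullet> x)"
  unfolding smooth_on_def
  by (subst euclidean_inner) (auto intro!: Ck_on_sum Ck_on_mult Ck_on_inner_left)

lemma smooth_on_powr:
  fixes f :: "'a::euclidean_space \<Rightarrow> real"
  assumes "open U" "smooth_on U f" "\<And>x. x \<in> U \<Longrightarrow> 0 < f x"
  shows "smooth_on U (\<lambda>x. f x powr a)"
proof -
  \<comment> \<open>The n-th derivative of the power: a falling factorial times the lowered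
    power.\<close>
  define G where "G n y = (\<Prod>i<n. a - real i) * y powr (a - real n)" for n and y :: real
  have "smooth_on U (\<lambda>x. G 0 (f x))"
  proof (rule smooth_on_compose[where S = "{0<..}" and G = G and f = f])
    show "(G n has_real_derivative G (Suc n) y) (at y)" if "y \<in> {0<..}" for n y
      using that unfolding G_def
      by (auto intro!: derivative_eq_intros simp: algebra_simps)
  qed (use assms in auto)
  then show ?thesis by (simp add: G_def)
qed

lemma smooth_on_inverse:
  fixes f :: "'a::euclidean_space \<Rightarrow> real"
  assumes "open U" "smooth_on U f" "\<And>x. x \<in> U \<Longrightarrow> 0 < f x"
  shows "smooth_on U (\<lambda>x. inverse (f x))"
  using smooth_on_powr[OF assms, of "-1"] smooth_on_cong[OF assms(1), of "\<lambda>x. f x powr (- 1)" "\<lambda>x. inverse (f x)"] assms(3)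
  by (simp add: powr_minus abs_of_pos)

lemma smooth_on_ln:
  fixes f :: "'a::euclidean_space \<Rightarrow> real"
  assumes "open U" "smooth_on U f" "\<And>x. x \<in> U \<Longrightarrow> 0 < f x"
  shows "smooth_on U (\<lambda>x. ln (f x))"
proof -
  \<comment> \<open>Index 0 is the logarithm itself; from index 1 on these are the derivatives of
    the power -1, shifted by one.\<close>
  define G where "G n y = (if n = 0 then ln y else (\<Prod>i<n-1. -1 - real i) * y powr (-1 - real (n-1)))" for n and y :: real
  have "smooth_on U (\<lambda>x. G 0 (f x))"
  proof (rule smooth_on_compose[where S = "{0<..}" and G = G and f = f])
    show "(G n has_real_derivative G (Suc n) y) (at y)" if "y \<in> {0<..}" for n y
    proof (cases n)
      case 0
      then show ?thesis using that unfolding G_def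
        by (auto intro!: derivative_eq_intros simp: powr_minus field_simps)
    next
      case (Suc m)
      then show ?thesis using that unfolding G_def
        by (auto intro!: derivative_eq_intros simp: algebra_simps)
    qed
  qed (use assms in auto)
  then show ?thesis by (simp add: G_def)
qed

lemma smooth_on_exp:
  fixes f :: "'a::euclidean_space \<Rightarrow> real"
  assumes "open U" "smooth_on U f"
  shows "smooth_on U (\<lambda>x. exp (f x))"
  by (rule smooth_on_compose[where S = UNIV and G = "\<lambda>n. exp"]) (use assms in auto)

section \<open>Flat functions: exp(-1/v) extended by zero, and its derivatives\<close>

lemma power_exp_le_fact:
  fixes y :: real assumes "0 \<le> y" shows "y ^ n * exp (- y) \<le> fact n"
proof -
  have "(\<Sum>i\<in>{n}. y ^ i /\<^sub>R fact i) \<le> (\<Sum>i. y ^ i /\<^sub>R fact i)"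
    by (rule sum_le_suminf[OF summable_exp_generic]) (use assms in auto)
  then have "y ^ n / fact n \<le> exp y"
    by (simp add: exp_def divide_inverse mult.commute)
  then show ?thesis
    by (simp add: exp_minus field_simps)
qed

text \<open>\<open>m\<close> is arbitrary because peeling one coefficient off the polynomial passes
  a factor \<open>y\<close> to the monomial.\<close>

lemma poly_exp_bounded:
  "\<exists>K. \<forall>y\<ge>0. y ^ m * \<bar>poly p y\<bar> * exp (- y) \<le> (K::real)"
proof (induction p arbitrary: m)
  case (pCons a p)
  obtain K where K: "\<And>y. y \<ge> 0 \<Longrightarrow> y ^ Suc m * \<bar>poly p y\<bar> * exp (- y) \<le> K"
    using pCons.IH[of "Suc m"] by blast
  show ?case
  proof (intro exI allI impI)
    fix y :: real assume y: "0 \<le> y"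
    have "y ^ m * \<bar>poly (pCons a p) y\<bar> * exp (- y) \<le> y ^ m * (\<bar>a\<bar> + y * \<bar>poly p y\<bar>) * exp (- y)"
      using y abs_triangle_ineq[of a "y * poly p y"]
      by (intro mult_right_mono mult_left_mono) (auto simp: abs_mult)
    also have "\<dots> = \<bar>a\<bar> * (y ^ m * exp (- y)) + y ^ Suc m * \<bar>poly p y\<bar> * exp (- y)"
      by (simp add: algebra_simps)
    also have "\<dots> \<le> \<bar>a\<bar> * fact m + K"
      using K[OF y] power_exp_le_fact[OF y, of m] by (intro add_mono mult_left_mono) auto
    finally show "y ^ m * \<bar>poly (pCons a p) y\<bar> * exp (- y) \<le> \<bar>a\<bar> * fact m + K" .
  qed
qed auto

text \<open>This family is closed under differentiation, so smoothness across the origin is obtained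
  for all orders at once.\<close>

definition flat_exp :: "real poly \<Rightarrow> real \<Rightarrow> real" where
  "flat_exp p v = (if v \<le> 0 then 0 else poly p (1 / v) * exp (- (1 / v)))"

text \<open>With y = 1/v one has d/dv = - y^2 d/dy, and differentiating p(y) exp(-y) produces the
  new polynomial y^2 (p - p').\<close>

definition flat_step :: "real poly \<Rightarrow> real poly" where
  "flat_step p = [:0, 0, 1:] * (p - pderiv p)"

text \<open>With y = 1/v this is boundedness of y^2 |p(y)| exp(-y). A quadratic bound is what makes
  the difference quotients at 0 tend to 0.\<close>

lemma flat_exp_quadratic: "\<exists>K. \<forall>v. \<bar>flat_exp p v\<bar> \<le> K * v\<^sup>2"
proof -
  obtain K where K: "\<And>y. y \<ge> 0 \<Longrightarrow> y ^ 2 * \<bar>poly p y\<bar> * exp (- y) \<le> K"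
    using poly_exp_bounded by blast
  have "\<bar>flat_exp p v\<bar> \<le> K * v\<^sup>2" for v
  proof (cases "v \<le> 0")
    case True
    have "0 \<le> K" using K[of 0] by simp
    with True show ?thesis by (simp add: flat_exp_def)
  next
    case False
    then show ?thesis
      using K[of "1 / v"] by (simp add: flat_exp_def abs_mult field_simps)
  qed
  then show ?thesis by blast
qed

lemma flat_exp_deriv: "(flat_exp p has_real_derivative flat_exp (flat_step p) v) (at v)"
proof -
  consider "v < 0" | "v = 0" | "v > 0" by linarith
  then show ?thesis
  proof cases
    case 1
    have "((\<lambda>v. 0) has_real_derivative 0) (at v)" by simp
    from has_field_derivative_transform_within_open[OF this, of "{..<0}" "flat_exp p"]
    show ?thesis using 1 by (simp add: flat_exp_def)
  next
    case 2
    obtain K where K: "\<And>v. \<bar>flat_exp p v\<bar> \<le> K * v\<^sup>2" using flat_exp_quadratic by blast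
    have "((\<lambda>h. (flat_exp p (0 + h) - flat_exp p 0) / h) \<longlongrightarrow> 0) (at 0)"
    proof (rule Lim_null_comparison)
      show "\<forall>\<^sub>F h in at 0. norm ((flat_exp p (0 + h) - flat_exp p 0) / h) \<le> K * \<bar>h\<bar>"
        unfolding eventually_at_filter
      proof (intro always_eventually allI impI)
        fix h :: real assume "h \<noteq> 0"
        have "\<bar>flat_exp p h\<bar> \<le> (K * \<bar>h\<bar>) * \<bar>h\<bar>"
          using K[of h] by (simp add: power2_eq_square mult.assoc)
        then have "\<bar>flat_exp p h\<bar> / \<bar>h\<bar> \<le> K * \<bar>h\<bar>"
          using \<open>h \<noteq> 0\<close> by (simp add: pos_divide_le_eq)
        moreover have "flat_exp p 0 = 0" by (simp add: flat_exp_def)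
        ultimately show "norm ((flat_exp p (0 + h) - flat_exp p 0) / h) \<le> K * \<bar>h\<bar>"
          by (simp only: diff_zero add_0_left real_norm_def abs_divide)
      qed
      show "((\<lambda>h. K * \<bar>h\<bar>) \<longlongrightarrow> 0) (at 0)"
        by (auto intro!: tendsto_eq_intros)
    qed
    then show ?thesis using 2 by (simp add: DERIV_def flat_exp_def)
  next
    case 3
    have i: "((\<lambda>v. 1 / v) has_real_derivative - (1 / v\<^sup>2)) (at v)"
      using 3 by (auto intro!: derivative_eq_intros simp: power2_eq_square)
    have "((\<lambda>v. poly p (1 / v) * exp (- (1 / v))) has_real_derivative
        poly p (1 / v) * (exp (- (1 / v)) * (1 / v\<^sup>2)) + (poly (pderiv p) (1 / v) * - (1 / v\<^sup>2)) * exp (- (1 / v))) (at v)"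
      by (rule derivative_eq_intros DERIV_chain2[OF poly_DERIV] i refl)+ simp
    moreover have "poly p (1 / v) * (exp (- (1 / v)) * (1 / v\<^sup>2)) + (poly (pderiv p) (1 / v) * - (1 / v\<^sup>2)) * exp (- (1 / v))
        = flat_exp (flat_step p) v"
      using 3 by (simp add: flat_exp_def flat_step_def) (simp add: field_simps power2_eq_square)
    ultimately have "((\<lambda>v. poly p (1 / v) * exp (- (1 / v))) has_real_derivative flat_exp (flat_step p) v) (at v)"
      by simp
    from has_field_derivative_transform_within_open[OF this, of "{0<..}" "flat_exp p"]
    show ?thesis using 3 by (simp add: flat_exp_def)
  qed
qed

text \<open>The members of the flat family up to the second derivative are spelled out, since the
  later estimates compare them as polynomials in 1/v.\<close>

definition bexp :: "real \<Rightarrow> real" where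
  "bexp v = (if v \<le> 0 then 0 else exp (- (1 / v)))"

definition bexp1 :: "real \<Rightarrow> real" where
  "bexp1 v = (if v \<le> 0 then 0 else exp (- (1 / v)) / v\<^sup>2)"

definition bexp2 :: "real \<Rightarrow> real" where
  "bexp2 v = (if v \<le> 0 then 0 else exp (- (1 / v)) * (1 / v ^ 4 - 2 / v ^ 3))"

lemma bexp_flat: "bexp = flat_exp 1" "bexp1 = flat_exp (flat_step 1)"
  "bexp2 = flat_exp (flat_step (flat_step 1))"
proof -
  have 1: "flat_step 1 = [:0, 0, 1:]"
    by (simp add: flat_step_def pderiv_1)
  have 2: "flat_step [:0, 0, 1:] = [:0, 0, 0, -2, 1:]"
    by (simp add: flat_step_def pderiv_pCons)
  show "bexp = flat_exp 1" by (auto simp: fun_eq_iff bexp_def flat_exp_def)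
  show "bexp1 = flat_exp (flat_step 1)"
    by (auto simp: fun_eq_iff bexp1_def flat_exp_def 1 power2_eq_square)
  have "exp (- (1 / v)) * (1 / v ^ 4 - 2 / v ^ 3) = poly [:0, 0, 0, -2, 1:] (1 / v) * exp (- (1 / v))"
    if "v > 0" for v :: real
    using that by (simp add: field_simps power3_eq_cube power4_eq_xxxx)
  then show "bexp2 = flat_exp (flat_step (flat_step 1))"
    unfolding 1 2 by (auto simp: fun_eq_iff bexp2_def flat_exp_def)
qed

lemma bexp_DERIV: "(bexp has_real_derivative bexp1 v) (at v)"
  and bexp1_DERIV: "(bexp1 has_real_derivative bexp2 v) (at v)"
  unfolding bexp_flat by (rule flat_exp_deriv)+

lemma bexp_nonneg: "0 \<le> bexp v" and bexp1_nonneg: "0 \<le> bexp1 v"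
  by (auto simp: bexp_def bexp1_def)

lemma smooth_on_bexp:
  fixes f :: "'a::euclidean_space \<Rightarrow> real"
  assumes "open U" "smooth_on U f"
  shows "smooth_on U (\<lambda>x. bexp (f x))"
proof -
  have "smooth_on U (\<lambda>x. (\<lambda>n. flat_exp ((flat_step ^^ n) 1)) 0 (f x))"
    by (rule smooth_on_compose[where S = UNIV]) (use assms flat_exp_deriv in auto)
  then show ?thesis by (simp add: bexp_flat)
qed

section \<open>Gradients and Laplacians\<close>

text \<open>The Laplacian is recorded as the trace of the derivative of a gradient field. Sum,
  product and chain rules then hold as vector identities, and partial derivatives reappear only in
  \<open>has_grad_lap_laplacian\<close>.\<close>

definition has_grad_lap :: "'a::euclidean_space set \<Rightarrow> ('a \<Rightarrow> real) \<Rightarrow> ('a \<Rightarrow> 'a) \<Rightarrow> ('a \<Rightarrow> real) \<Rightarrow> bool" where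
  "has_grad_lap U f G l \<longleftrightarrow> open U \<and> (\<forall>x\<in>U. (f has_derivative (\<lambda>v. G x \<bullet> v)) (at x)) \<and>
     (\<forall>x\<in>U. \<exists>H. (G has_derivative H) (at x) \<and> (\<Sum>b\<in>Basis. H b \<bullet> b) = l x)"

lemma has_grad_lap_eqI:
  "has_grad_lap U f G l \<Longrightarrow> (\<And>x. x \<in> U \<Longrightarrow> l x = l' x) \<Longrightarrow> has_grad_lap U f G l'"
  unfolding has_grad_lap_def by simp

lemma has_grad_lap_pd: "has_grad_lap U f G l \<Longrightarrow> x \<in> U \<Longrightarrow> pd f b x = G x \<bullet> b"
  unfolding has_grad_lap_def using pd_has_derivative by blast

lemma has_grad_lap_laplacian:
  assumes "has_grad_lap U f G l" "x \<in> U" shows "laplacian f x = l x"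
proof -
  obtain H where H: "(G has_derivative H) (at x)" "(\<Sum>b\<in>Basis. H b \<bullet> b) = l x"
    using assms unfolding has_grad_lap_def by blast
  have "pd (pd f b) b x = H b \<bullet> b" for b
  proof -
    have "pd (pd f b) b x = pd (\<lambda>x. G x \<bullet> b) b x"
      using assms has_grad_lap_pd[OF assms(1)] by (intro pd_cong_open[of U]) (auto simp: has_grad_lap_def)
    also have "\<dots> = H b \<bullet> b"
      using H(1) by (intro pd_has_derivative has_derivative_inner_left)
    finally show ?thesis .
  qed
  then show ?thesis using H(2) by (simp add: laplacian_def)
qed

lemma has_grad_lap_const: "open U \<Longrightarrow> has_grad_lap U (\<lambda>x. c) (\<lambda>x. 0) (\<lambda>x. 0)"
  unfolding has_grad_lap_def by (auto intro!: exI[of _ "\<lambda>v. 0"] derivative_eq_intros)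

lemma has_grad_lap_inner: "open U \<Longrightarrow> has_grad_lap U (\<lambda>x. x \<bullet> e) (\<lambda>x. e) (\<lambda>x. 0)"
  unfolding has_grad_lap_def
  by (auto intro!: exI[of _ "\<lambda>v. 0"] derivative_eq_intros simp: inner_commute)

lemma has_grad_lap_inner_self:
  "open U \<Longrightarrow> has_grad_lap U (\<lambda>x::'a::euclidean_space. x \<bullet> x) (\<lambda>x. 2 *\<^sub>R x) (\<lambda>x. 2 * real DIM('a))"
  unfolding has_grad_lap_def
  by (auto intro!: exI[of _ "\<lambda>v. 2 *\<^sub>R v"] derivative_eq_intros simp: inner_commute)

lemma has_grad_lap_add:
  assumes "has_grad_lap U f G l" "has_grad_lap U f' G' l'"
  shows "has_grad_lap U (\<lambda>x. f x + f' x) (\<lambda>x. G x + G' x) (\<lambda>x. l x + l' x)"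
  unfolding has_grad_lap_def
proof (intro conjI ballI)
  fix x assume "x \<in> U"
  with assms obtain H H' where H: "(G has_derivative H) (at x)" "(\<Sum>b\<in>Basis. H b \<bullet> b) = l x"
    "(G' has_derivative H') (at x)" "(\<Sum>b\<in>Basis. H' b \<bullet> b) = l' x"
    unfolding has_grad_lap_def by blast
  then show "\<exists>H. ((\<lambda>x. G x + G' x) has_derivative H) (at x) \<and> (\<Sum>b\<in>Basis. H b \<bullet> b) = l x + l' x"
    by (intro exI[of _ "\<lambda>v. H v + H' v"]) (auto intro!: derivative_intros simp: inner_add_left sum.distrib)
  show "((\<lambda>x. f x + f' x) has_derivative (\<bullet>) (G x + G' x)) (at x)"
    using assms \<open>x \<in> U\<close> unfolding has_grad_lap_def inner_add_left by (intro has_derivative_add) auto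
qed (use assms has_grad_lap_def in auto)

lemma has_grad_lap_mult:
  assumes "has_grad_lap U f G l" "has_grad_lap U f' G' l'"
  shows "has_grad_lap U (\<lambda>x. f x * f' x) (\<lambda>x. f x *\<^sub>R G' x + f' x *\<^sub>R G x)
    (\<lambda>x. f x * l' x + f' x * l x + 2 * (G x \<bullet> G' x))"
  unfolding has_grad_lap_def
proof (intro conjI ballI)
  fix x assume x: "x \<in> U"
  with assms obtain H H' where H: "(G has_derivative H) (at x)" "(\<Sum>b\<in>Basis. H b \<bullet> b) = l x"
    "(G' has_derivative H') (at x)" "(\<Sum>b\<in>Basis. H' b \<bullet> b) = l' x"
    unfolding has_grad_lap_def by blast
  have f: "(f has_derivative (\<lambda>v. G x \<bullet> v)) (at x)" "(f' has_derivative (\<lambda>v. G' x \<bullet> v)) (at x)"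
    using assms x unfolding has_grad_lap_def by auto
  have [simp]: "(\<Sum>b\<in>Basis. (G x \<bullet> b) * (G' x \<bullet> b)) = G x \<bullet> G' x"
    by (rule euclidean_inner[symmetric])
  have [simp]: "(\<Sum>b\<in>Basis. (G' x \<bullet> b) * (G x \<bullet> b)) = G x \<bullet> G' x"
    using euclidean_inner[of "G' x" "G x"] by (simp add: inner_commute)
  show "\<exists>H. ((\<lambda>x. f x *\<^sub>R G' x + f' x *\<^sub>R G x) has_derivative H) (at x) \<and>
      (\<Sum>b\<in>Basis. H b \<bullet> b) = f x * l' x + f' x * l x + 2 * (G x \<bullet> G' x)"
    using H f by (intro exI[of _ "\<lambda>v. (f x *\<^sub>R H' v + (G x \<bullet> v) *\<^sub>R G' x) + (f' x *\<^sub>R H v + (G' x \<bullet> v) *\<^sub>R G x)"])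
      (auto intro!: has_derivative_add has_derivative_scaleR
        simp: inner_add_left sum.distrib sum_distrib_left[symmetric])
  show "((\<lambda>x. f x * f' x) has_derivative (\<bullet>) (f x *\<^sub>R G' x + f' x *\<^sub>R G x)) (at x)"
    unfolding inner_add_left inner_scaleR_left
    using has_derivative_mult[OF f] by (simp only: mult.commute[of "f' x"])
qed (use assms has_grad_lap_def in auto)

lemma has_grad_lap_compose:
  assumes "has_grad_lap U f G l"
    and "\<And>y. y \<in> S \<Longrightarrow> (h has_real_derivative h1 y) (at y)"
    and "\<And>y. y \<in> S \<Longrightarrow> (h1 has_real_derivative h2 y) (at y)"
    and "\<And>x. x \<in> U \<Longrightarrow> f x \<in> S"
  shows "has_grad_lap U (\<lambda>x. h (f x)) (\<lambda>x. h1 (f x) *\<^sub>R G x) (\<lambda>x. h1 (f x) * l x + h2 (f x) * (G x \<bullet> G x))"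
  unfolding has_grad_lap_def
proof (intro conjI ballI)
  fix x assume x: "x \<in> U"
  with assms obtain H where H: "(G has_derivative H) (at x)" "(\<Sum>b\<in>Basis. H b \<bullet> b) = l x"
    unfolding has_grad_lap_def by metis
  have f: "(f has_derivative (\<lambda>v. G x \<bullet> v)) (at x)"
    using assms x unfolding has_grad_lap_def by auto
  have h: "(h has_derivative (*) (h1 (f x))) (at (f x))" "(h1 has_derivative (*) (h2 (f x))) (at (f x))"
    using assms(2,3)[OF assms(4)[OF x]] unfolding has_field_derivative_def by auto
  have [simp]: "(\<Sum>b\<in>Basis. (G x \<bullet> b) * (G x \<bullet> b)) = G x \<bullet> G x"
    by (rule euclidean_inner[symmetric])
  show "\<exists>H. ((\<lambda>x. h1 (f x) *\<^sub>R G x) has_derivative H) (at x) \<and>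
      (\<Sum>b\<in>Basis. H b \<bullet> b) = h1 (f x) * l x + h2 (f x) * (G x \<bullet> G x)"
    using H f by (intro exI[of _ "\<lambda>v. h1 (f x) *\<^sub>R H v + (h2 (f x) * (G x \<bullet> v)) *\<^sub>R G x"])
      (auto intro!: has_derivative_scaleR has_derivative_compose[OF f h(2)]
        simp: inner_add_left sum.distrib sum_distrib_left[symmetric] mult.assoc)
  show "((\<lambda>x. h (f x)) has_derivative (\<bullet>) (h1 (f x) *\<^sub>R G x)) (at x)"
    unfolding inner_scaleR_left using has_derivative_compose[OF f h(1)] .
qed (use assms(1) has_grad_lap_def in auto)

lemma has_grad_lap_cong:
  assumes "has_grad_lap U f G l" "\<And>x. x \<in> U \<Longrightarrow> G x = G' x" "\<And>x. x \<in> U \<Longrightarrow> l x = l' x"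
  shows "has_grad_lap U f G' l'"
  unfolding has_grad_lap_def
proof (intro conjI ballI)
  fix x assume x: "x \<in> U"
  with assms obtain H where H: "(G has_derivative H) (at x)" "(\<Sum>b\<in>Basis. H b \<bullet> b) = l x"
    unfolding has_grad_lap_def by blast
  have "(G' has_derivative H) (at x)"
    using has_derivative_transform_within_open[OF H(1)] x assms unfolding has_grad_lap_def by blast
  then show "\<exists>H. (G' has_derivative H) (at x) \<and> (\<Sum>b\<in>Basis. H b \<bullet> b) = l' x"
    using H(2) assms(3)[OF x] by auto
  show "(f has_derivative (\<bullet>) (G' x)) (at x)"
    using assms x unfolding has_grad_lap_def by auto
qed (use assms(1) has_grad_lap_def in auto)

section \<open>Kelvin-transformed product functions\<close>

text \<open>Let \<open>z = x / |x|\<^sup>2 - h e\<close> be the inversion followed by a shift; it maps the ball touching the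
  hyperplane orthogonal to \<open>e\<close> at the origin onto the half-space of positive \<open>e\<close>-component (for
  \<open>h < 0\<close>, the complement of a ball). Below, \<open>kelvin_A\<close> is that component of \<open>z\<close>,
  \<open>kelvin_B\<close> is \<open>|z|\<^sup>2\<close>, \<open>kelvin_Y\<close> is \<open>|x|\<close> to the power \<open>-2\<close>, and \<open>kelvin_C\<close>
  is the Kelvin factor \<open>|x|\<close> to the power \<open>2 - N\<close>.\<close>

definition kelvin_Y :: "'a::euclidean_space \<Rightarrow> real" where
  "kelvin_Y x = inverse (x \<bullet> x)"

definition kelvin_P :: "'a::euclidean_space \<Rightarrow> 'a \<Rightarrow> real" where
  "kelvin_P e x = (x \<bullet> e) * kelvin_Y x"

definition kelvin_A :: "'a::euclidean_space \<Rightarrow> real \<Rightarrow> 'a \<Rightarrow> real" where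
  "kelvin_A e h x = kelvin_P e x - h"

definition kelvin_B :: "'a::euclidean_space \<Rightarrow> real \<Rightarrow> 'a \<Rightarrow> real" where
  "kelvin_B e h x = kelvin_Y x - 2 * h * kelvin_P e x + h\<^sup>2"

definition kelvin_C :: "'a::euclidean_space \<Rightarrow> real" where
  "kelvin_C x = kelvin_Y x powr (real DIM('a) / 2 - 1)"

lemma kelvin_Y_pos: "x \<noteq> 0 \<Longrightarrow> 0 < kelvin_Y x"
  by (simp add: kelvin_Y_def)

lemma kelvin_C_pos: "x \<noteq> 0 \<Longrightarrow> 0 < kelvin_C x"
  by (simp add: kelvin_C_def kelvin_Y_def)

lemma kelvin_Y_norm: "kelvin_Y x = 1 / (norm x)\<^sup>2"
  by (simp add: kelvin_Y_def power2_norm_eq_inner inverse_eq_divide)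

text \<open>For a unit vector e this expands |z + h e|^2, where z + h e is the inverted point. With
  \<open>h > 0\<close> and positive \<open>kelvin_A\<close> it gives |z|^2 < |x|^(-2); for negative
  \<open>h\<close> the term linear in \<open>h\<close> changes sign, which is the unfavourable
  direction met in the lower Hardy bound.\<close>

lemma kelvin_Y_kelvin_B: "kelvin_Y x = kelvin_B e h x + 2 * h * kelvin_A e h x + h\<^sup>2"
  by (simp add: kelvin_A_def kelvin_B_def algebra_simps power2_eq_square)

lemma kelvin_P_square_le:
  assumes "norm e = 1" shows "(kelvin_P e x)\<^sup>2 \<le> kelvin_Y x"
proof (cases "x = 0")
  case False
  have "(x \<bullet> e)\<^sup>2 \<le> x \<bullet> x"
    using Cauchy_Schwarz_ineq[of x e] assms by (simp add: norm_eq_1)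
  then have "(x \<bullet> e)\<^sup>2 * (kelvin_Y x * kelvin_Y x) \<le> (x \<bullet> x) * (kelvin_Y x * kelvin_Y x)"
    by (intro mult_right_mono) auto
  moreover have "(x \<bullet> x) * kelvin_Y x = 1" using False by (simp add: kelvin_Y_def)
  ultimately show ?thesis
    by (simp add: kelvin_P_def power2_eq_square mult.assoc[symmetric]) (simp add: algebra_simps)
qed (simp add: kelvin_P_def kelvin_Y_def)

text \<open>A component of z is at most |z|; after cancelling the terms in \<open>h\<close> this is
  \<open>kelvin_P_square_le\<close>.\<close>

lemma kelvin_A_square_le: "norm e = 1 \<Longrightarrow> (kelvin_A e h x)\<^sup>2 \<le> kelvin_B e h x"
  using kelvin_P_square_le[of e x] by (simp add: kelvin_A_def kelvin_B_def power2_diff algebra_simps)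

lemma has_grad_lap_kelvin_Y:
  assumes "open U" "0 \<notin> U"
  shows "has_grad_lap U (kelvin_Y :: 'a::euclidean_space \<Rightarrow> real) (\<lambda>x. (- 2 * (kelvin_Y x)\<^sup>2) *\<^sub>R x) (\<lambda>x. (8 - 2 * real DIM('a)) * (kelvin_Y x)\<^sup>2)"
proof -
  have nz: "x \<bullet> x \<noteq> 0" if "x \<in> U" for x using that assms by auto
  have "has_grad_lap U (\<lambda>x. inverse (x \<bullet> x)) (\<lambda>x. - (inverse ((x \<bullet> x)\<^sup>2)) *\<^sub>R (2 *\<^sub>R x))
    (\<lambda>x. - (inverse ((x \<bullet> x)\<^sup>2)) * (2 * real DIM('a)) + 2 * inverse ((x \<bullet> x) ^ 3) * (2 *\<^sub>R x \<bullet> 2 *\<^sub>R x))"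
    by (rule has_grad_lap_compose[OF has_grad_lap_inner_self[OF assms(1)], where S = "{0<..}"])
      (use nz in \<open>auto intro!: derivative_eq_intros simp: power2_eq_square power3_eq_cube field_simps\<close>)
  then have "has_grad_lap U (\<lambda>x. inverse (x \<bullet> x)) (\<lambda>x. (- 2 * (kelvin_Y x)\<^sup>2) *\<^sub>R x) (\<lambda>x. (8 - 2 * real DIM('a)) * (kelvin_Y x)\<^sup>2)"
  proof (rule has_grad_lap_cong)
    fix x assume x: "x \<in> U"
    show "- inverse ((x \<bullet> x)\<^sup>2) *\<^sub>R 2 *\<^sub>R x = (- 2 * (kelvin_Y x)\<^sup>2) *\<^sub>R x"
      by (simp add: kelvin_Y_def power_inverse)
    show "- (inverse ((x \<bullet> x)\<^sup>2)) * (2 * real DIM('a)) + 2 * inverse ((x \<bullet> x) ^ 3) * (2 *\<^sub>R x \<bullet> 2 *\<^sub>R x)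
        = (8 - 2 * real DIM('a)) * (kelvin_Y x)\<^sup>2"
      using nz[OF x] by (simp add: kelvin_Y_def field_simps power2_eq_square power3_eq_cube)
  qed
  then show ?thesis by (simp add: kelvin_Y_def[abs_def])
qed

lemma has_grad_lap_kelvin_P:
  fixes e :: "'a::euclidean_space"
  assumes "open U" "0 \<notin> U"
  shows "has_grad_lap U (kelvin_P e) (\<lambda>x. kelvin_Y x *\<^sub>R e - (2 * kelvin_Y x * kelvin_P e x) *\<^sub>R x)
    (\<lambda>x. (4 - 2 * real DIM('a)) * (kelvin_Y x * kelvin_P e x))"
proof -
  have "has_grad_lap U (\<lambda>x. (x \<bullet> e) * kelvin_Y x) (\<lambda>x. kelvin_Y x *\<^sub>R e - (2 * kelvin_Y x * kelvin_P e x) *\<^sub>R x)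
    (\<lambda>x. (4 - 2 * real DIM('a)) * (kelvin_Y x * kelvin_P e x))"
    by (rule has_grad_lap_cong[OF has_grad_lap_mult[OF has_grad_lap_inner[OF assms(1)] has_grad_lap_kelvin_Y[OF assms]]])
      (auto simp: kelvin_P_def power2_eq_square algebra_simps inner_commute)
  then show ?thesis by (simp add: kelvin_P_def[abs_def])
qed

lemma has_grad_lap_kelvin_A:
  fixes e :: "'a::euclidean_space"
  assumes "open U" "0 \<notin> U"
  shows "has_grad_lap U (kelvin_A e h) (\<lambda>x. kelvin_Y x *\<^sub>R e - (2 * kelvin_Y x * kelvin_P e x) *\<^sub>R x)
    (\<lambda>x. (4 - 2 * real DIM('a)) * (kelvin_Y x * kelvin_P e x))"
proof -
  have "has_grad_lap U (\<lambda>x. kelvin_P e x + - h) (\<lambda>x. kelvin_Y x *\<^sub>R e - (2 * kelvin_Y x * kelvin_P e x) *\<^sub>R x)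
    (\<lambda>x. (4 - 2 * real DIM('a)) * (kelvin_Y x * kelvin_P e x))"
    by (rule has_grad_lap_cong[OF has_grad_lap_add[OF has_grad_lap_kelvin_P[OF assms] has_grad_lap_const[OF assms(1)]]]) auto
  then show ?thesis by (simp add: kelvin_A_def[abs_def])
qed

lemma has_grad_lap_kelvin_B:
  fixes e :: "'a::euclidean_space"
  assumes "open U" "0 \<notin> U"
  shows "has_grad_lap U (kelvin_B e h) (\<lambda>x. (- 2 * (kelvin_Y x)\<^sup>2 + 4 * h * (kelvin_Y x * kelvin_P e x)) *\<^sub>R x - (2 * h * kelvin_Y x) *\<^sub>R e)
    (\<lambda>x. (8 - 2 * real DIM('a)) * (kelvin_Y x)\<^sup>2 - 2 * h * ((4 - 2 * real DIM('a)) * (kelvin_Y x * kelvin_P e x)))"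
proof -
  have "has_grad_lap U (\<lambda>x. (kelvin_Y x + (- 2 * h) * kelvin_P e x) + h\<^sup>2) (\<lambda>x. (- 2 * (kelvin_Y x)\<^sup>2 + 4 * h * (kelvin_Y x * kelvin_P e x)) *\<^sub>R x - (2 * h * kelvin_Y x) *\<^sub>R e)
    (\<lambda>x. (8 - 2 * real DIM('a)) * (kelvin_Y x)\<^sup>2 - 2 * h * ((4 - 2 * real DIM('a)) * (kelvin_Y x * kelvin_P e x)))"
    by (rule has_grad_lap_cong[OF has_grad_lap_add[OF has_grad_lap_add[OF has_grad_lap_kelvin_Y[OF assms]
        has_grad_lap_mult[OF has_grad_lap_const[OF assms(1)] has_grad_lap_kelvin_P[OF assms]]] has_grad_lap_const[OF assms(1)]]])
      (auto simp: algebra_simps)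
  then show ?thesis by (simp add: kelvin_B_def[abs_def])
qed

text \<open>The exponent is that of the Newtonian kernel, whose harmonicity removes the zeroth order
  term from the transformed Laplacian.\<close>

lemma has_grad_lap_kelvin_C:
  assumes "open U" "0 \<notin> U"
  shows "has_grad_lap U (kelvin_C :: 'a::euclidean_space \<Rightarrow> real) (\<lambda>x. ((2 - real DIM('a)) * (kelvin_C x * kelvin_Y x)) *\<^sub>R x) (\<lambda>x. 0)"
proof -
  define a where "a = real DIM('a) / 2 - 1"
  have Y: "kelvin_Y x > 0" if "x \<in> U" for x using that assms kelvin_Y_pos by metis
  have "has_grad_lap U (\<lambda>x. kelvin_Y x powr a) (\<lambda>x. (a * kelvin_Y x powr (a - 1)) *\<^sub>R ((- 2 * (kelvin_Y x)\<^sup>2) *\<^sub>R x))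
    (\<lambda>x. a * kelvin_Y x powr (a - 1) * ((8 - 2 * real DIM('a)) * (kelvin_Y x)\<^sup>2) +
       a * (a - 1) * kelvin_Y x powr (a - 2) * (((- 2 * (kelvin_Y x)\<^sup>2) *\<^sub>R x) \<bullet> ((- 2 * (kelvin_Y x)\<^sup>2) *\<^sub>R x)))"
    by (rule has_grad_lap_compose[OF has_grad_lap_kelvin_Y[OF assms], where S = "{0<..}"])
      (use Y in \<open>auto intro!: derivative_eq_intros simp: algebra_simps\<close>)
  then have "has_grad_lap U (\<lambda>x. kelvin_Y x powr a) (\<lambda>x. ((2 - real DIM('a)) * (kelvin_C x * kelvin_Y x)) *\<^sub>R x) (\<lambda>x. 0)"
  proof (rule has_grad_lap_cong)
    fix x assume x: "x \<in> U"
    have p: "kelvin_Y x powr (a - 1) = kelvin_C x / kelvin_Y x" "kelvin_Y x powr (a - 2) = kelvin_C x / (kelvin_Y x)\<^sup>2"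
      using Y[OF x] by (simp_all add: kelvin_C_def a_def[symmetric] powr_diff powr_numeral)
    show "(a * kelvin_Y x powr (a - 1)) *\<^sub>R ((- 2 * (kelvin_Y x)\<^sup>2) *\<^sub>R x) = ((2 - real DIM('a)) * (kelvin_C x * kelvin_Y x)) *\<^sub>R x"
    proof -
      have "a * (kelvin_C x / kelvin_Y x) * (- 2 * (kelvin_Y x)\<^sup>2) = (2 - real DIM('a)) * (kelvin_C x * kelvin_Y x)"
        using Y[OF x] by (simp add: a_def field_simps power2_eq_square)
      then show ?thesis unfolding p scaleR_scaleR by (simp only:)
    qed
    have xx: "x \<bullet> x = 1 / kelvin_Y x" by (simp add: kelvin_Y_def inverse_eq_divide)
    show "a * kelvin_Y x powr (a - 1) * ((8 - 2 * real DIM('a)) * (kelvin_Y x)\<^sup>2) +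
       a * (a - 1) * kelvin_Y x powr (a - 2) * (((- 2 * (kelvin_Y x)\<^sup>2) *\<^sub>R x) \<bullet> ((- 2 * (kelvin_Y x)\<^sup>2) *\<^sub>R x)) = 0"
      using Y[OF x] unfolding p inner_scaleR_left inner_scaleR_right xx
      by (simp add: a_def field_simps power2_eq_square)
  qed
  then show ?thesis by (simp add: kelvin_C_def[abs_def] a_def)
qed

text \<open>The bracket is the Laplacian, taken in z, of f(z.e) k(|z|^2). The lemma is the
  intertwining property of the Kelvin transform, with conformal weight |x|^(-2-N), for functions of
  this shape.\<close>

lemma kelvin_laplacian:
  fixes e :: "'a::euclidean_space"
  assumes U: "open U" "0 \<notin> U" and e: "norm e = 1" and B: "\<And>x. x \<in> U \<Longrightarrow> 0 < kelvin_B e h x"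
    and f: "\<And>y. (f has_real_derivative f1 y) (at y)" "\<And>y. (f1 has_real_derivative f2 y) (at y)"
    and k: "\<And>y. 0 < y \<Longrightarrow> (k has_real_derivative k1 y) (at y)" "\<And>y. 0 < y \<Longrightarrow> (k1 has_real_derivative k2 y) (at y)"
  shows "\<exists>G. has_grad_lap U (\<lambda>x. kelvin_C x * (f (kelvin_A e h x) * k (kelvin_B e h x))) G
    (\<lambda>x. kelvin_C x * (kelvin_Y x)\<^sup>2 * (k (kelvin_B e h x) * f2 (kelvin_A e h x)
      + f (kelvin_A e h x) * (2 * real DIM('a) * k1 (kelvin_B e h x) + 4 * kelvin_B e h x * k2 (kelvin_B e h x))
      + 4 * kelvin_A e h x * f1 (kelvin_A e h x) * k1 (kelvin_B e h x)))"
proof -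
  have gA: "has_grad_lap U (\<lambda>x. f (kelvin_A e h x)) (\<lambda>x. f1 (kelvin_A e h x) *\<^sub>R (kelvin_Y x *\<^sub>R e - (2 * kelvin_Y x * kelvin_P e x) *\<^sub>R x))
    (\<lambda>x. f1 (kelvin_A e h x) * ((4 - 2 * real DIM('a)) * (kelvin_Y x * kelvin_P e x)) + f2 (kelvin_A e h x) *
      ((kelvin_Y x *\<^sub>R e - (2 * kelvin_Y x * kelvin_P e x) *\<^sub>R x) \<bullet> (kelvin_Y x *\<^sub>R e - (2 * kelvin_Y x * kelvin_P e x) *\<^sub>R x)))"
    by (rule has_grad_lap_compose[OF has_grad_lap_kelvin_A[OF U], where S = UNIV]) (use f in auto)
  let ?gB = "\<lambda>x. (- 2 * (kelvin_Y x)\<^sup>2 + 4 * h * (kelvin_Y x * kelvin_P e x)) *\<^sub>R x - (2 * h * kelvin_Y x) *\<^sub>R e"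
  have gB: "has_grad_lap U (\<lambda>x. k (kelvin_B e h x)) (\<lambda>x. k1 (kelvin_B e h x) *\<^sub>R ?gB x)
    (\<lambda>x. k1 (kelvin_B e h x) * ((8 - 2 * real DIM('a)) * (kelvin_Y x)\<^sup>2 - 2 * h * ((4 - 2 * real DIM('a)) * (kelvin_Y x * kelvin_P e x)))
       + k2 (kelvin_B e h x) * (?gB x \<bullet> ?gB x))"
    by (rule has_grad_lap_compose[OF has_grad_lap_kelvin_B[OF U], where S = "{0<..}"]) (use k B in auto)
  show ?thesis
  proof (rule exI, rule has_grad_lap_eqI[OF has_grad_lap_mult[OF has_grad_lap_kelvin_C[OF U] has_grad_lap_mult[OF gA gB]]], goal_cases)
    case (1 x)
    have "x \<noteq> 0" using 1 U by auto
    define Y A B' P C where d: "Y = kelvin_Y x" "A = kelvin_A e h x" "B' = kelvin_B e h x" "P = kelvin_P e x" "C = kelvin_C x"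
    define gA gB where g: "gA = Y *\<^sub>R e - (2 * Y * P) *\<^sub>R x"
      "gB = (- 2 * Y\<^sup>2 + 4 * h * (Y * P)) *\<^sub>R x - (2 * h * Y) *\<^sub>R e"
    have Y: "Y \<noteq> 0" using \<open>x \<noteq> 0\<close> by (simp add: d kelvin_Y_def)
    have "x \<bullet> x = 1 / Y" by (simp add: d kelvin_Y_def inverse_eq_divide)
    moreover have xe: "x \<bullet> e = P / Y" using Y by (simp add: d kelvin_P_def)
    moreover have "e \<bullet> x = P / Y" unfolding xe[symmetric] by (rule inner_commute)
    moreover have "e \<bullet> e = 1" using e by (simp add: norm_eq_1)
    ultimately have i: "x \<bullet> x = 1 / Y" "x \<bullet> e = P / Y" "e \<bullet> x = P / Y" "e \<bullet> e = 1" by blast+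
    have AB: "A = P - h" "B' = Y - 2 * h * P + h\<^sup>2" by (simp_all add: d kelvin_A_def kelvin_B_def)
    \<comment> \<open>Inversion is conformal with factor \<open>Y\<close>: the inner products are
      \<open>Y^2\<close> times those of the gradients e and 2 z in the z variable.\<close>
    have AA: "gA \<bullet> gA = Y\<^sup>2"
      using Y unfolding g inner_diff_left inner_diff_right inner_scaleR_left inner_scaleR_right i
      by (simp add: field_simps power2_eq_square)
    have AB': "gA \<bullet> gB = 2 * A * Y\<^sup>2"
      using Y unfolding g AB inner_diff_left inner_diff_right inner_scaleR_left inner_scaleR_right i
      by (simp add: field_simps power2_eq_square)
    have BB: "gB \<bullet> gB = 4 * B' * Y\<^sup>2"
      using Y unfolding g AB inner_diff_left inner_diff_right inner_scaleR_left inner_scaleR_right i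
      by (simp add: field_simps power2_eq_square)
    \<comment> \<open>Pairings with the radial gradient of \<open>kelvin_C\<close>. They cancel the
      Laplacian of \<open>kelvin_A\<close> and leave 2 N Y^2 from that of \<open>kelvin_B\<close>,
      as in flat z-space.\<close>
    have xA: "x \<bullet> gA = - P" and xB: "x \<bullet> gB = - 2 * Y + 2 * h * P"
      using Y unfolding g inner_diff_left inner_diff_right inner_scaleR_left inner_scaleR_right i
      by (simp_all add: field_simps power2_eq_square)
    show ?case
      unfolding d[symmetric] g[symmetric] inner_scaleR_left inner_scaleR_right inner_add_left inner_add_right AA AB' BB xA xB
      by algebra
  qed
qed

text \<open>The radial factor is written in the logarithmic variable \<open>ln |z|\<close>, in which the Hardy
  operator has constant coefficients.\<close>

definition kelvin_test :: "'a::euclidean_space \<Rightarrow> real \<Rightarrow> (real \<Rightarrow> real) \<Rightarrow> (real \<Rightarrow> real) \<Rightarrow> 'a \<Rightarrow> real" where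
  "kelvin_test e h f g x = kelvin_C x * (f (kelvin_A e h x) * (kelvin_B e h x powr (- (real DIM('a) / 4)) * g (ln (kelvin_B e h x) / 2)))"

text \<open>\<open>a\<close> and \<open>b\<close> stand for z.e and |z|^2. If f is the identity only
  \<open>f0 * (g2 - N^2/4 * g0)\<close> survives; the other terms measure the curvature of f and its
  deviation from homogeneity of degree one.\<close>

definition kelvin_lap :: "real \<Rightarrow> real \<Rightarrow> real \<Rightarrow> real \<Rightarrow> real \<Rightarrow> real \<Rightarrow> real \<Rightarrow> real \<Rightarrow> real \<Rightarrow> real" where
  "kelvin_lap N a b f0 f1 f2 g0 g1 g2 =
     b * g0 * f2 + f0 * (g2 - N\<^sup>2 / 4 * g0) + (a * f1 - f0) * (2 * g1 - N * g0)"

lemma kelvin_test_has_gl: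
  fixes e :: "'a::euclidean_space"
  assumes U: "open U" "0 \<notin> U" and e: "norm e = 1" and B: "\<And>x. x \<in> U \<Longrightarrow> 0 < kelvin_B e h x"
    and f: "\<And>y. (f has_real_derivative f1 y) (at y)" "\<And>y. (f1 has_real_derivative f2 y) (at y)"
    and g: "\<And>y. (g has_real_derivative g1 y) (at y)" "\<And>y. (g1 has_real_derivative g2 y) (at y)"
  shows "\<exists>G. has_grad_lap U (kelvin_test e h f g) G
    (\<lambda>x. kelvin_C x * (kelvin_Y x)\<^sup>2 * kelvin_B e h x powr (- (real DIM('a) / 4) - 1) *
      kelvin_lap (real DIM('a)) (kelvin_A e h x) (kelvin_B e h x) (f (kelvin_A e h x)) (f1 (kelvin_A e h x)) (f2 (kelvin_A e h x))
       (g (ln (kelvin_B e h x) / 2)) (g1 (ln (kelvin_B e h x) / 2)) (g2 (ln (kelvin_B e h x) / 2)))"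
proof -
  define N where "N = real DIM('a)"
  define k where "k y = y powr (- (N / 4)) * g (ln y / 2)" for y
  define k1 where "k1 y = y powr (- (N / 4) - 1) * (g1 (ln y / 2) / 2 - N / 4 * g (ln y / 2))" for y
  define k2 where "k2 y = y powr (- (N / 4) - 2) * (N / 4 * (N / 4 + 1) * g (ln y / 2)
     - (N / 4 + 1 / 2) * g1 (ln y / 2) + g2 (ln y / 2) / 4)" for y
  have l: "((\<lambda>y. ln y / 2) has_real_derivative 1 / (2 * y)) (at y)" if "0 < y" for y :: real
    using that by (auto intro!: derivative_eq_intros)
  note gl = DERIV_chain2[OF g(1) l] DERIV_chain2[OF g(2) l]
  have pw: "y powr (- (N / 4) - 1) = y powr (- (N / 4)) / y" "y powr (- (N / 4) - 2) = y powr (- (N / 4)) / y\<^sup>2"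
      "y powr (- (N / 4) - 1 - 1) = y powr (- (N / 4)) / y\<^sup>2" if "0 < y" for y :: real
  proof -
    have 2: "y powr - 2 = 1 / y\<^sup>2" using that by (simp add: powr_minus powr_numeral inverse_eq_divide)
    have e: "- (N / 4) - 1 = - (N / 4) + - 1" "- (N / 4) - 2 = - (N / 4) + - 2" "- (N / 4) - 1 - 1 = - (N / 4) + - 2"
      by simp_all
    show "y powr (- (N / 4) - 1) = y powr (- (N / 4)) / y"
      unfolding e(1) powr_add using that by (simp add: powr_minus_divide)
    show "y powr (- (N / 4) - 2) = y powr (- (N / 4)) / y\<^sup>2"
      unfolding e(2) powr_add 2 by simp
    show "y powr (- (N / 4) - 1 - 1) = y powr (- (N / 4)) / y\<^sup>2"
      unfolding e(3) powr_add 2 by simp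
  qed
  have k1: "(k has_real_derivative k1 y) (at y)" if y: "0 < y" for y
  proof -
    have "(k has_real_derivative y powr (- (N / 4)) * (g1 (ln y / 2) * (1 / (2 * y))) +
       (- (N / 4)) * y powr (- (N / 4) - 1) * g (ln y / 2)) (at y)"
      unfolding k_def
      by (rule derivative_eq_intros gl y refl)+ (use y in simp)
    moreover have "y powr (- (N / 4)) * (g1 (ln y / 2) * (1 / (2 * y))) +
       (- (N / 4)) * y powr (- (N / 4) - 1) * g (ln y / 2) = k1 y"
      unfolding k1_def pw[OF y] using y by (simp add: field_simps)
    ultimately show ?thesis by simp
  qed
  have k2: "(k1 has_real_derivative k2 y) (at y)" if y: "0 < y" for y
  proof -
    have "(k1 has_real_derivative y powr (- (N / 4) - 1) * ((g2 (ln y / 2) * (1 / (2 * y))) / 2 - N / 4 * (g1 (ln y / 2) * (1 / (2 * y))))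
       + ((- (N / 4) - 1) * y powr (- (N / 4) - 1 - 1)) * (g1 (ln y / 2) / 2 - N / 4 * g (ln y / 2))) (at y)"
      unfolding k1_def
      by (rule DERIV_cong[OF DERIV_mult[OF has_real_derivative_powr[OF y]
            DERIV_diff[OF DERIV_cdivide[OF gl(2)] DERIV_cmult[OF gl(1)]]]]) (use y in auto)
    moreover have "y powr (- (N / 4) - 1) * ((g2 (ln y / 2) * (1 / (2 * y))) / 2 - N / 4 * (g1 (ln y / 2) * (1 / (2 * y))))
       + ((- (N / 4) - 1) * y powr (- (N / 4) - 1 - 1)) * (g1 (ln y / 2) / 2 - N / 4 * g (ln y / 2)) = k2 y"
      unfolding k2_def pw[OF y] using y by (simp add: field_simps power2_eq_square)
    ultimately show ?thesis by simp
  qed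
  obtain G where G: "has_grad_lap U (\<lambda>x. kelvin_C x * (f (kelvin_A e h x) * k (kelvin_B e h x))) G
    (\<lambda>x. kelvin_C x * (kelvin_Y x)\<^sup>2 * (k (kelvin_B e h x) * f2 (kelvin_A e h x)
      + f (kelvin_A e h x) * (2 * real DIM('a) * k1 (kelvin_B e h x) + 4 * kelvin_B e h x * k2 (kelvin_B e h x))
      + 4 * kelvin_A e h x * f1 (kelvin_A e h x) * k1 (kelvin_B e h x)))"
    using kelvin_laplacian[OF U e B f k1 k2] by blast
  have eq: "kelvin_test e h f g = (\<lambda>x. kelvin_C x * (f (kelvin_A e h x) * k (kelvin_B e h x)))"
    by (simp add: kelvin_test_def[abs_def] k_def N_def)
  show ?thesis
    unfolding eq
  proof (rule exI, rule has_grad_lap_eqI[OF G], goal_cases)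
    case (1 x)
    then have y: "0 < kelvin_B e h x" using B by auto
    have "k (kelvin_B e h x) * f2 (kelvin_A e h x)
      + f (kelvin_A e h x) * (2 * N * k1 (kelvin_B e h x) + 4 * kelvin_B e h x * k2 (kelvin_B e h x))
      + 4 * kelvin_A e h x * f1 (kelvin_A e h x) * k1 (kelvin_B e h x) = kelvin_B e h x powr (- (N / 4) - 1) *
      kelvin_lap N (kelvin_A e h x) (kelvin_B e h x) (f (kelvin_A e h x)) (f1 (kelvin_A e h x)) (f2 (kelvin_A e h x))
       (g (ln (kelvin_B e h x) / 2)) (g1 (ln (kelvin_B e h x) / 2)) (g2 (ln (kelvin_B e h x) / 2))"
      using y unfolding k_def k1_def k2_def kelvin_lap_def pw[OF y]
      by (simp add: field_simps power2_eq_square)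
    then show ?case by (simp add: N_def mult.assoc)
  qed
qed

lemma kelvin_laplacian_eq:
  fixes e :: "'a::euclidean_space"
  assumes "x \<noteq> 0" "0 < kelvin_B e h x" "norm e = 1"
    and f: "\<And>y. (f has_real_derivative f1 y) (at y)" "\<And>y. (f1 has_real_derivative f2 y) (at y)"
    and g: "\<And>y. (g has_real_derivative g1 y) (at y)" "\<And>y. (g1 has_real_derivative g2 y) (at y)"
  shows "laplacian (kelvin_test e h f g) x = kelvin_C x * (kelvin_Y x)\<^sup>2 * kelvin_B e h x powr (- (real DIM('a) / 4) - 1) *
      kelvin_lap (real DIM('a)) (kelvin_A e h x) (kelvin_B e h x) (f (kelvin_A e h x)) (f1 (kelvin_A e h x)) (f2 (kelvin_A e h x))
       (g (ln (kelvin_B e h x) / 2)) (g1 (ln (kelvin_B e h x) / 2)) (g2 (ln (kelvin_B e h x) / 2))"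
proof -
  let ?V = "- {0::'a}"
  have "continuous_on ?V (kelvin_B e h)"
    unfolding kelvin_B_def[abs_def] kelvin_P_def kelvin_Y_def by (intro continuous_intros) auto
  then have o: "open {x \<in> ?V. 0 < kelvin_B e h x}"
    using continuous_open_preimage[of ?V "kelvin_B e h" "{0<..}"]
    by (simp add: vimage_def Int_def open_Compl)
  show ?thesis
    using has_grad_lap_laplacian[where x = x] assms(1,2)
      kelvin_test_has_gl[OF o, of e h f f1 f2 g g1 g2, OF _ assms(3) _ f g] by blast
qed

lemma smooth_kelvin_Y: "open U \<Longrightarrow> 0 \<notin> U \<Longrightarrow> smooth_on U kelvin_Y"
  unfolding kelvin_Y_def[abs_def] by (rule smooth_on_inverse) (auto intro: smooth_on_inner_self)

lemma smooth_kelvin_A: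
  assumes "open U" "0 \<notin> U" shows "smooth_on U (kelvin_A e h)"
  unfolding kelvin_A_def[abs_def] kelvin_P_def
  by (intro smooth_on_diff smooth_on_mult smooth_on_const smooth_on_inner smooth_kelvin_Y assms)

lemma smooth_kelvin_B:
  assumes "open U" "0 \<notin> U" shows "smooth_on U (kelvin_B e h)"
  unfolding kelvin_B_def[abs_def] kelvin_P_def
  by (intro smooth_on_add smooth_on_diff smooth_on_mult smooth_on_const smooth_on_inner smooth_kelvin_Y assms)

lemma smooth_kelvin_test:
  assumes U: "open U" "0 \<notin> U" and B: "\<And>x. x \<in> U \<Longrightarrow> 0 < kelvin_B e h x"
    and "smooth_on U (\<lambda>x. f (kelvin_A e h x))" "smooth_on U (\<lambda>x. g (ln (kelvin_B e h x) / 2))"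
  shows "smooth_on U (kelvin_test e h f g)"
  unfolding kelvin_test_def[abs_def] kelvin_C_def
  by (intro smooth_on_mult smooth_on_powr smooth_kelvin_Y smooth_kelvin_B assms kelvin_Y_pos) (use U in auto)

section \<open>Integration by parts and supersolutions\<close>

lemma continuous_compact_support_lborel:
  fixes f :: "'a::euclidean_space \<Rightarrow> real"
  assumes "continuous_on UNIV f" "compact K" "\<And>x. x \<notin> K \<Longrightarrow> f x = 0"
  shows "integrable lborel f"
proof -
  have "integrable lborel (\<lambda>x. indicator K x *\<^sub>R f x)"
    by (rule borel_integrable_compact[OF assms(2) continuous_on_subset[OF assms(1) subset_UNIV]])
  moreover have "(\<lambda>x. indicator K x *\<^sub>R f x) = f"
    using assms(3) by (auto simp: fun_eq_iff indicator_def)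
  ultimately show ?thesis by simp
qed

lemma continuous_compact_support_integrable:
  fixes f :: "'a::euclidean_space \<Rightarrow> real"
  assumes "continuous_on UNIV f" "compact K" "\<And>x. x \<notin> K \<Longrightarrow> f x = 0"
  shows "integrable lebesgue f"
  using integrable_completion[of f lborel] continuous_compact_support_lborel[OF assms]
  by (auto dest: borel_measurable_integrable)

lemma pd_outside:
  assumes "x \<notin> tsupport f" shows "pd f b x = 0"
proof -
  have "pd f b x = pd (\<lambda>x. 0) b x"
    using assms closure_subset[of "{x. f x \<noteq> 0}"]
    by (intro pd_cong_open[of "- tsupport f"]) (auto simp: tsupport_def)
  also have "\<dots> = 0" by (rule pd_has_derivative) simp
  finally show ?thesis .
qed

lemma outside_tsupport: "x \<notin> tsupport f \<Longrightarrow> f x = 0"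
  using closure_subset[of "{x. f x \<noteq> 0}"] by (auto simp: tsupport_def)

text \<open>By translation invariance all difference quotients of \<open>f\<close> have integral
  zero. They converge to the partial derivative and are dominated through the mean value theorem;
  increments are at most 1, so the ball of radius \<open>R + 1\<close> carries all of them.\<close>

lemma integral_pd_zero:
  fixes f :: "'a::euclidean_space \<Rightarrow> real"
  assumes f: "smooth_on UNIV f" and K: "compact (tsupport f)" and b: "b \<in> Basis"
  shows "(LINT x|lebesgue. pd f b x) = 0"
proof -
  have cf: "continuous_on UNIV f" and cp: "continuous_on UNIV (pd f b)"
    using f b smooth_on_continuous smooth_on_pd by blast+
  obtain R where R: "tsupport f \<subseteq> cball 0 R"
    using compact_imp_bounded[OF K] bounded_subset_ballD[of "tsupport f" 0] ball_subset_cball by (meson subset_trans)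
  obtain M where M: "\<And>x. \<bar>pd f b x\<bar> \<le> M"
  proof -
    have "bounded (pd f b ` tsupport f)"
      using K cp continuous_on_subset by (intro compact_imp_bounded compact_continuous_image) auto
    then obtain M where "M > 0" "\<And>x. x \<in> tsupport f \<Longrightarrow> norm (pd f b x) \<le> M"
      unfolding bounded_pos by auto
    then have "\<bar>pd f b x\<bar> \<le> M" for x
      using pd_outside[of x f b] by (cases "x \<in> tsupport f") auto
    then show ?thesis using that by blast
  qed
  have dv: "((\<lambda>t. f (x + t *\<^sub>R b)) has_real_derivative pd f b (x + t *\<^sub>R b)) (at t)" for x t
  proof -
    have "((\<lambda>t. f (x + t *\<^sub>R b)) has_derivative (\<lambda>s. pd f (s *\<^sub>R b) (x + t *\<^sub>R b))) (at t)"
      by (rule has_derivative_compose[OF _ smooth_on_has_derivative[OF open_UNIV f]])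
        (auto intro!: derivative_eq_intros)
    moreover have "pd f (s *\<^sub>R b) y = pd f b y * s" for s y
      using linear_cmul[OF has_derivative_linear[OF smooth_on_has_derivative[OF open_UNIV f UNIV_I[of y]]]]
      by simp
    ultimately show ?thesis by (simp add: has_field_derivative_def)
  qed
  define D where "D n x = (f (x + (1 / real (Suc n)) *\<^sub>R b) - f x) * real (Suc n)" for n x
  have lim: "(\<lambda>n. D n x) \<longlonglongrightarrow> pd f b x" for x
  proof -
    have "((\<lambda>h. (f (x + h *\<^sub>R b) - f x) / h) \<longlongrightarrow> pd f b x) (at 0)"
      using dv[of x 0] by (simp add: DERIV_def)
    moreover have "filterlim (\<lambda>n. 1 / real (Suc n)) (at 0) sequentially"
      unfolding filterlim_at using LIMSEQ_Suc[OF lim_const_over_n[of "1::real"]] by simp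
    ultimately have "(\<lambda>n. (f (x + (1 / real (Suc n)) *\<^sub>R b) - f x) / (1 / real (Suc n))) \<longlonglongrightarrow> pd f b x"
      by (rule filterlim_compose)
    then show ?thesis by (simp add: D_def)
  qed
  have bound: "norm (D n x) \<le> M * indicator (cball 0 (R + 1)) x" for n x
  proof (cases "x \<in> cball 0 (R + 1)")
    case True
    have "\<exists>z>0. z < 1 / real (Suc n) \<and> f (x + (1 / real (Suc n)) *\<^sub>R b) - f (x + 0 *\<^sub>R b) = (1 / real (Suc n) - 0) * pd f b (x + z *\<^sub>R b)"
      by (rule MVT2) (use dv in auto)
    then obtain z where "f (x + (1 / real (Suc n)) *\<^sub>R b) - f x = (1 / real (Suc n)) * pd f b (x + z *\<^sub>R b)"
      by auto
    then have "D n x = pd f b (x + z *\<^sub>R b)" by (simp add: D_def)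
    then show ?thesis using M True by simp
  next
    case False
    have c: "norm c \<le> 1 \<Longrightarrow> x + c \<notin> cball 0 R" for c
      using False norm_triangle_ineq4[of "x + c" c] by auto
    have fz: "f y = 0" if "y \<notin> cball 0 R" for y
      using that R by (intro outside_tsupport) auto
    have "f (x + (1 / real (Suc n)) *\<^sub>R b) = 0"
      by (rule fz[OF c]) (use b in simp)
    moreover have "f x = 0" by (rule fz) (use False in auto)
    ultimately have "D n x = 0" by (simp add: D_def)
    then show ?thesis using False by simp
  qed
  have fb: "f \<in> borel_measurable borel" and pb: "pd f b \<in> borel_measurable borel"
    using cf cp borel_measurable_continuous_onI by blast+
  have Dm: "D n \<in> borel_measurable lborel" for n
    unfolding D_def[abs_def] by (intro borel_measurable_times borel_measurable_diff measurable_compose[OF _ fb]) auto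
  have "(\<lambda>n. LINT x|lborel. D n x) \<longlonglongrightarrow> (LINT x|lborel. pd f b x)"
  proof (rule integral_dominated_convergence[where w = "\<lambda>x. M * indicator (cball 0 (R + 1)) x"])
    show "integrable lborel (\<lambda>x. M * indicator (cball 0 (R + 1)) x)"
      using emeasure_compact_finite[OF compact_cball]
      by (intro integrable_mult_right integrable_real_indicator) auto
  qed (use Dm pb lim bound in auto)
  moreover have "(LINT x|lborel. D n x) = 0" for n
  proof -
    have int: "integrable lborel f"
      by (rule continuous_compact_support_lborel[OF cf K]) (rule outside_tsupport)
    define c where "c = (1 / real (Suc n)) *\<^sub>R b"
    have "(LINT x|lborel. f x) = (LINT x|distr lborel borel ((+) c). f x)"
      by (simp add: lborel_distr_plus)
    also have "\<dots> = (LINT x|lborel. f (c + x))"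
      by (rule integral_distr) (use fb in auto)
    finally have 1: "(LINT x|lborel. f x) = (LINT x|lborel. f (x + c))" by (simp add: add.commute)
    have "integrable (distr lborel borel ((+) c)) f" using int by (simp add: lborel_distr_plus)
    then have "integrable lborel (\<lambda>x. f (x + c))"
      by (subst (asm) integrable_distr_eq) (use fb in \<open>auto simp: add.commute\<close>)
    then show ?thesis unfolding D_def c_def[symmetric] using 1 int by simp
  qed
  ultimately have "(LINT x|lborel. pd f b x) = 0"
    using LIMSEQ_unique[OF tendsto_const, of 0 "LINT x|lborel. pd f b x"] by simp
  then show ?thesis using integral_completion[of "pd f b" lborel] pb by simp
qed

lemma pd_mult:
  assumes "open U" "x \<in> U" "smooth_on U f" "smooth_on U g"
  shows "pd (\<lambda>x. f x * g x) b x = f x * pd g b x + pd f b x * g x"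
  by (rule pd_has_derivative[OF has_derivative_mult[OF smooth_on_has_derivative[OF assms(1,3,2)]
          smooth_on_has_derivative[OF assms(1,4,2)]]])

text \<open>\<open>U\<close> and the complement of \<open>K\<close> are open and cover the space, so
  smoothness can be glued.\<close>

lemma smooth_on_extend_zero:
  assumes "open U" "smooth_on U f" "closed K" "K \<subseteq> U" "\<And>x. x \<notin> K \<Longrightarrow> f x = 0"
  shows "smooth_on UNIV f"
proof -
  have "smooth_on (- K) f"
    using smooth_on_cong[of "- K" f "\<lambda>x. 0"] smooth_on_const[of "- K" 0] assms by auto
  then have "smooth_on (U \<union> - K) f"
    using assms by (intro smooth_on_Un) auto
  moreover have "U \<union> - K = UNIV" using assms by auto
  ultimately show ?thesis by simp
qed

lemma tsupport_subset: "closed K \<Longrightarrow> (\<And>x. x \<notin> K \<Longrightarrow> f x = 0) \<Longrightarrow> tsupport f \<subseteq> K"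
  unfolding tsupport_def by (rule closure_minimal) auto

lemma compact_tsupport: "compact K \<Longrightarrow> (\<And>x. x \<notin> K \<Longrightarrow> f x = 0) \<Longrightarrow> compact (tsupport f)"
  using compact_Int_closed[of K "tsupport f"] tsupport_subset[of K f] compact_imp_closed[of K]
  by (metis Int_absorb1 closed_closure tsupport_def)

lemma test_fun_mult_smooth:
  assumes "open U" "test_fun U \<phi>" "smooth_on U g"
  shows "smooth_on UNIV (\<lambda>x. \<phi> x * g x)" "compact (tsupport (\<lambda>x. \<phi> x * g x))"
proof -
  have p: "smooth_on UNIV \<phi>" "compact (tsupport \<phi>)" "tsupport \<phi> \<subseteq> U"
    using assms(2) by (auto simp: test_fun_def)
  show "smooth_on UNIV (\<lambda>x. \<phi> x * g x)"
    by (rule smooth_on_extend_zero[OF assms(1) smooth_on_mult[OF assms(1) smooth_on_subset[OF p(1)] assms(3)],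
          where K = "tsupport \<phi>"])
      (use p outside_tsupport[of _ \<phi>] compact_imp_closed in auto)
  show "compact (tsupport (\<lambda>x. \<phi> x * g x))"
    by (rule compact_tsupport[OF p(2)]) (simp add: outside_tsupport)
qed

lemma test_fun_mult_continuous_on:
  assumes "open U" "test_fun U \<phi>" "continuous_on U g"
  shows "continuous_on UNIV (\<lambda>x. \<phi> x * g x)"
proof -
  have p: "continuous_on UNIV \<phi>" "compact (tsupport \<phi>)" "tsupport \<phi> \<subseteq> U"
    using assms(2) smooth_on_continuous by (auto simp: test_fun_def)
  have "continuous_on U (\<lambda>x. \<phi> x * g x)"
    using p assms by (intro continuous_intros) (auto intro: continuous_on_subset)
  moreover have "continuous_on (- tsupport \<phi>) (\<lambda>x. \<phi> x * g x)"
    by (rule continuous_on_eq[OF continuous_on_const[of _ 0]]) (simp add: outside_tsupport)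
  ultimately have "continuous_on (U \<union> - tsupport \<phi>) (\<lambda>x. \<phi> x * g x)"
    using assms p compact_imp_closed by (intro continuous_on_open_Un) auto
  moreover have "U \<union> - tsupport \<phi> = UNIV" using p by auto
  ultimately show ?thesis by simp
qed

lemma test_fun_mult_continuous:
  assumes "open U" "test_fun U \<phi>" "continuous_on U g"
  shows "integrable lebesgue (\<lambda>x. \<phi> x * g x)"
  by (rule continuous_compact_support_integrable[OF test_fun_mult_continuous_on[OF assms], of "tsupport \<phi>"])
    (use assms(2) outside_tsupport[of _ \<phi>] in \<open>auto simp: test_fun_def\<close>)

lemma test_fun_square: "test_fun U \<phi> \<Longrightarrow> test_fun U (\<lambda>x. (\<phi> x)\<^sup>2)"
  using smooth_on_mult[of UNIV \<phi> \<phi>] compact_tsupport[of "tsupport \<phi>" "\<lambda>x. (\<phi> x)\<^sup>2"]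
    tsupport_subset[of "tsupport \<phi>" "\<lambda>x. (\<phi> x)\<^sup>2"] outside_tsupport[of _ \<phi>] compact_imp_closed
  unfolding test_fun_def power2_eq_square by force

lemma continuous_pd: "test_fun U \<phi> \<Longrightarrow> b \<in> Basis \<Longrightarrow> continuous_on UNIV (pd \<phi> b)"
  unfolding test_fun_def using smooth_on_continuous smooth_on_pd by blast

lemma continuous_laplacian: "smooth_on U \<phi> \<Longrightarrow> continuous_on U (laplacian \<phi>)"
  unfolding laplacian_def[abs_def]
  by (intro continuous_intros smooth_on_continuous smooth_on_pd) auto

lemma laplacian_outside:
  assumes "x \<notin> tsupport f" shows "laplacian f x = 0"
proof -
  have "pd (pd f b) b x = 0" for b
  proof (rule pd_outside)
    have "tsupport (pd f b) \<subseteq> tsupport f"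
      by (rule tsupport_subset) (auto simp: pd_outside, simp add: tsupport_def)
    then show "x \<notin> tsupport (pd f b)" using assms by auto
  qed
  then show ?thesis by (simp add: laplacian_def)
qed

lemma grad_sq_integrable:
  assumes "test_fun U \<phi>" shows "integrable lebesgue (grad_sq \<phi>)"
proof (rule continuous_compact_support_integrable[where K = "tsupport \<phi>"])
  show "continuous_on UNIV (grad_sq \<phi>)"
    unfolding grad_sq_def[abs_def] by (intro continuous_intros continuous_pd[OF assms])
qed (use assms pd_outside[of _ \<phi>] in \<open>auto simp: test_fun_def grad_sq_def\<close>)

lemma grad_sq_by_parts:
  assumes "test_fun U \<phi>"
  shows "(LINT x|lebesgue. grad_sq \<phi> x) = (LINT x|lebesgue. \<phi> x * - laplacian \<phi> x)"
proof -
  have p: "smooth_on UNIV \<phi>" "test_fun UNIV \<phi>"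
    using assms by (auto simp: test_fun_def)
  have i: "integrable lebesgue (pd (\<lambda>x. \<phi> x * pd \<phi> b x) b)"
    and z: "(LINT x|lebesgue. pd (\<lambda>x. \<phi> x * pd \<phi> b x) b x) = 0" if "b \<in> Basis" for b
  proof -
    note s = test_fun_mult_smooth[OF open_UNIV p(2) smooth_on_pd[OF p(1) that]]
    show "(LINT x|lebesgue. pd (\<lambda>x. \<phi> x * pd \<phi> b x) b x) = 0"
      by (rule integral_pd_zero[OF s that])
    show "integrable lebesgue (pd (\<lambda>x. \<phi> x * pd \<phi> b x) b)"
      by (rule continuous_compact_support_integrable[OF smooth_on_continuous[OF smooth_on_pd[OF s(1) that]] s(2)])
        (rule pd_outside)
  qed
  have "pd (\<lambda>x. \<phi> x * pd \<phi> b x) b x = \<phi> x * pd (pd \<phi> b) b x + (pd \<phi> b x)\<^sup>2" if "b \<in> Basis" for b x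
    using pd_mult[OF open_UNIV _ p(1) smooth_on_pd[OF p(1) that], of x b] by (simp add: power2_eq_square)
  then have "grad_sq \<phi> x - \<phi> x * - laplacian \<phi> x = (\<Sum>b\<in>Basis. pd (\<lambda>x. \<phi> x * pd \<phi> b x) b x)" for x
    by (simp add: grad_sq_def laplacian_def sum.distrib sum_distrib_left)
  then have "(LINT x|lebesgue. grad_sq \<phi> x - \<phi> x * - laplacian \<phi> x) = (LINT x|lebesgue. (\<Sum>b\<in>Basis. pd (\<lambda>x. \<phi> x * pd \<phi> b x) b x))"
    by simp
  also have "\<dots> = 0"
    by (subst Bochner_Integration.integral_sum) (use i z in auto)
  finally have "(LINT x|lebesgue. grad_sq \<phi> x - \<phi> x * - laplacian \<phi> x) = 0" .
  moreover have "integrable lebesgue (\<lambda>x. \<phi> x * - laplacian \<phi> x)"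
    using continuous_laplacian[OF p(1)] by (intro test_fun_mult_continuous[OF open_UNIV p(2)] continuous_intros)
  ultimately show ?thesis
    using grad_sq_integrable[OF assms] by simp
qed

text \<open>Expand \<open>|\<nabla>\<phi> - \<phi> \<nabla>W / W|\<^sup>2 \<ge> 0\<close> and integrate the divergence of \<open>\<phi>\<^sup>2 \<nabla>W / W\<close> away.\<close>

lemma hardy_from_supersolution:
  assumes U: "open U" and W: "smooth_on U W" "\<And>x. x \<in> U \<Longrightarrow> 0 < W x"
    and V: "continuous_on U V" "\<And>x. x \<in> U \<Longrightarrow> V x * W x \<le> - laplacian W x"
    and \<phi>: "test_fun U \<phi>"
  shows "(LINT x|lebesgue. (\<phi> x)\<^sup>2 * V x) \<le> (LINT x|lebesgue. grad_sq \<phi> x)"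
proof -
  note p2 = test_fun_square[OF \<phi>]
  \<comment> \<open>Components of the field phi^2 grad W / W. The compact support of phi in
    \<open>U\<close> makes them smooth on the whole space although \<open>W\<close> is controlled
    only on \<open>U\<close>.\<close>
  define F where "F b x = (\<phi> x)\<^sup>2 * (pd W b x * inverse (W x))" for b x
  have sI: "smooth_on U (\<lambda>x. inverse (W x))"
    by (rule smooth_on_inverse[OF U W])
  have sg: "smooth_on U (\<lambda>x. pd W b x * inverse (W x))" if "b \<in> Basis" for b
    by (intro smooth_on_mult[OF U] smooth_on_pd W sI that)
  have z: "(LINT x|lebesgue. pd (F b) b x) = 0" and i: "integrable lebesgue (pd (F b) b)" if "b \<in> Basis" for b
  proof -
    note s = test_fun_mult_smooth[OF U p2 sg[OF that], folded F_def]
    show "(LINT x|lebesgue. pd (F b) b x) = 0"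
      using integral_pd_zero[OF s that] by simp
    show "integrable lebesgue (pd (F b) b)"
      by (rule continuous_compact_support_integrable[OF smooth_on_continuous[OF smooth_on_pd[OF s(1) that]] s(2)])
        (rule pd_outside)
  qed
  have pw: "(\<phi> x)\<^sup>2 * V x + (\<Sum>b\<in>Basis. pd (F b) b x) \<le> grad_sq \<phi> x" for x
  proof (cases "x \<in> U")
    case True
    have sp: "smooth_on U \<phi>" using \<phi> smooth_on_subset unfolding test_fun_def by blast
    have e: "pd (F b) b x = (\<phi> x)\<^sup>2 * (pd (pd W b) b x / W x - (pd W b x / W x)\<^sup>2) + 2 * \<phi> x * pd \<phi> b x * (pd W b x / W x)"
      if b: "b \<in> Basis" for b
    proof -
      have 1: "pd (\<lambda>x. inverse (W x)) b x = - pd W b x / (W x)\<^sup>2"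
        using pd_has_derivative[OF Deriv.has_derivative_inverse[OF _ smooth_on_has_derivative[OF U W(1) True]], of b] W(2)[OF True]
        by (simp add: power2_eq_square divide_inverse)
      have 2: "pd (\<lambda>x. pd W b x * inverse (W x)) b x = pd (pd W b) b x / W x - (pd W b x / W x)\<^sup>2"
        unfolding pd_mult[OF U True smooth_on_pd[OF W(1) b] sI] 1
        by (simp add: divide_inverse power2_eq_square)
      have 3: "pd (\<lambda>x. (\<phi> x)\<^sup>2) b x = 2 * \<phi> x * pd \<phi> b x"
        unfolding power2_eq_square pd_mult[OF U True sp sp] by simp
      have "smooth_on U (\<lambda>x. (\<phi> x)\<^sup>2)" using smooth_on_mult[OF U sp sp] by (simp add: power2_eq_square)
      then show ?thesis
        unfolding F_def[abs_def] pd_mult[OF U True \<open>smooth_on U (\<lambda>x. (\<phi> x)\<^sup>2)\<close> sg[OF b]] 2 3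
        by (simp add: divide_inverse)
    qed
    have "(\<phi> x)\<^sup>2 * V x \<le> - (\<phi> x)\<^sup>2 * (laplacian W x / W x)"
    proof -
      have "V x \<le> - laplacian W x / W x" using V(2)[OF True] W(2)[OF True] by (simp only: pos_le_divide_eq)
      from mult_left_mono[OF this, of "(\<phi> x)\<^sup>2"] show ?thesis by simp
    qed
    moreover have "(\<Sum>b\<in>Basis. pd (F b) b x) = (\<phi> x)\<^sup>2 * (laplacian W x / W x)
        + (\<Sum>b\<in>Basis. 2 * \<phi> x * pd \<phi> b x * (pd W b x / W x) - (\<phi> x * (pd W b x / W x))\<^sup>2)"
    proof -
      have "(\<phi> x)\<^sup>2 * (laplacian W x / W x) = (\<Sum>b\<in>Basis. (\<phi> x)\<^sup>2 * (pd (pd W b) b x / W x))"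
        by (simp add: laplacian_def sum_distrib_left sum_divide_distrib)
      then show ?thesis
        by (simp add: e sum.distrib[symmetric] algebra_simps power_mult_distrib power_divide cong: sum.cong)
    qed
    moreover have "(\<Sum>b\<in>Basis. 2 * \<phi> x * pd \<phi> b x * (pd W b x / W x) - (\<phi> x * (pd W b x / W x))\<^sup>2) \<le> grad_sq \<phi> x"
      unfolding grad_sq_def
    proof (rule sum_mono)
      fix b :: 'a
      have "0 \<le> (pd \<phi> b x - \<phi> x * (pd W b x / W x))\<^sup>2" by simp
      then show "2 * \<phi> x * pd \<phi> b x * (pd W b x / W x) - (\<phi> x * (pd W b x / W x))\<^sup>2 \<le> (pd \<phi> b x)\<^sup>2"
        by (simp add: power2_diff algebra_simps)
    qed
    ultimately show ?thesis by simp
  next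
    case False
    then have "x \<notin> tsupport \<phi>" using \<phi> by (auto simp: test_fun_def)
    moreover have "tsupport (F b) \<subseteq> tsupport \<phi>" for b
      by (rule tsupport_subset) (simp add: tsupport_def, simp add: F_def outside_tsupport)
    ultimately have "pd (F b) b x = 0" "\<phi> x = 0" for b
      using pd_outside[of x "F b" b] outside_tsupport[of x \<phi>] by blast+
    then show ?thesis by (simp add: grad_sq_def sum_nonneg)
  qed
  have iV: "integrable lebesgue (\<lambda>x. (\<phi> x)\<^sup>2 * V x)"
    by (rule test_fun_mult_continuous[OF U p2 V(1)])
  have iS: "integrable lebesgue (\<lambda>x. \<Sum>b\<in>Basis. pd (F b) b x)" using i by auto
  have "(LINT x|lebesgue. (\<phi> x)\<^sup>2 * V x) = (LINT x|lebesgue. (\<phi> x)\<^sup>2 * V x + (\<Sum>b\<in>Basis. pd (F b) b x))"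
    using iV iS i z by (simp add: Bochner_Integration.integral_sum)
  also have "\<dots> \<le> (LINT x|lebesgue. grad_sq \<phi> x)"
    by (rule integral_mono) (use iV iS grad_sq_integrable[OF \<phi>] pw in auto)
  finally show ?thesis .
qed

text \<open>With a zero integral, the nonempty open set where f is positive would be
  negligible.\<close>

lemma continuous_integral_pos:
  fixes f :: "'a::euclidean_space \<Rightarrow> real"
  assumes "open U" "continuous_on U f" "integrable lebesgue f" "\<And>x. 0 \<le> f x" "x \<in> U" "0 < f x"
  shows "0 < (LINT x|lebesgue. f x)"
proof (rule ccontr)
  assume "\<not> ?thesis"
  then have "(LINT x|lebesgue. f x) = 0"
    using integral_nonneg_AE[of f lebesgue] assms(4) by (simp add: less_le)
  then have "AE x in lebesgue. f x = 0"
    using integral_nonneg_eq_0_iff_AE[OF assms(3)] assms(4) by auto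
  then obtain M where "{x. f x \<noteq> 0} \<subseteq> M" "M \<in> null_sets lebesgue"
    by (auto simp: eventually_ae_filter)
  then have n: "negligible {x \<in> U. 0 < f x}"
    unfolding negligible_iff_null_sets[symmetric] by (auto elim!: negligible_subset)
  have "open {x \<in> U. 0 < f x}"
    using continuous_open_preimage[OF assms(2,1), of "{0<..}"] by (simp add: vimage_def Int_def)
  with n assms(5,6) show False
    using open_not_negligible by blast
qed

section \<open>Compactly supported subsolutions\<close>

text \<open>A smooth convex replacement for the positive part. The choice is made so that
  \<open>v F' - F = \<delta> F / v\<close> and \<open>F'' = \<delta>\<^sup>2 F / v\<^sup>4\<close>: every error term in the Laplacian is again a multiple of \<open>F\<close>,
  and the gain \<open>F''\<close> beats the loss \<open>v F' - F\<close> for small \<open>v\<close>.\<close>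

definition soft_pos :: "real \<Rightarrow> real \<Rightarrow> real" where
  "soft_pos \<delta> v = v * bexp (v / \<delta>)"

definition soft_pos1 :: "real \<Rightarrow> real \<Rightarrow> real" where
  "soft_pos1 \<delta> v = bexp (v / \<delta>) + v * (bexp1 (v / \<delta>) / \<delta>)"

definition soft_pos2 :: "real \<Rightarrow> real \<Rightarrow> real" where
  "soft_pos2 \<delta> v = 2 * bexp1 (v / \<delta>) / \<delta> + v * (bexp2 (v / \<delta>) / \<delta>\<^sup>2)"

lemma soft_pos_DERIV: "(soft_pos \<delta> has_real_derivative soft_pos1 \<delta> v) (at v)"
  and soft_pos1_DERIV: "(soft_pos1 \<delta> has_real_derivative soft_pos2 \<delta> v) (at v)"
proof -
  have l: "((\<lambda>v. v / \<delta>) has_real_derivative 1 / \<delta>) (at v)" by (rule DERIV_cdivide[OF DERIV_ident])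
  note d = DERIV_chain2[OF bexp_DERIV l] DERIV_chain2[OF bexp1_DERIV l]
  show "(soft_pos \<delta> has_real_derivative soft_pos1 \<delta> v) (at v)"
    unfolding soft_pos_def[abs_def] soft_pos1_def
    by (rule DERIV_cong[OF DERIV_mult[OF DERIV_ident d(1)]]) simp
  show "(soft_pos1 \<delta> has_real_derivative soft_pos2 \<delta> v) (at v)"
    unfolding soft_pos1_def[abs_def] soft_pos2_def
    by (rule DERIV_cong[OF DERIV_add[OF d(1) DERIV_mult[OF DERIV_ident DERIV_cdivide[OF d(2)]]]])
      (simp add: power2_eq_square)
qed

lemma soft_pos_zero: "0 < \<delta> \<Longrightarrow> v \<le> 0 \<Longrightarrow> soft_pos \<delta> v = 0 \<and> soft_pos1 \<delta> v = 0 \<and> soft_pos2 \<delta> v = 0"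
  by (simp add: soft_pos_def soft_pos1_def soft_pos2_def bexp_def bexp1_def bexp2_def divide_le_0_iff)

lemma soft_pos_nonneg: "0 < \<delta> \<Longrightarrow> 0 \<le> soft_pos \<delta> v"
  by (cases "v \<le> 0") (simp_all add: soft_pos_zero, simp add: soft_pos_def bexp_nonneg)

lemma soft_pos_pos: "0 < \<delta> \<Longrightarrow> 0 < v \<Longrightarrow> 0 < soft_pos \<delta> v"
  by (simp add: soft_pos_def bexp_def divide_le_0_iff)

lemma soft_pos_le: "0 < \<delta> \<Longrightarrow> 0 < v \<Longrightarrow> soft_pos \<delta> v \<le> v"
  by (simp add: soft_pos_def bexp_def mult_left_le)

lemma soft_pos_lap:
  assumes "0 < \<delta>" "0 < a"
  shows "kelvin_lap N a b (soft_pos \<delta> a) (soft_pos1 \<delta> a) (soft_pos2 \<delta> a) g0 g1 g2 =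
     soft_pos \<delta> a * (b * g0 * (\<delta>\<^sup>2 / a ^ 4) + g2 - N\<^sup>2 / 4 * g0 + \<delta> / a * (2 * g1 - N * g0))"
proof -
  define E where "E = exp (- (1 / (a / \<delta>)))"
  have p: "\<not> a / \<delta> \<le> 0" using assms by (simp add: divide_le_0_iff)
  have 0: "soft_pos \<delta> a = a * E" using p by (simp add: soft_pos_def bexp_def E_def)
  have 1: "soft_pos1 \<delta> a = E + E * (\<delta> / a)"
    using p assms unfolding soft_pos1_def bexp_def bexp1_def E_def[symmetric] by (simp add: field_simps power2_eq_square)
  have 2: "soft_pos2 \<delta> a = E * (\<delta>\<^sup>2 / a ^ 3)"
    using p assms unfolding soft_pos2_def bexp1_def bexp2_def E_def[symmetric]
    by (simp add: field_simps power2_eq_square power3_eq_cube power4_eq_xxxx)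
  show ?thesis
    unfolding kelvin_lap_def 0 1 2 using assms
    by (simp add: field_simps power2_eq_square power3_eq_cube power4_eq_xxxx)
qed

text \<open>The gain and loss of \<open>soft_pos\<close> at smoothing scale d^3. If d/a <= M the
  loss is at most M^2 d^2; otherwise d/a exceeds M >= 1, so (d/a)^3 >= M and the gain outweighs the
  loss. The cube is what makes both regimes work with the same threshold.\<close>

lemma smoothing_error:
  fixes a d M :: real
  assumes "0 < a" "0 < d" "1 \<le> M"
  shows "- (M\<^sup>2 * d\<^sup>2) \<le> (d ^ 3)\<^sup>2 / a ^ 4 - M * (d ^ 3 / a)"
proof (cases "d \<le> a * M")
  case True
  have "M * (d ^ 3 / a) = M * d\<^sup>2 * (d / a)" by (simp add: power2_eq_square power3_eq_cube)
  also have "\<dots> \<le> M * d\<^sup>2 * M"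
    using True assms by (intro mult_left_mono) (auto simp: field_simps)
  finally have "M * (d ^ 3 / a) \<le> M\<^sup>2 * d\<^sup>2" by (simp add: power2_eq_square algebra_simps)
  moreover have "0 \<le> (d ^ 3)\<^sup>2 / a ^ 4" using assms by simp
  ultimately show ?thesis by linarith
next
  case False
  then have "M \<le> d / a" using assms by (simp add: field_simps)
  moreover have "1 \<le> d / a" using assms calculation by linarith
  ultimately have "M \<le> (d / a) ^ 3"
    using power_increasing[of 1 3 "d / a"] by simp
  then have "M * (d ^ 3 / a) \<le> (d / a) ^ 3 * (d ^ 3 / a)"
    using assms by (intro mult_right_mono) auto
  also have "\<dots> = (d ^ 3)\<^sup>2 / a ^ 4" using assms
    by (simp add: power_divide field_simps power2_eq_square power3_eq_cube power4_eq_xxxx)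
  finally have "M * (d ^ 3 / a) \<le> (d ^ 3)\<^sup>2 / a ^ 4" .
  moreover have "0 \<le> M\<^sup>2 * d\<^sup>2" by simp
  ultimately show ?thesis by linarith
qed

text \<open>The exponential is 1/|z|. Since h <= |z|, the quantity |z + h e|^2 is at most |z|^2 (1 +
  u) with u = 3 h / |z|, and (1 - u)(1 + u) <= 1. This is the perturbation of the potential caused
  by the shift of the half-space.\<close>

lemma kelvin_B_div_kelvin_Y:
  assumes e: "norm e = 1" and x: "x \<noteq> 0" and h: "0 < h" and A: "0 < kelvin_A e h x" and B: "h\<^sup>2 \<le> kelvin_B e h x"
  shows "1 - 3 * h * exp (- (ln (kelvin_B e h x) / 2)) \<le> kelvin_B e h x / kelvin_Y x"
proof -
  define s where "s = sqrt (kelvin_B e h x)"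
  have Bp: "0 < kelvin_B e h x" using B h by (smt (verit) zero_less_power)
  then have s: "0 < s" "s\<^sup>2 = kelvin_B e h x" by (simp_all add: s_def)
  have hs: "h \<le> s" unfolding s_def using B h by (simp add: real_le_rsqrt)
  have As: "kelvin_A e h x \<le> s"
    unfolding s_def using kelvin_A_square_le[OF e, of h x] by (simp add: real_le_rsqrt)
  have "ln s = ln (kelvin_B e h x) / 2" unfolding s_def using Bp by (simp add: ln_sqrt)
  then have ex: "exp (- (ln (kelvin_B e h x) / 2)) = 1 / s"
    using s(1) by (metis exp_ln exp_minus inverse_eq_divide)
  have "h * kelvin_A e h x \<le> h * s" "h * h \<le> h * s" using As hs h by auto
  then have Y: "kelvin_Y x \<le> s\<^sup>2 + 3 * h * s"
    unfolding kelvin_Y_kelvin_B[of x e h] s(2)[symmetric] by (simp add: power2_eq_square)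
  have "(1 - 3 * h / s) * kelvin_Y x \<le> s\<^sup>2"
  proof (cases "1 - 3 * h / s \<le> 0")
    case True
    then show ?thesis using kelvin_Y_pos[OF x] mult_nonpos_nonneg[of "1 - 3 * h / s" "kelvin_Y x"]
      by (smt (verit) zero_le_power2)
  next
    case False
    then have "(1 - 3 * h / s) * kelvin_Y x \<le> (1 - 3 * h / s) * (s\<^sup>2 + 3 * h * s)"
      using Y by (intro mult_left_mono) auto
    also have "\<dots> = s\<^sup>2 - 9 * h\<^sup>2" using s by (simp add: field_simps power2_eq_square)
    also have "\<dots> \<le> s\<^sup>2" by simp
    finally show ?thesis .
  qed
  then show ?thesis using kelvin_Y_pos[OF x] s by (simp add: ex pos_le_divide_eq)
qed

text \<open>The common estimate behind both constructions of subsolutions. Once the positive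
  prefactor is taken out, the potential contributes \<open>c * (b / Y) * g\<close>, handled by
  \<open>kelvin_B_div_kelvin_Y\<close>, and the curved half-space coordinate is handled by
  \<open>smoothing_error\<close>. \<open>M\<close> bounds from below the combination of g and g'
  that multiplies the loss of \<open>soft_pos\<close>.\<close>

lemma kelvin_test_pos_part:
  fixes e :: "'a::euclidean_space"
  assumes e: "norm e = 1" and x: "x \<noteq> 0" and h: "0 < h" and A: "0 < kelvin_A e h x"
    and B: "h\<^sup>2 \<le> kelvin_B e h x" "1 \<le> kelvin_B e h x" and d: "0 < d" and c: "0 \<le> c"
    and g: "\<And>y. (g has_real_derivative g1 y) (at y)" "\<And>y. (g1 has_real_derivative g2 y) (at y)"
    and t: "t = ln (kelvin_B e h x) / 2" and M: "1 \<le> M" "0 \<le> g t" "- M * g t \<le> 2 * g1 t - real DIM('a) * g t"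
  shows "kelvin_C x * (kelvin_Y x)\<^sup>2 * kelvin_B e h x powr (- (real DIM('a) / 4) - 1) * soft_pos (d ^ 3) (kelvin_A e h x) *
      (g2 t - ((real DIM('a))\<^sup>2 / 4 - c) * g t - 3 * h * c * exp (- t) * g t - M\<^sup>2 * d\<^sup>2 * g t)
    \<le> laplacian (kelvin_test e h (soft_pos (d ^ 3)) g) x + c / (norm x)\<^sup>2 * kelvin_test e h (soft_pos (d ^ 3)) g x"
proof -
  define N where "N = real DIM('a)"
  define a b Y where ab: "a = kelvin_A e h x" "b = kelvin_B e h x" "Y = kelvin_Y x"
  define K where "K = kelvin_C x * Y\<^sup>2 * b powr (- (N / 4) - 1) * soft_pos (d ^ 3) a"
  have d3: "0 < d ^ 3" using d by simp
  have a: "0 < a" and b: "1 \<le> b" using A B by (auto simp: ab)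
  have Y: "0 < Y" using kelvin_Y_pos[OF x] by (simp add: ab)
  have K: "0 \<le> K" using kelvin_C_pos[OF x] Y soft_pos_nonneg[OF d3] by (simp add: K_def)
  have B0: "0 < kelvin_B e h x" using B by linarith
  have t': "ln b / 2 = t" using t by (simp add: ab)
  have L: "laplacian (kelvin_test e h (soft_pos (d ^ 3)) g) x = K * (b * g t * ((d ^ 3)\<^sup>2 / a ^ 4) + g2 t - N\<^sup>2 / 4 * g t + d ^ 3 / a * (2 * g1 t - N * g t))"
    using kelvin_laplacian_eq[OF x B0 e soft_pos_DERIV soft_pos1_DERIV g, of "d ^ 3"]
    unfolding ab[symmetric] t' N_def[symmetric] soft_pos_lap[OF d3 a]
    by (simp only: K_def mult.assoc)
  have "b powr (- (N / 4)) = b powr (- (N / 4) - 1) * b"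
    using b powr_add[of b "- (N / 4) - 1" 1] by simp
  then have P: "c / (norm x)\<^sup>2 * kelvin_test e h (soft_pos (d ^ 3)) g x = K * (c * (b / Y) * g t)"
  proof -
    have "c / (norm x)\<^sup>2 = c * Y" by (simp add: ab kelvin_Y_norm)
    moreover have "kelvin_test e h (soft_pos (d ^ 3)) g x = kelvin_C x * (soft_pos (d ^ 3) a * (b powr (- (N / 4)) * g t))"
      unfolding kelvin_test_def ab[symmetric] t' N_def ..
    ultimately show ?thesis
      unfolding K_def \<open>b powr (- (N / 4)) = b powr (- (N / 4) - 1) * b\<close> using Y
      by (simp add: power2_eq_square)
  qed
  have 1: "- (M\<^sup>2 * d\<^sup>2) * g t \<le> b * g t * ((d ^ 3)\<^sup>2 / a ^ 4) + d ^ 3 / a * (2 * g1 t - N * g t)"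
  proof -
    have "- (M\<^sup>2 * d\<^sup>2) * g t \<le> ((d ^ 3)\<^sup>2 / a ^ 4 - M * (d ^ 3 / a)) * g t"
      by (rule mult_right_mono[OF smoothing_error[OF a d M(1)] M(2)])
    also have "\<dots> = 1 * (g t * ((d ^ 3)\<^sup>2 / a ^ 4)) + d ^ 3 / a * (- M * g t)"
      by (simp add: algebra_simps)
    also have "\<dots> \<le> b * (g t * ((d ^ 3)\<^sup>2 / a ^ 4)) + d ^ 3 / a * (2 * g1 t - N * g t)"
      using b M d a by (intro add_mono mult_right_mono mult_left_mono) (auto simp: N_def)
    finally show ?thesis by (simp add: mult.assoc)
  qed
  have 2: "c * g t * (1 - 3 * h * exp (- t)) \<le> c * g t * (b / Y)"
    using kelvin_B_div_kelvin_Y[OF e x h A B(1)] M c by (intro mult_left_mono) (auto simp: ab t)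
  have "g2 t - (N\<^sup>2 / 4 - c) * g t - 3 * h * c * exp (- t) * g t - M\<^sup>2 * d\<^sup>2 * g t
     \<le> (b * g t * ((d ^ 3)\<^sup>2 / a ^ 4) + g2 t - N\<^sup>2 / 4 * g t + d ^ 3 / a * (2 * g1 t - N * g t)) + c * (b / Y) * g t"
    using 1 2 by (simp add: algebra_simps)
  from mult_left_mono[OF this K] show ?thesis
    unfolding L P N_def[symmetric] ab[symmetric] K_def[symmetric] by (simp add: distrib_left)
qed

text \<open>Pointwise inequalities are also wanted at zeros of the test function; there flatness of
  \<open>soft_pos\<close>, or the vanishing of g with two derivatives, kills every term of the
  Laplacian.\<close>

lemma kelvin_test_vanish:
  fixes e :: "'a::euclidean_space"
  assumes e: "norm e = 1" and x: "x \<noteq> 0" and B: "0 < kelvin_B e h x" and d: "0 < \<delta>"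
    and g: "\<And>y. (g has_real_derivative g1 y) (at y)" "\<And>y. (g1 has_real_derivative g2 y) (at y)"
    and z: "kelvin_A e h x \<le> 0 \<or> (g (ln (kelvin_B e h x) / 2) = 0 \<and> g1 (ln (kelvin_B e h x) / 2) = 0 \<and> g2 (ln (kelvin_B e h x) / 2) = 0)"
  shows "laplacian (kelvin_test e h (soft_pos \<delta>) g) x = 0" "kelvin_test e h (soft_pos \<delta>) g x = 0"
  using kelvin_laplacian_eq[OF x B e soft_pos_DERIV soft_pos1_DERIV g, of \<delta>] z soft_pos_zero[OF d, of "kelvin_A e h x"]
  by (auto simp: kelvin_lap_def kelvin_test_def)

text \<open>The reverse triangle inequality for z = x/|x|^2 - h e, squared.\<close>

lemma kelvin_B_lower:
  assumes e: "norm e = 1" and x: "x \<noteq> 0"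
  shows "(1 / norm x - \<bar>h\<bar>)\<^sup>2 \<le> kelvin_B e h x"
proof -
  have Y: "kelvin_Y x = (1 / norm x)\<^sup>2" by (simp add: kelvin_Y_norm power_divide)
  have "\<bar>kelvin_P e x\<bar> \<le> 1 / norm x"
    using kelvin_P_square_le[OF e, of x] Y by (metis abs_le_square_iff abs_of_nonneg norm_ge_zero zero_le_divide_1_iff)
  then have "\<bar>h\<bar> * \<bar>kelvin_P e x\<bar> \<le> \<bar>h\<bar> * (1 / norm x)" by (rule mult_left_mono) simp
  then have "h * kelvin_P e x \<le> \<bar>h\<bar> * (1 / norm x)" by (metis abs_mult abs_le_D1)
  then show ?thesis unfolding kelvin_B_def Y power2_diff by (simp add: power_divide)
qed

lemma kelvin_B_large:
  assumes e: "norm e = 1" and x: "x \<noteq> 0" "norm x \<le> 1 / (\<bar>h\<bar> + S)" and S: "0 < S"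
  shows "S\<^sup>2 \<le> kelvin_B e h x"
proof -
  have "\<bar>h\<bar> + S \<le> 1 / norm x"
    using x S by (simp add: field_simps)
  then have "S\<^sup>2 \<le> (1 / norm x - \<bar>h\<bar>)\<^sup>2" using S by (intro power_mono) auto
  then show ?thesis using kelvin_B_lower[OF e x(1), of h] by linarith
qed

text \<open>Where the function is nonzero, |z| <= 1/|x| <= |z| + h, so bounds on ln |z| confine |x|
  to a compact annulus away from the origin. Positive \<open>kelvin_A\<close> places the point in
  the tangent ball, described by \<open>h * (norm x)^2 <= x . e\<close>.\<close>

lemma kelvin_test_fun:
  fixes e :: "'a::euclidean_space"
  assumes e: "norm e = 1" and h: "0 < h" and d: "0 < \<delta>" and R: "R \<le> 1 / h"
    and D: "{x. 0 < norm x \<and> norm x < R \<and> h * (norm x)\<^sup>2 \<le> x \<bullet> e} \<subseteq> D"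
    and t0: "exp (- t0) < R" and g: "\<forall>t. t < t0 \<or> t1 < t \<longrightarrow> g t = 0"
    and sm: "\<forall>U f. open U \<longrightarrow> smooth_on U f \<longrightarrow> smooth_on U (\<lambda>x::'a. g (f x))"
  shows "test_fun D (kelvin_test e h (soft_pos \<delta>) g)"
    and "kelvin_test e h (soft_pos \<delta>) g x \<noteq> 0 \<Longrightarrow> 0 < kelvin_A e h x \<and> x \<noteq> 0 \<and> t0 \<le> ln (kelvin_B e h x) / 2 \<and> ln (kelvin_B e h x) / 2 \<le> t1"
    and "x \<in> tsupport (kelvin_test e h (soft_pos \<delta>) g) \<Longrightarrow> x \<noteq> 0 \<and> 0 < kelvin_B e h x"
proof -
  let ?\<phi> = "kelvin_test e h (soft_pos \<delta>) g"
  define K where "K = {x. inverse (exp t1 + h) \<le> norm x \<and> norm x \<le> exp (- t0) \<and> h * (norm x)\<^sup>2 \<le> x \<bullet> e}"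
  have nz: "0 < kelvin_A e h x \<and> x \<noteq> 0 \<and> t0 \<le> ln (kelvin_B e h x) / 2 \<and> ln (kelvin_B e h x) / 2 \<le> t1" if "?\<phi> x \<noteq> 0" for x
  proof -
    have "0 < kelvin_A e h x" using that soft_pos_zero[OF d, of "kelvin_A e h x"] by (force simp: kelvin_test_def)
    moreover have "x \<noteq> 0" using calculation h by (auto simp: kelvin_A_def kelvin_P_def)
    moreover have "g (ln (kelvin_B e h x) / 2) \<noteq> 0" using that by (auto simp: kelvin_test_def)
    ultimately show ?thesis using g by (meson not_le)
  qed
  then show "?\<phi> x \<noteq> 0 \<Longrightarrow> 0 < kelvin_A e h x \<and> x \<noteq> 0 \<and> t0 \<le> ln (kelvin_B e h x) / 2 \<and> ln (kelvin_B e h x) / 2 \<le> t1" .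
  have out: "?\<phi> x = 0" if "x \<notin> K" for x
  proof (rule ccontr)
    assume n: "?\<phi> x \<noteq> 0"
    note A = nz[OF n]
    have x: "0 < norm x" using A by simp
    define s where "s = sqrt (kelvin_B e h x)"
    have As: "(kelvin_A e h x)\<^sup>2 \<le> kelvin_B e h x" by (rule kelvin_A_square_le[OF e])
    moreover have "0 < (kelvin_A e h x)\<^sup>2" using A by simp
    ultimately have B: "0 < kelvin_B e h x" by linarith
    then have s: "0 < s" "s\<^sup>2 = kelvin_B e h x" by (simp_all add: s_def)
    have ls: "ln s = ln (kelvin_B e h x) / 2" unfolding s_def using B by (simp add: ln_sqrt)
    have s01: "exp t0 \<le> s" "s \<le> exp t1" using A ls s(1) by (metis exp_le_cancel_iff exp_ln)+
    have Y: "kelvin_Y x = (1 / norm x)\<^sup>2" by (simp add: kelvin_Y_norm power_divide)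
    have "kelvin_A e h x \<le> s" unfolding s_def using As by (simp add: real_le_rsqrt)
    then have "h * kelvin_A e h x \<le> h * s" using h by simp
    then have "(1 / norm x)\<^sup>2 \<le> (s + h)\<^sup>2"
      unfolding Y[symmetric] kelvin_Y_kelvin_B[of x e h] s(2)[symmetric] power2_sum by (simp add: mult.commute)
    then have "1 / norm x \<le> s + h" by (rule power2_le_imp_le) (use s h in auto)
    then have 1: "inverse (exp t1 + h) \<le> norm x"
      using s01 x h s by (smt (verit) divide_le_eq exp_gt_zero inverse_eq_divide mult.commute pos_divide_le_eq)
    have "s\<^sup>2 \<le> (1 / norm x)\<^sup>2"
      unfolding Y[symmetric] kelvin_Y_kelvin_B[of x e h] s(2)[symmetric] using h A by simp
    then have "s \<le> 1 / norm x" by (rule power2_le_imp_le) (use x in auto)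
    then have "exp t0 * norm x \<le> 1" using s01 x by (smt (verit) pos_le_divide_eq)
    then have 2: "norm x \<le> exp (- t0)" by (simp add: exp_minus field_simps)
    have "h < (x \<bullet> e) * (1 / norm x)\<^sup>2" using A by (simp add: kelvin_A_def kelvin_P_def Y)
    then have "h * (norm x)\<^sup>2 \<le> x \<bullet> e" using x by (simp add: power_divide field_simps)
    with 1 2 that show False by (simp add: K_def)
  qed
  have "closed K" unfolding K_def
    by (intro closed_Collect_conj closed_Collect_le continuous_intros)
  moreover have "bounded K" unfolding K_def
    by (rule bounded_subset[OF bounded_cball[of 0 "exp (- t0)"]]) auto
  ultimately have K: "compact K" by (simp add: compact_eq_bounded_closed)
  have Kp: "0 < norm x" "norm x < R" if "x \<in> K" for x
  proof -
    have "0 < inverse (exp t1 + h)" using h by (simp add: add_pos_pos)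
    moreover have "inverse (exp t1 + h) \<le> norm x" using that by (simp add: K_def)
    ultimately show "0 < norm x" by linarith
    show "norm x < R" using that t0 by (simp add: K_def)
  qed
  have KD: "K \<subseteq> D" using D Kp by (auto simp: K_def)
  \<comment> \<open>|z| vanishes only at e/h, which has norm 1/h >= R; hence \<open>kelvin_B\<close>
    is positive on this punctured ball and the logarithm is smooth there.\<close>
  define U where "U = ball 0 R - {0::'a}"
  have U: "open U" "0 \<notin> U" "K \<subseteq> U" using Kp by (auto simp: U_def)
  have BU: "0 < kelvin_B e h x" if "x \<in> U" for x
  proof -
    have "x \<noteq> 0" "norm x < 1 / h" using that R by (auto simp: U_def)
    then have "h < 1 / norm x" using h by (simp add: field_simps)
    then have "0 < (1 / norm x - \<bar>h\<bar>)\<^sup>2" using h by simp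
    then show ?thesis using kelvin_B_lower[OF e \<open>x \<noteq> 0\<close>, of h] by linarith
  qed
  have "smooth_on U ?\<phi>"
  proof (rule smooth_kelvin_test[OF U(1,2) BU])
    show "smooth_on U (\<lambda>x. soft_pos \<delta> (kelvin_A e h x))"
      unfolding soft_pos_def divide_inverse by (intro smooth_on_mult smooth_on_bexp smooth_kelvin_A smooth_on_const U)
    show "smooth_on U (\<lambda>x. g (ln (kelvin_B e h x) / 2))"
      unfolding divide_inverse by (intro sm[rule_format] smooth_on_mult smooth_on_ln smooth_kelvin_B smooth_on_const U BU)
  qed
  then have "smooth_on UNIV ?\<phi>"
    by (rule smooth_on_extend_zero[OF U(1) _ compact_imp_closed[OF K] U(3) out])
  moreover have ts: "tsupport ?\<phi> \<subseteq> K"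
    by (rule tsupport_subset[OF compact_imp_closed[OF K] out])
  ultimately show "test_fun D ?\<phi>"
    unfolding test_fun_def using compact_tsupport[of K ?\<phi>, OF K out] ts KD by blast
  show "x \<in> tsupport ?\<phi> \<Longrightarrow> x \<noteq> 0 \<and> 0 < kelvin_B e h x"
    using ts U(2,3) BU by blast
qed

section \<open>The Hardy constant\<close>

text \<open>With \<open>- h\<close> in place of \<open>h\<close> the potential error has relative
  size h/|z|, while g'' contributes a gain of size |z|^(-1/2), which wins near the origin.
  \<open>W\<close> only has to be positive on \<open>U\<close>, so the half-space coordinate enters
  unsmoothed.\<close>

lemma hardy_lower_domain:
  fixes e :: "'a::euclidean_space"
  assumes e: "norm e = 1" and h: "0 < h"
  shows "\<exists>r1>0. \<forall>U \<phi>. open U \<longrightarrow> (\<forall>x\<in>U. x \<noteq> 0 \<and> norm x < r1 \<and> - h * (norm x)\<^sup>2 < x \<bullet> e) \<longrightarrow> test_fun U \<phi> \<longrightarrow>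
     (real DIM('a))\<^sup>2 / 4 * (LINT x|lebesgue. (\<phi> x)\<^sup>2 / (norm x)\<^sup>2) \<le> (LINT x|lebesgue. grad_sq \<phi> x)"
proof -
  define N where "N = real DIM('a)"
  \<comment> \<open>A lower bound for |z|^(1/2): the 2 keeps g away from 0, 4 h yields
    \<open>b / 2 <= Y\<close>, and 4 N^2 h lets the gain absorb the potential error.\<close>
  define S0 where "S0 = 2 + 4 * N\<^sup>2 * h + 4 * h"
  have "0 \<le> N\<^sup>2 * h" using h by simp
  then have S0: "2 \<le> S0" "4 * N\<^sup>2 * h \<le> S0" "4 * h \<le> S0" using h by (auto simp: S0_def)
  define g where "g t = 1 - exp (- (t / 2))" for t :: real
  define g1 where "g1 t = exp (- (t / 2)) / 2" for t :: real
  define g2 where "g2 t = - exp (- (t / 2)) / 4" for t :: real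
  have g: "(g has_real_derivative g1 t) (at t)" "(g1 has_real_derivative g2 t) (at t)" for t
    unfolding g_def[abs_def] g1_def[abs_def] g2_def by (auto intro!: derivative_eq_intros)
  have i: "((\<lambda>y. y) has_real_derivative 1) (at y)" "((\<lambda>y::real. 1) has_real_derivative 0) (at y)" for y :: real
    by auto
  define W where "W = kelvin_test e (- h) (\<lambda>y. y) g"
  show ?thesis
  proof (intro exI conjI allI impI)
    show "0 < 1 / (\<bar>- h\<bar> + S0\<^sup>2)" using h by (simp add: add_pos_nonneg)
    fix U \<phi> assume U: "open U" and Ux: "\<forall>x\<in>U. x \<noteq> 0 \<and> norm x < 1 / (\<bar>- h\<bar> + S0\<^sup>2) \<and> - h * (norm x)\<^sup>2 < x \<bullet> e"
      and \<phi>: "test_fun U \<phi>"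
    have U0: "0 \<notin> U" using Ux by auto
    have B: "(S0\<^sup>2)\<^sup>2 \<le> kelvin_B e (- h) x" if "x \<in> U" for x
      using kelvin_B_large[OF e, of x "- h" "S0\<^sup>2"] Ux that S0 by auto
    have S4: "0 < (S0\<^sup>2)\<^sup>2" using S0 by simp
    have Bp: "0 < kelvin_B e (- h) x" if "x \<in> U" for x using B[OF that] S4 by linarith
    have A: "0 < kelvin_A e (- h) x" if "x \<in> U" for x
    proof -
      have "0 < norm x" "- h * (norm x)\<^sup>2 < x \<bullet> e" using Ux that by auto
      then show ?thesis by (simp add: kelvin_A_def kelvin_P_def kelvin_Y_norm field_simps)
    qed
    have key: "0 < W x \<and> N\<^sup>2 / 4 * inverse ((norm x)\<^sup>2) * W x \<le> - laplacian W x" if x: "x \<in> U" for x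
    proof -
      \<comment> \<open>\<open>s\<close> is |z|^(1/2), so that g equals 1 - 1/s.\<close>
      define s where "s = sqrt (sqrt (kelvin_B e (- h) x))"
      have s0: "0 < s" and s2: "s\<^sup>2 = sqrt (kelvin_B e (- h) x)" and s4: "(s\<^sup>2)\<^sup>2 = kelvin_B e (- h) x"
        using Bp[OF x] by (simp_all add: s_def)
      have "S0\<^sup>2 \<le> s\<^sup>2" using B[OF x] unfolding s4[symmetric] by (rule power2_le_imp_le) simp
      then have "S0 \<le> s" by (rule power2_le_imp_le) (use s0 in simp)
      with S0 have s: "2 \<le> s" "4 * N\<^sup>2 * h \<le> s" "4 * h \<le> s" by auto
      have ex: "exp (- (ln (kelvin_B e (- h) x) / 2 / 2)) = 1 / s"
      proof -
        have "ln s = ln (kelvin_B e (- h) x) / 2 / 2" using Bp[OF x] by (simp add: s_def ln_sqrt)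
        then show ?thesis using s0 by (metis exp_ln exp_minus inverse_eq_divide)
      qed
      define a b Y where d: "a = kelvin_A e (- h) x" "b = kelvin_B e (- h) x" "Y = kelvin_Y x"
      have a0: "0 < a" and b0: "0 < b" and C0: "0 < kelvin_C x" and Y0: "0 < Y"
        using A Bp x kelvin_C_pos[of x] kelvin_Y_pos[of x] U0 by (auto simp: d)
      have as: "a \<le> s\<^sup>2" unfolding d s2 using kelvin_A_square_le[OF e, of "- h" x] by (simp add: real_le_rsqrt)
      have Yb: "Y = b - 2 * h * a + h\<^sup>2" unfolding d by (subst kelvin_Y_kelvin_B[of x e "- h"]) simp
      have has: "h * a \<le> h * s\<^sup>2" using as h by simp
      have g0: "g (ln b / 2) = 1 - 1 / s" unfolding g_def d(2) ex ..
      have g2': "g2 (ln b / 2) = - (1 / s) / 4" unfolding g2_def d(2) ex ..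
      have g01: "0 < 1 - 1 / s" "1 - 1 / s \<le> 1" using s by auto
      have bs: "b = s * s * (s * s)" using s4 by (simp add: d power2_eq_square)
      have ss: "4 * h \<le> s * s" using s by (smt (verit) mult_le_cancel_right1)
      have "h * s\<^sup>2 * 4 \<le> b" unfolding bs using mult_right_mono[OF ss, of "s * s"] by (simp add: power2_eq_square algebra_simps)
      then have Yl: "b / 2 \<le> Y" using Yb has zero_le_power2[of h] by linarith
      \<comment> \<open>The supersolution inequality with its common positive factors removed. The
        defect, where positive, is controlled by 2 h s^2, and the gain Y/(4 s) is at least s^3/8
        because \<open>Y\<close> is at least s^4/2.\<close>
      have main: "N\<^sup>2 / 4 * b * (1 - 1 / s) \<le> Y * (N\<^sup>2 / 4 * (1 - 1 / s) + 1 / s / 4)"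
      proof -
        have "(b - Y) * (1 - 1 / s) \<le> 2 * h * s\<^sup>2"
        proof (cases "b - Y \<le> 0")
          case True
          have "(b - Y) * (1 - 1 / s) \<le> 0" using True g01 by (simp add: mult_nonpos_nonneg)
          then show ?thesis using h by (smt (verit) mult_nonneg_nonneg zero_le_power2)
        next
          case False
          then have "(b - Y) * (1 - 1 / s) \<le> b - Y" using g01 by (intro mult_left_le) auto
          then show ?thesis using Yb has zero_le_power2[of h] by linarith
        qed
        then have "N\<^sup>2 / 4 * ((b - Y) * (1 - 1 / s)) \<le> N\<^sup>2 / 4 * (2 * h * s\<^sup>2)" by (intro mult_left_mono) auto
        also have "\<dots> = (4 * N\<^sup>2 * h) * s\<^sup>2 / 8" by simp
        also have "\<dots> \<le> s * s\<^sup>2 / 8" using s by (intro divide_right_mono mult_right_mono) auto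
        also have "\<dots> = b / 2 * (1 / s / 4)" using s0 unfolding bs by (simp add: power2_eq_square)
        also have "\<dots> \<le> Y * (1 / s / 4)" using Yl s0 by (intro mult_right_mono) auto
        finally have "N\<^sup>2 / 4 * ((b - Y) * (1 - 1 / s)) \<le> Y * (1 / s / 4)" .
        moreover have "N\<^sup>2 / 4 * ((b - Y) * q) \<le> Y * r \<Longrightarrow> N\<^sup>2 / 4 * b * q \<le> Y * (N\<^sup>2 / 4 * q + r)" for q r
          by (simp add: algebra_simps)
        ultimately show ?thesis by blast
      qed
      define Q where "Q = b powr (- (N / 4) - 1)"
      have Q0: "0 < Q" using b0 by (simp add: Q_def)
      have bQ: "b powr (- (N / 4)) = Q * b"
        unfolding Q_def using b0 powr_add[of b "- (N / 4) - 1" 1] by simp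
      have W: "W x = kelvin_C x * (a * (Q * b * (1 - 1 / s)))"
        unfolding W_def kelvin_test_def d[symmetric] N_def[symmetric] bQ g0 ..
      have "laplacian W x = kelvin_C x * Y\<^sup>2 * Q * kelvin_lap N a b a 1 0 (g (ln b / 2)) (g1 (ln b / 2)) (g2 (ln b / 2))"
        unfolding W_def d N_def Q_def
        by (rule kelvin_laplacian_eq[OF _ Bp[OF x] e i g]) (use x U0 in auto)
      also have "\<dots> = - (kelvin_C x * Y * Q * a * (Y * (N\<^sup>2 / 4 * (1 - 1 / s) + 1 / s / 4)))"
        unfolding kelvin_lap_def g0 g2' by (simp add: algebra_simps power2_eq_square)
      finally have L: "- laplacian W x = kelvin_C x * Y * Q * a * (Y * (N\<^sup>2 / 4 * (1 - 1 / s) + 1 / s / 4))" by simp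
      have "N\<^sup>2 / 4 * inverse ((norm x)\<^sup>2) * W x = kelvin_C x * Y * Q * a * (N\<^sup>2 / 4 * b * (1 - 1 / s))"
      proof -
        have "inverse ((norm x)\<^sup>2) = Y" by (simp add: d kelvin_Y_norm inverse_eq_divide)
        then show ?thesis unfolding W by (simp only: mult_ac)
      qed
      also have "\<dots> \<le> - laplacian W x"
        unfolding L using main C0 Y0 Q0 a0 by (intro mult_left_mono) auto
      finally show ?thesis
        using C0 a0 Q0 b0 g01 unfolding W by simp
    qed
    have sW: "smooth_on U W"
      unfolding W_def
    proof (rule smooth_kelvin_test[OF U U0 Bp smooth_kelvin_A[OF U U0]])
      have "smooth_on U (\<lambda>x. 1 - exp (ln (kelvin_B e (- h) x) * (- 1 / 4)))"
        by (intro smooth_on_diff smooth_on_exp smooth_on_mult smooth_on_ln smooth_kelvin_B smooth_on_const U U0 Bp)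
      then show "smooth_on U (\<lambda>x. g (ln (kelvin_B e (- h) x) / 2))"
        by (simp add: g_def)
    qed
    have "(LINT x|lebesgue. (\<phi> x)\<^sup>2 * (N\<^sup>2 / 4 * inverse ((norm x)\<^sup>2))) \<le> (LINT x|lebesgue. grad_sq \<phi> x)"
    proof (rule hardy_from_supersolution[OF U sW _ _ _ \<phi>])
      show "continuous_on U (\<lambda>x. N\<^sup>2 / 4 * inverse ((norm x)\<^sup>2))"
        using U0 by (intro continuous_intros) auto
      show "0 < W x" "N\<^sup>2 / 4 * inverse ((norm x)\<^sup>2) * W x \<le> - laplacian W x" if "x \<in> U" for x
        using key[OF that] by blast+
    qed
    also have "(\<lambda>x. (\<phi> x)\<^sup>2 * (N\<^sup>2 / 4 * inverse ((norm x)\<^sup>2))) = (\<lambda>x. N\<^sup>2 / 4 * ((\<phi> x)\<^sup>2 / (norm x)\<^sup>2))"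
      by (simp only: divide_inverse mult_ac)
    finally show "(real DIM('a))\<^sup>2 / 4 * (LINT x|lebesgue. (\<phi> x)\<^sup>2 / (norm x)\<^sup>2) \<le> (LINT x|lebesgue. grad_sq \<phi> x)"
      unfolding N_def integral_mult_right_zero .
  qed
qed

text \<open>With y = 1/v and w = 1/(1-v) the right-hand side is the second derivative of
  \<open>bump\<close> divided by \<open>bump\<close>. At most one of y, w exceeds 2, and its fourth
  power dominates the rest; 500 is merely large enough. The w^4 is kept to absorb the smoothing
  error near the right end.\<close>

lemma bump_quartic:
  fixes y w :: real
  assumes "1 < y" "1 < w" "1 / y + 1 / w = 1"
  shows "w ^ 4 / 4 - 500 \<le> (y\<^sup>2 - w\<^sup>2)\<^sup>2 - 2 * y ^ 3 - 2 * w ^ 3"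
proof -
  have yw: "y \<le> 2 \<or> w \<le> 2"
  proof (rule ccontr)
    assume "\<not> ?thesis"
    then have "1 / y < 1 / 2" "1 / w < 1 / 2" by (auto simp: field_simps)
    then show False using assms(3) by linarith
  qed
  have est: "- 400 \<le> z ^ 4 * (3 / 4) - 2 * z ^ 3 - 8 * z\<^sup>2" for z :: real
  proof -
    have "0 \<le> (z\<^sup>2 / 2 - 2 * z)\<^sup>2 + (z\<^sup>2 - 12)\<^sup>2 / 2" by simp
    also have "\<dots> = z ^ 4 * (3 / 4) - 2 * z ^ 3 - 8 * z\<^sup>2 + 72"
      by (simp add: power2_eq_square power3_eq_cube power4_eq_xxxx field_simps)
    finally show ?thesis by linarith
  qed
  from yw show ?thesis
  proof
    assume y: "y \<le> 2"
    have "y\<^sup>2 * w\<^sup>2 \<le> 4 * w\<^sup>2" using y assms power_mono[of y 2 2] by (intro mult_right_mono) auto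
    moreover have "y ^ 3 \<le> 8" using y assms power_mono[of y 2 3] by simp
    moreover have "(y\<^sup>2 - w\<^sup>2)\<^sup>2 = y ^ 4 + w ^ 4 - 2 * (y\<^sup>2 * w\<^sup>2)" by (simp add: power2_eq_square power4_eq_xxxx algebra_simps)
    moreover have "0 \<le> y ^ 4" by simp
    ultimately show ?thesis using est[of w] by linarith
  next
    assume w: "w \<le> 2"
    have "y\<^sup>2 * w\<^sup>2 \<le> y\<^sup>2 * 4" using w assms power_mono[of w 2 2] by (intro mult_left_mono) auto
    moreover have "w ^ 3 \<le> 8" "w ^ 4 \<le> 16" using w assms power_mono[of w 2 3] power_mono[of w 2 4] by simp_all
    moreover have "(y\<^sup>2 - w\<^sup>2)\<^sup>2 = y ^ 4 + w ^ 4 - 2 * (y\<^sup>2 * w\<^sup>2)" by (simp add: power2_eq_square power4_eq_xxxx algebra_simps)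
    moreover have "0 \<le> y ^ 4" "0 \<le> w ^ 4" by simp_all
    ultimately show ?thesis using est[of y] by linarith
  qed
qed

definition bump :: "real \<Rightarrow> real" where
  "bump v = bexp v * bexp (1 - v)"

definition bump1 :: "real \<Rightarrow> real" where
  "bump1 v = bexp1 v * bexp (1 - v) - bexp v * bexp1 (1 - v)"

definition bump2 :: "real \<Rightarrow> real" where
  "bump2 v = bexp2 v * bexp (1 - v) - 2 * (bexp1 v * bexp1 (1 - v)) + bexp v * bexp2 (1 - v)"

lemma bump_DERIV: "(bump has_real_derivative bump1 v) (at v)"
  and bump1_DERIV: "(bump1 has_real_derivative bump2 v) (at v)"
proof -
  have l: "((\<lambda>v. 1 - v) has_real_derivative - 1) (at v)" by (auto intro!: derivative_eq_intros)
  note d = DERIV_chain2[OF bexp_DERIV l] DERIV_chain2[OF bexp1_DERIV l]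
  show "(bump has_real_derivative bump1 v) (at v)"
    unfolding bump_def[abs_def] bump1_def
    by (rule DERIV_cong[OF DERIV_mult[OF bexp_DERIV d(1)]]) simp
  show "(bump1 has_real_derivative bump2 v) (at v)"
    unfolding bump1_def[abs_def] bump2_def
    by (rule DERIV_cong[OF DERIV_diff[OF DERIV_mult[OF bexp1_DERIV d(1)] DERIV_mult[OF bexp_DERIV d(2)]]]) simp
qed

text \<open>Lower bounds suffice for a subsolution. The left end contributes positively to the first
  derivative and is dropped; the right end is tracked by \<open>w\<close>.\<close>

lemma bump_estimates:
  assumes v: "0 < v" "v < 1"
  defines "w \<equiv> 1 / (1 - v)"
  shows "0 < bump v" "1 < w" "- (w\<^sup>2) * bump v \<le> bump1 v" "(w ^ 4 / 4 - 500) * bump v \<le> bump2 v"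
proof -
  define y where "y = 1 / v"
  have yw: "1 < y" "1 < w" "1 / y + 1 / w = 1" using v by (auto simp: y_def w_def)
  show b: "0 < bump v" using v by (simp add: bump_def bexp_def)
  show "1 < w" by (rule yw)
  have e: "bexp1 v = bexp v * y\<^sup>2" "bexp1 (1 - v) = bexp (1 - v) * w\<^sup>2"
    "bexp2 v = bexp v * (y ^ 4 - 2 * y ^ 3)" "bexp2 (1 - v) = bexp (1 - v) * (w ^ 4 - 2 * w ^ 3)"
    using v by (simp_all add: bexp_def bexp1_def bexp2_def y_def w_def power_divide)
  have "bump1 v = bump v * y\<^sup>2 + - (w\<^sup>2) * bump v" unfolding bump1_def e bump_def by (simp add: algebra_simps)
  then show "- (w\<^sup>2) * bump v \<le> bump1 v" using b by simp
  have "bump2 v = ((y\<^sup>2 - w\<^sup>2)\<^sup>2 - 2 * y ^ 3 - 2 * w ^ 3) * bump v" unfolding bump2_def e bump_def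
    by (simp add: algebra_simps power2_eq_square power4_eq_xxxx)
  then show "(w ^ 4 / 4 - 500) * bump v \<le> bump2 v"
    using mult_right_mono[OF bump_quartic[OF yw], of "bump v"] b by simp
qed

lemma bump_zero: "v \<le> 0 \<or> 1 \<le> v \<Longrightarrow> bump v = 0"
  by (auto simp: bump_def bexp_def)

lemma smooth_on_bump: "open U \<Longrightarrow> smooth_on U f \<Longrightarrow> smooth_on U (\<lambda>x. bump (f x))"
  unfolding bump_def by (intro smooth_on_mult smooth_on_bexp smooth_on_diff smooth_on_const)

text \<open>The point with z = q e, where both arguments of \<open>kelvin_test\<close> are explicit;
  it certifies that test functions do not vanish identically.\<close>

lemma kelvin_axis_point:
  fixes e :: "'a::euclidean_space"
  assumes "norm e = 1" "0 < h" "0 < q"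
  obtains x where "kelvin_A e h x = q" "ln (kelvin_B e h x) / 2 = ln q" "x \<noteq> 0"
proof -
  define s where "s = 1 / (q + h)"
  have s: "0 < s" "1 / s = q + h" using assms by (auto simp: s_def)
  have "e \<bullet> e = 1" using assms by (simp add: norm_eq_1)
  then have Y: "kelvin_Y (s *\<^sub>R e) = (1 / s)\<^sup>2" and P: "kelvin_P e (s *\<^sub>R e) = 1 / s"
    using s(1) by (simp_all add: kelvin_P_def kelvin_Y_def power2_eq_square field_simps)
  have "kelvin_B e h (s *\<^sub>R e) = q\<^sup>2"
    unfolding kelvin_B_def Y P s(2) by (simp add: power2_eq_square algebra_simps)
  then have "ln (kelvin_B e h (s *\<^sub>R e)) / 2 = ln q" using assms by (simp add: ln_realpow)
  moreover have "kelvin_A e h (s *\<^sub>R e) = q" unfolding kelvin_A_def P s(2) by simp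
  moreover have "s *\<^sub>R e \<noteq> 0" using s assms by auto
  ultimately show ?thesis using that by blast
qed

lemma hardy_upper_domain:
  fixes e :: "'a::euclidean_space"
  assumes e: "norm e = 1" and h: "0 < h" and R: "0 < R" "R \<le> 1 / h" and D: "open D" "0 \<notin> D"
    and De: "{x. 0 < norm x \<and> norm x < R \<and> h * (norm x)\<^sup>2 \<le> x \<bullet> e} \<subseteq> D"
    and eps: "0 < \<epsilon>"
  shows "\<exists>\<phi>. test_fun D \<phi> \<and> (\<exists>x. \<phi> x \<noteq> 0) \<and>
    (LINT x|lebesgue. grad_sq \<phi> x) \<le> ((real DIM('a))\<^sup>2 / 4 + \<epsilon>) * (LINT x|lebesgue. (\<phi> x)\<^sup>2 / (norm x)\<^sup>2)"
proof -
  define N where "N = real DIM('a)"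
  define c where "c = N\<^sup>2 / 4 + \<epsilon>"
  have c: "0 < c" using eps by (simp add: c_def add_nonneg_pos)
  \<comment> \<open>|z| >= X on the support: the summand h gives h <= |z|, 2/R keeps the support in
    norm < R, and the last one bounds the potential error by epsilon/2.\<close>
  define X where "X = 1 + h + 2 / R + 6 * h * c / \<epsilon>"
  have X: "1 \<le> X" "h \<le> X" "2 / R \<le> X" "6 * h * c / \<epsilon> \<le> X"
    using h R c eps by (auto simp: X_def)
  define t0 where "t0 = ln X"
  have et0: "exp t0 = X" using X by (simp add: t0_def)
  \<comment> \<open>Wide enough that the loss 500/L^2 of the bump is at most epsilon/2.\<close>
  define L where "L = 1 + 1000 / \<epsilon>"
  have L1: "1 \<le> L" using eps by (simp add: L_def)
  have "1000 / \<epsilon> \<le> L * L" using L1 mult_left_mono[of 1 L L] by (simp add: L_def)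
  then have L: "500 / L\<^sup>2 \<le> \<epsilon> / 2" using eps L1 by (simp add: power2_eq_square field_simps)
  \<comment> \<open>Gives M d <= w^2/(2 L), so the smoothing error is covered by the term w^4/(4
    L^2) of the bump.\<close>
  define d where "d = 1 / (2 * (N + 2) * L)"
  have N: "1 \<le> N" by (simp add: N_def Suc_leI)
  have d: "0 < d" using N L1 by (simp add: d_def)
  define g where "g t = bump ((t - t0) / L)" for t
  define g1 where "g1 t = bump1 ((t - t0) / L) / L" for t
  define g2 where "g2 t = bump2 ((t - t0) / L) / L\<^sup>2" for t
  have l: "((\<lambda>t. (t - t0) / L) has_real_derivative 1 / L) (at t)" for t
    by (rule DERIV_cong[OF DERIV_cdivide[OF DERIV_diff[OF DERIV_ident DERIV_const]]]) simp
  have g: "(g has_real_derivative g1 t) (at t)" "(g1 has_real_derivative g2 t) (at t)" for t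
  proof -
    show "(g has_real_derivative g1 t) (at t)"
      unfolding g_def[abs_def] g1_def by (rule DERIV_cong[OF DERIV_chain2[OF bump_DERIV l]]) simp
    show "(g1 has_real_derivative g2 t) (at t)"
      unfolding g1_def[abs_def] g2_def
      by (rule DERIV_cong[OF DERIV_cdivide[OF DERIV_chain2[OF bump1_DERIV l]]]) (simp add: power2_eq_square)
  qed
  have gz: "\<forall>t. t < t0 \<or> t0 + L < t \<longrightarrow> g t = 0"
    unfolding g_def by (intro allI impI bump_zero) (use L1 in \<open>auto simp: field_simps\<close>)
  have sm: "\<forall>U f. open U \<longrightarrow> smooth_on U f \<longrightarrow> smooth_on U (\<lambda>x::'a. g (f x))"
    unfolding g_def divide_inverse
    by (intro allI impI smooth_on_bump smooth_on_mult smooth_on_diff smooth_on_const)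
  define \<phi> where "\<phi> = kelvin_test e h (soft_pos (d ^ 3)) g"
  have d3: "0 < d ^ 3" using d by simp
  have "1 / X < R" using X R by (smt (verit) divide_less_eq mult.commute pos_divide_le_eq)
  then have t0R: "exp (- t0) < R" by (simp add: exp_minus et0 inverse_eq_divide)
  note tf = kelvin_test_fun[OF e h d3 R(2) De t0R gz sm, folded \<phi>_def]
  \<comment> \<open>The subsolution inequality for c = N^2/4 + epsilon, multiplied by phi >= 0; its
    integral is the bound on the Rayleigh quotient.\<close>
  have pw: "\<phi> x * - laplacian \<phi> x \<le> c * ((\<phi> x)\<^sup>2 / (norm x)\<^sup>2)" for x
  proof (cases "\<phi> x = 0")
    case False
    from tf(2)[OF this] have A: "0 < kelvin_A e h x" and x: "x \<noteq> 0" and tb: "t0 \<le> ln (kelvin_B e h x) / 2" "ln (kelvin_B e h x) / 2 \<le> t0 + L" by auto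
    define t where "t = ln (kelvin_B e h x) / 2"
    define \<theta> where "\<theta> = (t - t0) / L"
    have "g t \<noteq> 0" using False by (auto simp: \<phi>_def kelvin_test_def t_def)
    then have "bump \<theta> \<noteq> 0" by (simp add: g_def \<theta>_def)
    then have th: "0 < \<theta>" "\<theta> < 1" using bump_zero by (meson not_le)+
    define w where "w = 1 / (1 - \<theta>)"
    note be = bump_estimates[OF th, folded w_def]
    have Bp: "0 < kelvin_B e h x"
      using kelvin_A_square_le[OF e, of h x] A by (smt (verit) zero_less_power)
    have eX: "exp (- t) \<le> 1 / X" using tb et0 by (metis t_def exp_le_cancel_iff exp_minus inverse_eq_divide neg_le_iff_le)
    have "X\<^sup>2 \<le> kelvin_B e h x"
    proof -
      have "X\<^sup>2 = exp (2 * t0)" by (simp add: et0[symmetric] exp_double)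
      also have "\<dots> \<le> exp (ln (kelvin_B e h x))" using tb by simp
      finally show ?thesis using Bp by simp
    qed
    moreover have "h\<^sup>2 \<le> X\<^sup>2" "1 \<le> X\<^sup>2" using X h by (auto intro: power_mono one_le_power)
    ultimately have B: "h\<^sup>2 \<le> kelvin_B e h x" "1 \<le> kelvin_B e h x" by auto
    have gt: "g t = bump \<theta>" by (simp add: g_def \<theta>_def)
    have w1: "1 \<le> w\<^sup>2" using be(2) by (simp add: one_le_power)
    define M where "M = N + 2 * w\<^sup>2"
    have M1: "1 \<le> M" using N w1 by (simp add: M_def)
    have Mg: "- M * g t \<le> 2 * g1 t - real DIM('a) * g t"
    proof -
      have "w\<^sup>2 * bump \<theta> * 1 \<le> w\<^sup>2 * bump \<theta> * L" using L1 be(1) by (intro mult_left_mono) auto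
      then have "(- (w\<^sup>2) * bump \<theta>) * L \<le> bump1 \<theta>" using be(3) by simp
      then have "- (w\<^sup>2) * bump \<theta> \<le> g1 t"
        unfolding g1_def \<theta>_def[symmetric] using L1 by (subst pos_le_divide_eq) auto
      moreover have "- M * bump \<theta> = 2 * (- (w\<^sup>2) * bump \<theta>) - N * bump \<theta>" unfolding M_def by algebra
      ultimately show ?thesis unfolding gt N_def by linarith
    qed
    have Md: "M\<^sup>2 * d\<^sup>2 \<le> w ^ 4 / 4 / L\<^sup>2"
    proof -
      have "N * 1 \<le> N * w\<^sup>2" using N w1 by (intro mult_left_mono) auto
      then have "M \<le> (N + 2) * w\<^sup>2" by (simp add: M_def algebra_simps)
      then have "M * d \<le> (N + 2) * w\<^sup>2 * d" using d by (intro mult_right_mono) auto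
      also have "\<dots> = w\<^sup>2 / (2 * L)" 
      proof -
        have "n * v * (1 / (2 * n * L)) = v / (2 * L)" if "n \<noteq> 0" for n v :: real using that by simp
        from this[of "N + 2" "w\<^sup>2"] show ?thesis unfolding d_def using N by simp
      qed
      finally have "(M * d)\<^sup>2 \<le> (w\<^sup>2 / (2 * L))\<^sup>2" using M1 d by (intro power_mono) auto
      then show ?thesis by (simp add: power_mult_distrib power_divide)
    qed
    have hc: "3 * h * c * exp (- t) \<le> \<epsilon> / 2"
    proof -
      have "3 * h * c * exp (- t) \<le> 3 * h * c * (1 / X)" using eX h c by (intro mult_left_mono) auto
      also have "\<dots> \<le> \<epsilon> / 2" using X(1,4) eps by (simp add: field_simps)
      finally show ?thesis .
    qed
    have "0 \<le> ((w ^ 4 / 4 - 500) / L\<^sup>2 + \<epsilon> - 3 * h * c * exp (- t) - M\<^sup>2 * d\<^sup>2) * g t"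
      using hc Md L be(1) unfolding gt by (intro mult_nonneg_nonneg) (auto simp: diff_divide_distrib)
    also have "\<dots> \<le> g2 t - (N\<^sup>2 / 4 - c) * g t - 3 * h * c * exp (- t) * g t - M\<^sup>2 * d\<^sup>2 * g t"
    proof -
      have "(w ^ 4 / 4 - 500) / L\<^sup>2 * g t \<le> g2 t"
        using divide_right_mono[OF be(4), of "L\<^sup>2"] unfolding gt g2_def \<theta>_def[symmetric] by simp
      then show ?thesis by (simp add: c_def algebra_simps)
    qed
    finally have nn: "0 \<le> g2 t - (N\<^sup>2 / 4 - c) * g t - 3 * h * c * exp (- t) * g t - M\<^sup>2 * d\<^sup>2 * g t" .
    have "0 \<le> kelvin_C x * (kelvin_Y x)\<^sup>2 * kelvin_B e h x powr (- (real DIM('a) / 4) - 1) * soft_pos (d ^ 3) (kelvin_A e h x)"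
      using kelvin_C_pos[OF x] soft_pos_nonneg[OF d3] by simp
    from mult_nonneg_nonneg[OF this nn] have "0 \<le> laplacian \<phi> x + c / (norm x)\<^sup>2 * \<phi> x"
      using kelvin_test_pos_part[OF e x h A B d less_imp_le[OF c] g t_def M1 _ Mg] be(1)
      unfolding \<phi>_def gt N_def by simp
    moreover have "0 \<le> \<phi> x"
      using kelvin_C_pos[OF x] soft_pos_nonneg[OF d3] be(1) gt unfolding \<phi>_def kelvin_test_def t_def by simp
    ultimately have "0 \<le> \<phi> x * (laplacian \<phi> x + c / (norm x)\<^sup>2 * \<phi> x)" by simp
    then show ?thesis by (simp add: algebra_simps power2_eq_square)
  qed simp
  have pu: "test_fun UNIV \<phi>" "smooth_on UNIV \<phi>" using tf(1) by (auto simp: test_fun_def)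
  have "(LINT x|lebesgue. grad_sq \<phi> x) = (LINT x|lebesgue. \<phi> x * - laplacian \<phi> x)"
    by (rule grad_sq_by_parts[OF tf(1)])
  also have "\<dots> \<le> (LINT x|lebesgue. c * ((\<phi> x)\<^sup>2 / (norm x)\<^sup>2))"
  proof (rule integral_mono[OF _ _ pw])
    show "integrable lebesgue (\<lambda>x. \<phi> x * - laplacian \<phi> x)"
      using continuous_laplacian[OF pu(2)] by (intro test_fun_mult_continuous[OF open_UNIV pu(1)] continuous_intros)
    have "integrable lebesgue (\<lambda>x. (\<phi> x)\<^sup>2 * inverse ((norm x)\<^sup>2))"
      using D by (intro test_fun_mult_continuous[OF D(1) test_fun_square[OF tf(1)]] continuous_intros) auto
    then show "integrable lebesgue (\<lambda>x. c * ((\<phi> x)\<^sup>2 / (norm x)\<^sup>2))" by (simp add: divide_inverse)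
  qed
  finally have "(LINT x|lebesgue. grad_sq \<phi> x) \<le> c * (LINT x|lebesgue. (\<phi> x)\<^sup>2 / (norm x)\<^sup>2)"
    unfolding integral_mult_right_zero .
  moreover have "\<exists>x. \<phi> x \<noteq> 0"
  proof -
    obtain x where x: "kelvin_A e h x = exp (t0 + L / 2)" "ln (kelvin_B e h x) / 2 = ln (exp (t0 + L / 2))" "x \<noteq> 0"
      using kelvin_axis_point[OF e h exp_gt_zero] by blast
    have "0 < (kelvin_A e h x)\<^sup>2" unfolding x by simp
    then have Bp: "0 < kelvin_B e h x" using kelvin_A_square_le[OF e, of h x] by linarith
    have "g (t0 + L / 2) \<noteq> 0" using L1 bump_estimates(1)[of "1 / 2"] by (simp add: g_def)
    then have "\<phi> x \<noteq> 0" using kelvin_C_pos[OF x(3)] soft_pos_pos[OF d3, of "kelvin_A e h x"] Bp x(1) unfolding \<phi>_def kelvin_test_def x(2) by simp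
    then show ?thesis by blast
  qed
  ultimately show ?thesis using tf(1) unfolding c_def N_def by blast
qed

section \<open>Test functions of small capacity\<close>

lemma bexp_estimates:
  assumes "0 < v"
  shows "bexp v = exp (- (1 / v))" "bexp1 v = bexp v * (1 / v)\<^sup>2" "bexp2 v = bexp v * ((1 / v) ^ 4 - 2 * (1 / v) ^ 3)"
  using assms by (simp_all add: bexp_def bexp1_def bexp2_def power_divide)

lemma power_exp_scaled:
  fixes y q :: real
  assumes "0 \<le> y" "0 < q" shows "y ^ n * exp (- (y * q)) \<le> fact n / q ^ n"
proof -
  have "(y * q) ^ n * exp (- (y * q)) \<le> fact n" by (rule power_exp_le_fact) (use assms in simp)
  then show ?thesis using assms by (simp add: power_mult_distrib pos_le_divide_eq mult_ac)
qed

lemma exp_neg_powr: "exp (- y) powr a = exp (- (y * a))" for y a :: real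
  by (simp add: powr_def)

text \<open>With y = 1/(kappa v) the combination Q'' + 2 kappa Q' equals kappa^2 y^2 (1 + (y - 1)^2)
  Q, at least Q/v^2, and v^2 exp(-v) is bounded.\<close>

lemma radial_profile_pos:
  fixes \<kappa> p :: real
  assumes k: "0 < \<kappa>" and p: "1 < p"
  shows "\<exists>C. 0 \<le> C \<and> (\<forall>v>0. 0 < bexp (\<kappa> * v) \<and> 0 \<le> \<kappa> * bexp1 (\<kappa> * v) \<and>
     exp (- v) / 24 * bexp (\<kappa> * v) \<le> \<kappa>\<^sup>2 * bexp2 (\<kappa> * v) + 2 * \<kappa> * (\<kappa> * bexp1 (\<kappa> * v)) \<and>
     (\<forall>L\<ge>1. v < L \<longrightarrow> \<kappa> * bexp1 (\<kappa> * v) + \<kappa> * bexp (\<kappa> * v) + bexp (\<kappa> * v) / L \<le> C * bexp (\<kappa> * v) powr (1 / p)))"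
proof -
  define q where "q = 1 - 1 / p"
  have q: "0 < q" using p by (simp add: q_def)
  define C where "C = \<kappa> * (2 / q\<^sup>2) + \<kappa> + 1"
  have "0 \<le> C" using k q by (simp add: C_def)
  moreover have "0 < bexp (\<kappa> * v) \<and> 0 \<le> \<kappa> * bexp1 (\<kappa> * v) \<and>
     exp (- v) / 24 * bexp (\<kappa> * v) \<le> \<kappa>\<^sup>2 * bexp2 (\<kappa> * v) + 2 * \<kappa> * (\<kappa> * bexp1 (\<kappa> * v)) \<and>
     (\<forall>L\<ge>1. v < L \<longrightarrow> \<kappa> * bexp1 (\<kappa> * v) + \<kappa> * bexp (\<kappa> * v) + bexp (\<kappa> * v) / L \<le> C * bexp (\<kappa> * v) powr (1 / p))"
    if v: "0 < v" for v
  proof -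
    have kv: "0 < \<kappa> * v" using k v by simp
    define y where "y = 1 / (\<kappa> * v)"
    have y: "0 < y" using kv by (simp add: y_def)
    define E where "E = bexp (\<kappa> * v)"
    note be = bexp_estimates[OF kv, folded y_def E_def]
    have E: "0 < E" by (simp add: be(1))
    have 1: "exp (- v) / 24 * E \<le> \<kappa>\<^sup>2 * (E * (y ^ 4 - 2 * y ^ 3)) + 2 * \<kappa> * (\<kappa> * (E * y\<^sup>2))"
    proof -
      have "v\<^sup>2 * exp (- v) \<le> 24" using power_exp_le_fact[of v 2] v by (simp add: fact_numeral)
      then have "exp (- v) / 24 \<le> 1 / v\<^sup>2" using v by (simp add: field_simps)
      also have "\<dots> = \<kappa>\<^sup>2 * y\<^sup>2" using k v by (simp add: y_def power_divide power_mult_distrib)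
      also have "\<dots> \<le> \<kappa>\<^sup>2 * y\<^sup>2 * (1 + (y - 1)\<^sup>2)"
        using mult_left_mono[of 1 "1 + (y - 1)\<^sup>2" "\<kappa>\<^sup>2 * y\<^sup>2"] by simp
      finally have "exp (- v) / 24 * E \<le> \<kappa>\<^sup>2 * y\<^sup>2 * (1 + (y - 1)\<^sup>2) * E" using E by (intro mult_right_mono) auto
      also have "\<dots> = \<kappa>\<^sup>2 * (E * (y ^ 4 - 2 * y ^ 3)) + 2 * \<kappa> * (\<kappa> * (E * y\<^sup>2))"
        by (simp add: algebra_simps power2_eq_square power3_eq_cube power4_eq_xxxx)
      finally show ?thesis .
    qed
    have 2: "\<kappa> * (E * y\<^sup>2) + \<kappa> * E + E / L \<le> C * E powr (1 / p)" if L: "1 \<le> L" for L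
    proof -
      \<comment> \<open>Splitting off \<open>E powr (1 / p)\<close> leaves exp(-q y), which beats
        the powers of y in the derivative.\<close>
      have Eq: "E = E powr (1 / p) * exp (- (y * q))"
        unfolding be(1) exp_neg_powr mult_exp_exp by (simp add: q_def algebra_simps)
      have "y\<^sup>2 * exp (- (y * q)) \<le> 2 / q\<^sup>2" using power_exp_scaled[of y q 2] y q by (simp add: fact_numeral)
      then have "\<kappa> * (y\<^sup>2 * exp (- (y * q))) \<le> \<kappa> * (2 / q\<^sup>2)" using k by (intro mult_left_mono) auto
      moreover have e1: "exp (- (y * q)) \<le> 1" using y q by simp
      then have "\<kappa> * exp (- (y * q)) \<le> \<kappa>" using k by simp
      moreover have "exp (- (y * q)) / L \<le> 1" using order_trans[OF e1 L] L by (simp add: divide_le_eq)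
      ultimately have "\<kappa> * (y\<^sup>2 * exp (- (y * q))) + \<kappa> * exp (- (y * q)) + exp (- (y * q)) / L \<le> C"
        by (simp add: C_def)
      then have "(\<kappa> * (y\<^sup>2 * exp (- (y * q))) + \<kappa> * exp (- (y * q)) + exp (- (y * q)) / L) * E powr (1 / p) \<le> C * E powr (1 / p)"
        by (rule mult_right_mono) simp
      moreover have "(\<kappa> * (y\<^sup>2 * exp (- (y * q))) + \<kappa> * exp (- (y * q)) + exp (- (y * q)) / L) * E powr (1 / p) = \<kappa> * (E * y\<^sup>2) + \<kappa> * E + E / L"
      proof -
        have "(\<kappa> * (y\<^sup>2 * X) + \<kappa> * X + X / L) * P = \<kappa> * ((P * X) * y\<^sup>2) + \<kappa> * (P * X) + (P * X) / L" for X P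
          by (simp add: algebra_simps add_divide_distrib)
        from this[of "exp (- (y * q))" "E powr (1 / p)"] show ?thesis unfolding Eq[symmetric] .
      qed
      ultimately show ?thesis by simp
    qed
    show ?thesis
      using 1 2 E k unfolding be(2,3) E_def[symmetric] by simp
  qed
  ultimately show ?thesis by blast
qed

text \<open>For kappa = 0 the profile has to be convex, so it grows linearly and Q/L is controlled
  only for v < L. Here Q'' = Q/v^4, and 24 = 4! bounds v^4 exp(-v); the case of positive kappa
  shares this constant.\<close>

lemma radial_profile_zero:
  fixes p :: real
  assumes p: "1 < p"
  shows "\<exists>C. 0 \<le> C \<and> (\<forall>v>0. 0 < soft_pos 1 v \<and> 0 \<le> soft_pos1 1 v \<and>
     exp (- v) / 24 * soft_pos 1 v \<le> soft_pos2 1 v + 2 * 0 * soft_pos1 1 v \<and>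
     (\<forall>L\<ge>1. v < L \<longrightarrow> soft_pos1 1 v + 0 * soft_pos 1 v + soft_pos 1 v / L \<le> C * soft_pos 1 v powr (1 / p)))"
proof -
  define q where "q = 1 - 1 / p"
  have q: "0 < q" using p by (simp add: q_def)
  define C where "C = 2 + 3 * (1 / q) + 2 / q\<^sup>2"
  have "0 \<le> C" using q by (simp add: C_def)
  moreover have "0 < soft_pos 1 v \<and> 0 \<le> soft_pos1 1 v \<and>
     exp (- v) / 24 * soft_pos 1 v \<le> soft_pos2 1 v + 2 * 0 * soft_pos1 1 v \<and>
     (\<forall>L\<ge>1. v < L \<longrightarrow> soft_pos1 1 v + 0 * soft_pos 1 v + soft_pos 1 v / L \<le> C * soft_pos 1 v powr (1 / p))"
    if v: "0 < v" for v
  proof -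
    define y where "y = 1 / v"
    have y: "0 < y" "v = 1 / y" using v by (simp_all add: y_def)
    define E where "E = bexp v"
    note be = bexp_estimates[OF v, folded y_def E_def]
    have E: "0 < E" by (simp add: be(1))
    have f0: "soft_pos 1 v = v * E" by (simp add: soft_pos_def E_def)
    have f1: "soft_pos1 1 v = E * (1 + y)" using v by (simp add: soft_pos1_def be E_def[symmetric] y_def field_simps power2_eq_square)
    have f2: "soft_pos2 1 v = E * y ^ 3"
      using v by (simp add: soft_pos2_def be E_def[symmetric] y_def field_simps power2_eq_square power3_eq_cube power4_eq_xxxx)
    have 1: "exp (- v) / 24 * (v * E) \<le> E * y ^ 3"
    proof -
      have "v ^ 4 * exp (- v) \<le> 24" using power_exp_le_fact[of v 4] v by (simp add: fact_numeral)
      then have "v * exp (- v) / 24 \<le> y ^ 3" using v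
        by (simp add: y_def field_simps power3_eq_cube power4_eq_xxxx)
      then have "v * exp (- v) / 24 * E \<le> y ^ 3 * E" using E by (intro mult_right_mono) auto
      then show ?thesis by (simp add: mult_ac)
    qed
    have 2: "E * (1 + y) + v * E / L \<le> C * (v * E) powr (1 / p)" if L: "1 \<le> L" "v < L" for L
    proof -
      have Eq: "E = E powr (1 / p) * exp (- (y * q))"
        unfolding be(1) exp_neg_powr mult_exp_exp by (simp add: q_def algebra_simps)
      \<comment> \<open>v^(1/p) degenerates at 0, where the factor y = 1/v compensates.\<close>
      have vp: "1 \<le> (1 + y) * v powr (1 / p)"
      proof (cases "1 \<le> v")
        case True
        then have "1 \<le> v powr (1 / p)" using p by (simp add: ge_one_powr_ge_zero)
        then show ?thesis using y mult_mono[of 1 "1 + y" 1 "v powr (1 / p)"] by simp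
      next
        case False
        have "v powr 1 \<le> v powr (1 / p)" using False v p by (intro powr_mono') auto
        then have "y * v \<le> y * v powr (1 / p)" using v y by (intro mult_left_mono) auto
        then show ?thesis using y by (simp add: algebra_simps) (smt (verit) powr_ge_zero)
      qed
      have "v * E / L \<le> E" using L v E by (simp add: divide_le_eq mult_mono)
      then have "E * (1 + y) + v * E / L \<le> E * (2 + y)" by (simp add: algebra_simps)
      also have "\<dots> \<le> E * (2 + y) * ((1 + y) * v powr (1 / p))"
        using mult_left_mono[OF vp, of "E * (2 + y)"] E y by simp
      also have "\<dots> = ((2 + y) * (1 + y) * exp (- (y * q))) * (v powr (1 / p) * E powr (1 / p))"
        by (subst Eq) (simp add: mult_ac)
      also have "\<dots> \<le> C * (v powr (1 / p) * E powr (1 / p))"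
      proof (rule mult_right_mono)
        have "y * exp (- (y * q)) \<le> 1 / q" using power_exp_scaled[of y q 1] y q by simp
        moreover have "y\<^sup>2 * exp (- (y * q)) \<le> 2 / q\<^sup>2" using power_exp_scaled[of y q 2] y q by (simp add: fact_numeral)
        moreover have "exp (- (y * q)) \<le> 1" using y q by simp
        moreover have "(2 + y) * (1 + y) * exp (- (y * q)) = 2 * exp (- (y * q)) + 3 * (y * exp (- (y * q))) + y\<^sup>2 * exp (- (y * q))"
          by (simp add: algebra_simps power2_eq_square)
        ultimately show "(2 + y) * (1 + y) * exp (- (y * q)) \<le> C" unfolding C_def by linarith
      qed simp
      also have "v powr (1 / p) * E powr (1 / p) = (v * E) powr (1 / p)"
        using v E by (simp add: powr_mult)
      finally show ?thesis .
    qed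
    show ?thesis using 1 2 E v y(1) unfolding f0 f1 f2 by simp
  qed
  ultimately show ?thesis by blast
qed

text \<open>Substituting g = exp(kappa t) Q turns g'' - kappa^2 g into exp(kappa t) (Q'' + 2 kappa
  Q'). The slack exp(-v) Q/24 pays for the potential error, and the bound by Q^(1/p) prepares
  Young's inequality for the cutoff terms.\<close>

lemma radial_profile:
  fixes \<kappa> p :: real
  assumes k: "0 \<le> \<kappa>" and p: "1 < p"
  shows "\<exists>Q Q1 Q2 C. (\<forall>v. (Q has_real_derivative Q1 v) (at v) \<and> (Q1 has_real_derivative Q2 v) (at v)) \<and>
    (\<forall>v\<le>0. Q v = 0 \<and> Q1 v = 0 \<and> Q2 v = 0) \<and>
    (\<forall>U f. open U \<longrightarrow> smooth_on U f \<longrightarrow> smooth_on U (\<lambda>x::'a::euclidean_space. Q (f x))) \<and>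
    0 \<le> C \<and> (\<forall>v>0. 0 < Q v \<and> 0 \<le> Q1 v \<and> exp (- v) / 24 * Q v \<le> Q2 v + 2 * \<kappa> * Q1 v \<and>
      (\<forall>L\<ge>1. v < L \<longrightarrow> Q1 v + \<kappa> * Q v + Q v / L \<le> C * Q v powr (1 / p)))"
proof (cases "\<kappa> = 0")
  case True
  obtain C where C: "0 \<le> C" "\<forall>v>0. 0 < soft_pos 1 v \<and> 0 \<le> soft_pos1 1 v \<and>
     exp (- v) / 24 * soft_pos 1 v \<le> soft_pos2 1 v + 2 * 0 * soft_pos1 1 v \<and>
     (\<forall>L\<ge>1. v < L \<longrightarrow> soft_pos1 1 v + 0 * soft_pos 1 v + soft_pos 1 v / L \<le> C * soft_pos 1 v powr (1 / p))"
    using radial_profile_zero[OF p] by blast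
  have "smooth_on U (\<lambda>x::'a. soft_pos 1 (f x))" if "open U" "smooth_on U f" for U f
    unfolding soft_pos_def using smooth_on_mult[OF that(1,2) smooth_on_bexp[OF that]] by simp
  then show ?thesis
    unfolding True using C soft_pos_DERIV soft_pos1_DERIV soft_pos_zero[of 1]
    by (intro exI[of _ "soft_pos 1"] exI[of _ "soft_pos1 1"] exI[of _ "soft_pos2 1"] exI[of _ C] conjI) auto
next
  case False
  then have k: "0 < \<kappa>" using k by simp
  obtain C where C: "0 \<le> C" "\<forall>v>0. 0 < bexp (\<kappa> * v) \<and> 0 \<le> \<kappa> * bexp1 (\<kappa> * v) \<and>
     exp (- v) / 24 * bexp (\<kappa> * v) \<le> \<kappa>\<^sup>2 * bexp2 (\<kappa> * v) + 2 * \<kappa> * (\<kappa> * bexp1 (\<kappa> * v)) \<and>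
     (\<forall>L\<ge>1. v < L \<longrightarrow> \<kappa> * bexp1 (\<kappa> * v) + \<kappa> * bexp (\<kappa> * v) + bexp (\<kappa> * v) / L \<le> C * bexp (\<kappa> * v) powr (1 / p))"
    using radial_profile_pos[OF k p] by blast
  have l: "((\<lambda>v. \<kappa> * v) has_real_derivative \<kappa>) (at v)" for v
    using DERIV_cmult[OF DERIV_ident, of \<kappa>] by simp
  have d: "((\<lambda>v. bexp (\<kappa> * v)) has_real_derivative \<kappa> * bexp1 (\<kappa> * v)) (at v)"
    "((\<lambda>v. \<kappa> * bexp1 (\<kappa> * v)) has_real_derivative \<kappa>\<^sup>2 * bexp2 (\<kappa> * v)) (at v)" for v
    by (rule DERIV_cong[OF DERIV_chain2[OF bexp_DERIV l]], simp,
        rule DERIV_cong[OF DERIV_cmult[OF DERIV_chain2[OF bexp1_DERIV l]]], simp add: power2_eq_square)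
  have s: "smooth_on U (\<lambda>x::'a. bexp (\<kappa> * f x))" if "open U" "smooth_on U f" for U f
    by (intro smooth_on_bexp smooth_on_mult smooth_on_const that)
  have z: "\<kappa> * v \<le> 0" if "v \<le> 0" for v using k that by (simp add: mult_nonneg_nonpos)
  show ?thesis
    using C d s z
    by (intro exI[of _ "\<lambda>v. bexp (\<kappa> * v)"] exI[of _ "\<lambda>v. \<kappa> * bexp1 (\<kappa> * v)"] exI[of _ "\<lambda>v. \<kappa>\<^sup>2 * bexp2 (\<kappa> * v)"] exI[of _ C] conjI)
      (auto simp: bexp_def bexp1_def bexp2_def)
qed

text \<open>With zeta = bexp(1 - v/L) and w = 1/(1 - v/L) one has zeta' = - zeta w^2/L and zeta'' =
  zeta (w^4 - 2 w^3)/L^2. The error m3 is paid by the profile, m4 is at most w^4/L^2, and every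
  remaining loss carries 1/L. As w >= 1, all powers are raised to w^4; the factor 3 is 2 from the
  negative part of zeta'' plus 1 from m4.\<close>

lemma cutoff_algebra:
  fixes L w :: real
  assumes L: "1 \<le> L" and w: "1 \<le> w" and z: "0 \<le> \<zeta>" and Q: "0 \<le> Q" "0 \<le> Q1" "0 \<le> \<kappa>"
    and s: "m3 * Q \<le> Q2 + 2 * \<kappa> * Q1" and m: "m4 \<le> w ^ 4 / L\<^sup>2"
  shows "- (3 / L * w ^ 4 * \<zeta> * (Q1 + \<kappa> * Q + Q / L)) \<le>
    (\<kappa>\<^sup>2 * (Q * \<zeta>) + 2 * \<kappa> * (Q1 * \<zeta> - Q * (\<zeta> * w\<^sup>2) / L) + (Q2 * \<zeta> - 2 * (Q1 * (\<zeta> * w\<^sup>2)) / L + Q * (\<zeta> * (w ^ 4 - 2 * w ^ 3)) / L\<^sup>2))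
     - \<kappa>\<^sup>2 * (Q * \<zeta>) - m3 * (Q * \<zeta>) - m4 * (Q * \<zeta>)"
proof -
  have w2: "2 * w\<^sup>2 \<le> 3 * w ^ 4" proof -
    have "w\<^sup>2 \<le> w ^ 4" using power_increasing[of 2 4 w] w by simp
    moreover have "0 \<le> w ^ 4" by simp
    ultimately show ?thesis by linarith
  qed
  have w3: "- 2 * w ^ 4 \<le> w ^ 4 - 2 * w ^ 3"   proof -
    have "w ^ 3 \<le> w ^ 4" using power_increasing[of 3 4 w] w by simp
    moreover have "0 \<le> w ^ 4" by simp
    ultimately show ?thesis by linarith
  qed
  have a: "2 * w\<^sup>2 * ((\<kappa> * Q + Q1) / L) \<le> 3 * w ^ 4 * ((\<kappa> * Q + Q1) / L)"
    using L Q by (intro mult_right_mono[OF w2]) auto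
  have b: "- 2 * w ^ 4 * (Q / L\<^sup>2) \<le> (w ^ 4 - 2 * w ^ 3) * (Q / L\<^sup>2)"
    using L Q by (intro mult_right_mono[OF w3]) auto
  have c: "m4 * Q \<le> w ^ 4 / L\<^sup>2 * Q" by (rule mult_right_mono[OF m Q(1)])
  have "- (3 * w ^ 4 * ((\<kappa> * Q + Q1) / L)) - 3 * w ^ 4 * (Q / L\<^sup>2)
     \<le> (Q2 + 2 * \<kappa> * Q1 - m3 * Q) - 2 * w\<^sup>2 * ((\<kappa> * Q + Q1) / L) + (w ^ 4 - 2 * w ^ 3) * (Q / L\<^sup>2) - m4 * Q"
    using a b c s by simp
  from mult_left_mono[OF this z] show ?thesis
    using L by (simp add: power2_eq_square algebra_simps add_divide_distrib diff_divide_distrib)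
qed

lemma cutoff_DERIV:
  fixes \<kappa> t0 L :: real
  assumes Q: "\<And>v. (Q has_real_derivative Q1 v) (at v)" "\<And>v. (Q1 has_real_derivative Q2 v) (at v)"
  defines "z \<equiv> \<lambda>t. bexp (1 - (t - t0) / L)" and "z1 \<equiv> \<lambda>t. bexp1 (1 - (t - t0) / L)" and "z2 \<equiv> \<lambda>t. bexp2 (1 - (t - t0) / L)"
  shows "((\<lambda>t. exp (\<kappa> * t) * (Q (t - t0) * z t)) has_real_derivative
      exp (\<kappa> * t) * (\<kappa> * (Q (t - t0) * z t) + (Q1 (t - t0) * z t - Q (t - t0) * z1 t / L))) (at t)" (is ?D1)
    and "((\<lambda>t. exp (\<kappa> * t) * (\<kappa> * (Q (t - t0) * z t) + (Q1 (t - t0) * z t - Q (t - t0) * z1 t / L))) has_real_derivative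
      exp (\<kappa> * t) * (\<kappa>\<^sup>2 * (Q (t - t0) * z t) + 2 * \<kappa> * (Q1 (t - t0) * z t - Q (t - t0) * z1 t / L)
        + (Q2 (t - t0) * z t - 2 * (Q1 (t - t0) * z1 t) / L + Q (t - t0) * z2 t / L\<^sup>2))) (at t)" (is ?D2)
proof -
  have e: "((\<lambda>t. exp (\<kappa> * t)) has_real_derivative \<kappa> * exp (\<kappa> * t)) (at t)"
    by (auto intro!: derivative_eq_intros)
  have l: "((\<lambda>t. 1 - (t - t0) / L) has_real_derivative - (1 / L)) (at t)"
    by (rule DERIV_cong[OF DERIV_diff[OF DERIV_const DERIV_cdivide[OF DERIV_diff[OF DERIV_ident DERIV_const]]]]) simp
  have s: "((\<lambda>t. t - t0) has_real_derivative 1) (at t)"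
    by (rule DERIV_cong[OF DERIV_diff[OF DERIV_ident DERIV_const]]) simp
  have z: "(z has_real_derivative - (z1 t / L)) (at t)" "(z1 has_real_derivative - (z2 t / L)) (at t)"
    unfolding z_def z1_def z2_def
    by (rule DERIV_cong[OF DERIV_chain2[OF bexp_DERIV l]], simp,
        rule DERIV_cong[OF DERIV_chain2[OF bexp1_DERIV l]], simp)
  note q = DERIV_chain2[OF Q(1) s] DERIV_chain2[OF Q(2) s]
  show ?D1
    by (rule DERIV_cong[OF DERIV_mult[OF e DERIV_mult[OF q(1) z(1)]]]) (simp add: algebra_simps)
  show ?D2
    by (rule DERIV_cong[OF DERIV_mult[OF e DERIV_add[OF DERIV_cmult[OF DERIV_mult[OF q(1) z(1)]]
          DERIV_diff[OF DERIV_mult[OF q(2) z(1)] DERIV_cdivide[OF DERIV_mult[OF q(1) z(2)]]]]]])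
      (simp add: algebra_simps power2_eq_square add_divide_distrib diff_divide_distrib)
qed

text \<open>The weight \<open>norm x powr (- (N * (1 - 1 / p)))\<close> is borderline: its conjugate power is the
  scale-invariant \<open>norm x powr (- N)\<close>, whose integral over an annulus grows only like the
  logarithm \<open>L\<close> of the ratio of the radii and so loses against the factor \<open>1 / L\<close>.\<close>

lemma weight_bound:
  fixes Y b :: real
  assumes "1 \<le> b" "b \<le> Y" "Y \<le> 4 * b" "0 < q" "0 \<le> \<kappa>" "\<kappa> < N / 2 - 1" "2 \<le> q * (N / 2 + 1 - \<kappa>)"
  shows "(Y powr (N / 2 - 1) * (sqrt b * (b powr (- (N / 4)) * exp (\<kappa> * (ln b / 2))))) powr q * (Y\<^sup>2 / b)
    \<le> (1 / 4) powr (q * (1 / 2 - N / 4 + \<kappa> / 2) - 1) * Y powr (N * q / 2)"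
proof -
  define m where "m = q * (1 / 2 - N / 4 + \<kappa> / 2)"
  have b: "0 < b" and Y: "0 < Y" "1 \<le> Y" using assms by auto
  have "q * (1 / 2 - N / 4 + \<kappa> / 2) \<le> 0" using assms by (intro mult_nonneg_nonpos) auto
  \<comment> \<open>A nonpositive exponent lets \<open>b\<close> be replaced by its lower bound
    Y/4.\<close>
  then have m: "m - 1 \<le> 0" by (simp add: m_def)
  have 1: "sqrt b * (b powr (- (N / 4)) * exp (\<kappa> * (ln b / 2))) = b powr (1 / 2 - N / 4 + \<kappa> / 2)"
    using b by (simp add: powr_half_sqrt[symmetric] powr_def mult_exp_exp algebra_simps)
  have 2: "Y\<^sup>2 / b = Y powr 2 * b powr - 1" using b Y by (simp add: powr_numeral powr_minus divide_inverse)
  have "(Y powr (N / 2 - 1) * b powr (1 / 2 - N / 4 + \<kappa> / 2)) powr q * (Y powr 2 * b powr - 1)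
     = Y powr ((N / 2 - 1) * q + 2) * b powr (m - 1)"
  proof -
    have "(Y powr (N / 2 - 1) * b powr (1 / 2 - N / 4 + \<kappa> / 2)) powr q = Y powr ((N / 2 - 1) * q) * b powr m"
      by (simp add: powr_mult powr_powr m_def mult.commute)
    moreover have "b powr (m - 1) = b powr m * b powr - 1"
      unfolding powr_add[symmetric] by simp
    ultimately show ?thesis by (simp only: powr_add mult_ac)
  qed
  also have "b powr (m - 1) \<le> (Y * (1 / 4)) powr (m - 1)"
    using m assms Y by (intro powr_mono2') auto
  also have "(Y * (1 / 4)) powr (m - 1) = Y powr (m - 1) * (1 / 4) powr (m - 1)"
    using Y by (intro powr_mult)
  also have "Y powr ((N / 2 - 1) * q + 2) * (Y powr (m - 1) * (1 / 4) powr (m - 1))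
      = (1 / 4) powr (m - 1) * Y powr ((N / 2 - 1) * q + 2 + (m - 1))"
    by (simp only: powr_add mult_ac)
  \<comment> \<open>The last hypothesis says exactly that the exponent of \<open>Y\<close> is at
    most N q/2, and Y >= 1 then allows raising it.\<close>
  also have "\<dots> \<le> (1 / 4) powr (m - 1) * Y powr (N * q / 2)"
  proof (intro mult_left_mono powr_mono)
    have "2 \<le> q * N / 2 + q - q * \<kappa>" using assms by (simp add: algebra_simps)
    moreover have "(N / 2 - 1) * q + 2 + (m - 1) = q * N / 4 - q / 2 + q * \<kappa> / 2 + 1" unfolding m_def by (simp add: field_simps)
    ultimately show "(N / 2 - 1) * q + 2 + (m - 1) \<le> N * q / 2" by (simp add: mult.commute)
  qed (use Y in auto)
  finally show ?thesis unfolding 1 2 m_def by (simp add: mult_left_mono)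
qed

lemma bexp_mono: "v \<le> w \<Longrightarrow> bexp v \<le> bexp w"
  by (auto simp: bexp_def frac_le)

text \<open>The ball and the constants are fixed before \<open>L\<close>: the test functions stay
  above \<open>\<eta>\<close> on a fixed ball while the coefficient of their defect decays like 1/L.
  The factor \<open>\<phi> x powr (1 / p)\<close> is shaped for Young's inequality.\<close>

lemma capacity_test_functions:
  fixes e :: "'a::euclidean_space"
  assumes e: "norm e = 1" and h: "0 < h" and R: "0 < R" "R \<le> 1 / h" and D: "open D"
    and De: "{x. 0 < norm x \<and> norm x < R \<and> h * (norm x)\<^sup>2 \<le> x \<bullet> e} \<subseteq> D"
    and c: "real DIM('a) - 1 < c" "c \<le> (real DIM('a))\<^sup>2 / 4"
    and p: "1 < p" "p_half_sphere (real DIM('a)) c \<le> p" and N3: "3 \<le> DIM('a)"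
  shows "\<exists>y \<rho> \<eta> K T. 0 < \<rho> \<and> 0 < \<eta> \<and> 0 \<le> K \<and> ball y \<rho> \<subseteq> D \<and> (\<forall>L\<ge>4. \<exists>\<phi>. test_fun D \<phi> \<and>
     (\<forall>x. 0 \<le> \<phi> x) \<and> (\<forall>x\<in>ball y \<rho>. \<eta> \<le> \<phi> x) \<and>
     (\<forall>x. \<phi> x \<noteq> 0 \<longrightarrow> exp (- (T + L)) \<le> norm x \<and> norm x \<le> 1) \<and>
     (\<forall>x. - laplacian \<phi> x - c / (norm x)\<^sup>2 * \<phi> x \<le>
        \<phi> x powr (1 / p) * (K / L * norm x powr (- (real DIM('a) * (1 - 1 / p))))))"
proof -
  define N where "N = real DIM('a)"
  have N: "3 \<le> N" using N3 by (simp add: N_def)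
  define \<kappa> where "\<kappa> = sqrt (N\<^sup>2 / 4 - c)"
  have k0: "0 \<le> \<kappa>" and k2: "\<kappa>\<^sup>2 = N\<^sup>2 / 4 - c" using c by (simp_all add: \<kappa>_def N_def)
  have "N\<^sup>2 / 4 - c < (N / 2 - 1)\<^sup>2" using c by (simp add: N_def power2_eq_square algebra_simps)
  then have k1: "\<kappa> < N / 2 - 1" unfolding k2[symmetric] by (rule power2_less_imp_less) (use N in simp)
  have c0: "0 < c" using c N by (simp add: N_def)
  define q where "q = 1 - 1 / p"
  have q: "0 < q" using p by (simp add: q_def)
  \<comment> \<open>The critical exponent enters here: with alpha = N/2 - 1 - kappa, the condition p
    >= 1 + 2/alpha reads (p - 1) alpha >= 2, equivalently q (alpha + 2) >= 2.\<close>
  have qa: "2 \<le> q * (N / 2 + 1 - \<kappa>)"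
  proof -
    define \<alpha> where "\<alpha> = N / 2 - 1 - \<kappa>"
    have a: "0 < \<alpha>" using k1 by (simp add: \<alpha>_def)
    have "1 + 2 / \<alpha> \<le> p"
      using p(2) unfolding p_half_sphere_def alpha_exp_def N_def[symmetric] \<kappa>_def[symmetric]
      by (simp add: \<alpha>_def diff_divide_distrib)
    then have "2 \<le> (p - 1) * \<alpha>" using a by (simp add: field_simps)
    then have "2 * p \<le> (p - 1) * (\<alpha> + 2)" by (simp add: algebra_simps)
    then have "2 \<le> (p - 1) * (\<alpha> + 2) / p" using p by (simp add: pos_le_divide_eq)
    also have "\<dots> = q * (N / 2 + 1 - \<kappa>)" using p by (simp add: q_def \<alpha>_def field_simps)
    finally show ?thesis .
  qed
  obtain Q Q1 Q2 C where Q: "\<forall>v. (Q has_real_derivative Q1 v) (at v) \<and> (Q1 has_real_derivative Q2 v) (at v)"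
    "\<forall>v\<le>0. Q v = 0 \<and> Q1 v = 0 \<and> Q2 v = 0"
    "\<forall>U f. open U \<longrightarrow> smooth_on U f \<longrightarrow> smooth_on U (\<lambda>x::'a. Q (f x))"
    and C0: "0 \<le> C"
    and Q': "\<forall>v>0. 0 < Q v \<and> 0 \<le> Q1 v \<and> exp (- v) / 24 * Q v \<le> Q2 v + 2 * \<kappa> * Q1 v \<and>
      (\<forall>L\<ge>1. v < L \<longrightarrow> Q1 v + \<kappa> * Q v + Q v / L \<le> C * Q v powr (1 / p))"
    using radial_profile[OF k0 p(1), where 'a = 'a] by (elim exE conjE) (rule that)
  have Qd: "\<And>v. (Q has_real_derivative Q1 v) (at v)" "\<And>v. (Q1 has_real_derivative Q2 v) (at v)"
    using Q(1) by auto
  note Qz = Q(2)[rule_format] and Qs = Q(3)[rule_format] and Qp = Q'[rule_format]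
  \<comment> \<open>As before, h and 2/R secure h <= |z| and the outer radius; 72 = 3 * 24 brings
    the potential error below the slack exp(-v)/24 of the profile.\<close>
  define X where "X = 1 + h + 2 / R + 72 * h * c"
  have X: "1 \<le> X" "h \<le> X" "2 / R \<le> X" "72 * h * c \<le> X"
    using h R c0 by (auto simp: X_def)
  define t0 where "t0 = ln X"
  have et0: "exp t0 = X" using X by (simp add: t0_def)
  have "1 / X < R" using X R by (smt (verit) divide_less_eq mult.commute pos_divide_le_eq)
  then have t0R: "exp (- t0) < R" by (simp add: exp_minus et0 inverse_eq_divide)
  \<comment> \<open>Smoothing scale of order 1/L, so that M^2 d^2 <= w^4/L^2 as
    \<open>cutoff_algebra\<close> expects.\<close>
  define d where "d L = 1 / ((N + 2) * L)" for L :: real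
  define g where "g L t = exp (\<kappa> * t) * (Q (t - t0) * bexp (1 - (t - t0) / L))" for L t
  define g1 where "g1 L t = exp (\<kappa> * t) * (\<kappa> * (Q (t - t0) * bexp (1 - (t - t0) / L)) +
     (Q1 (t - t0) * bexp (1 - (t - t0) / L) - Q (t - t0) * bexp1 (1 - (t - t0) / L) / L))" for L t
  define g2 where "g2 L t = exp (\<kappa> * t) * (\<kappa>\<^sup>2 * (Q (t - t0) * bexp (1 - (t - t0) / L)) + 2 * \<kappa> * (Q1 (t - t0) * bexp (1 - (t - t0) / L) - Q (t - t0) * bexp1 (1 - (t - t0) / L) / L)
        + (Q2 (t - t0) * bexp (1 - (t - t0) / L) - 2 * (Q1 (t - t0) * bexp1 (1 - (t - t0) / L)) / L + Q (t - t0) * bexp2 (1 - (t - t0) / L) / L\<^sup>2))" for L t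
  have g: "(g L has_real_derivative g1 L t) (at t)" "(g1 L has_real_derivative g2 L t) (at t)" for L t
    unfolding g_def[abs_def] g1_def[abs_def] g2_def by (rule cutoff_DERIV[OF Qd])+
  define \<phi> where "\<phi> L = kelvin_test e h (soft_pos (d L ^ 3)) (g L)" for L
  have d: "0 < d L" if "1 \<le> L" for L using that N by (simp add: d_def)
  have gz: "g L t = 0 \<and> g1 L t = 0 \<and> g2 L t = 0" if "1 \<le> L" "\<not> (0 < t - t0 \<and> t - t0 < L)" for L t
  proof (cases "0 < t - t0")
    case False
    then show ?thesis using Qz[of "t - t0"] by (simp add: g_def g1_def g2_def)
  next
    case True
    then have "1 - (t - t0) / L \<le> 0" using that by (simp add: field_simps)
    then show ?thesis by (simp add: g_def g1_def g2_def bexp_def bexp1_def bexp2_def)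
  qed
  have gz': "\<forall>t. t < t0 \<or> t0 + L < t \<longrightarrow> g L t = 0" if "1 \<le> L" for L
    using gz[OF that] by auto
  have sm: "\<forall>U f. open U \<longrightarrow> smooth_on U f \<longrightarrow> smooth_on U (\<lambda>x::'a. g L (f x))" for L
    unfolding g_def divide_inverse
    by (intro allI impI smooth_on_bexp smooth_on_mult smooth_on_diff smooth_on_const smooth_on_exp Qs)
  have d3: "0 < d L ^ 3" if "1 \<le> L" for L using d[OF that] by simp
  have tf: "test_fun D (\<phi> L)"
    "\<phi> L x \<noteq> 0 \<Longrightarrow> 0 < kelvin_A e h x \<and> x \<noteq> 0 \<and> t0 \<le> ln (kelvin_B e h x) / 2 \<and> ln (kelvin_B e h x) / 2 \<le> t0 + L"
    "x \<in> tsupport (\<phi> L) \<Longrightarrow> x \<noteq> 0 \<and> 0 < kelvin_B e h x" if "1 \<le> L" for L x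
    using kelvin_test_fun[OF e h d3[OF that] R(2) De t0R gz'[OF that] sm] unfolding \<phi>_def by blast+
  have nn: "0 \<le> \<phi> L x" if "1 \<le> L" for L x
  proof (cases "x = 0")
    case False
    have "0 \<le> Q v" for v using Qp[of v] Qz[of v] by (cases "0 < v") auto
    then have "0 \<le> g L t" for t by (simp add: g_def bexp_nonneg)
    then show ?thesis using kelvin_C_pos[OF False] soft_pos_nonneg[OF d3[OF that]] by (simp add: \<phi>_def kelvin_test_def)
  next
    case True
    then show ?thesis by (simp add: \<phi>_def kelvin_test_def kelvin_C_def kelvin_Y_def)
  qed
  define K where "K = 3 * C * (24 / q ^ 4) * (1 / 4) powr (q * (1 / 2 - N / 4 + \<kappa> / 2) - 1)"
  have K: "0 \<le> K" using C0 q by (simp add: K_def)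
  have supp: "exp (- (t0 + 1 + L)) \<le> norm x \<and> norm x \<le> 1"
    and main: "- laplacian (\<phi> L) x - c / (norm x)\<^sup>2 * \<phi> L x \<le>
        \<phi> L x powr (1 / p) * (K / L * norm x powr (- (N * q)))"
    if L: "1 \<le> L" and nz: "\<phi> L x \<noteq> 0" for L x
  proof -
    from tf(2)[OF L nz] have A: "0 < kelvin_A e h x" and x: "x \<noteq> 0" by auto
    define t where "t = ln (kelvin_B e h x) / 2"
    define v where "v = t - t0"
    define a b Y where ab: "a = kelvin_A e h x" "b = kelvin_B e h x" "Y = kelvin_Y x"
    have "g L t \<noteq> 0" using nz by (auto simp: \<phi>_def kelvin_test_def t_def)
    then have v: "0 < v" "v < L" using gz[OF L, of t] by (auto simp: v_def)
    define w where "w = 1 / (1 - v / L)"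
    have vL: "0 < 1 - v / L" "1 - v / L \<le> 1" using v L by (auto simp: field_simps)
    then have w: "1 \<le> w" by (simp add: w_def)
    define z where "z = bexp (1 - v / L)"
    note be = bexp_estimates[OF vL(1), folded w_def z_def]
    have z: "0 < z" by (simp add: be(1))
    have As: "a\<^sup>2 \<le> b" using kelvin_A_square_le[OF e, of h x] by (simp add: ab)
    have "0 < a\<^sup>2" using A by (simp add: ab)
    then have b0: "0 < b" using As by linarith
    have bt: "b = exp (2 * t)" using b0 by (simp add: t_def ab)
    have eX: "exp (- t) \<le> exp (- v) / X"
    proof -
      have "exp (- t) = exp (- v) * exp (- t0)" by (simp add: v_def mult_exp_exp)
      then show ?thesis by (simp add: exp_minus[of t0] et0 divide_inverse)
    qed
    have "X\<^sup>2 \<le> b"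
    proof -
      have "X\<^sup>2 = exp (2 * t0)" by (simp add: et0[symmetric] exp_double)
      also have "\<dots> \<le> exp (2 * t)" using v by (simp add: v_def)
      finally show ?thesis by (simp add: bt)
    qed
    moreover have "h\<^sup>2 \<le> X\<^sup>2" "1 \<le> X\<^sup>2" using X h by (auto intro: power_mono one_le_power)
    ultimately have B: "h\<^sup>2 \<le> b" "1 \<le> b" by auto
    define s where "s = sqrt b"
    have s: "0 < s" "s * s = b" using b0 by (simp_all add: s_def)
    have hs: "h \<le> s" unfolding s_def using B by (simp add: real_le_rsqrt)
    have as: "a \<le> s" unfolding s_def using As by (simp add: real_le_rsqrt)
    have Yb: "Y = b + 2 * h * a + h\<^sup>2" unfolding ab by (rule kelvin_Y_kelvin_B)
    have a0: "0 < a" using A by (simp add: ab)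
    have "h * a \<le> s * s" "h * h \<le> s * s" using hs as h a0 s by (auto intro: mult_mono)
    then have Y4: "Y \<le> 4 * b" unfolding Yb s(2) by (simp add: power2_eq_square)
    have Y1: "b \<le> Y" unfolding Yb using h a0 by simp
    have Y0: "0 < Y" using Y1 b0 by linarith
    have xn: "0 < norm x" using x by simp
    have Yn: "Y = 1 / (norm x)\<^sup>2" by (simp add: ab kelvin_Y_norm)
    show "exp (- (t0 + 1 + L)) \<le> norm x \<and> norm x \<le> 1"
    proof
      have "1 \<le> 1 / (norm x)\<^sup>2" using Y1 B Yn by linarith
      then have "(norm x)\<^sup>2 \<le> 1\<^sup>2" using xn by (simp add: field_simps)
      then show "norm x \<le> 1" by (rule power2_le_imp_le) simp
      have "(1 / norm x)\<^sup>2 \<le> (2 * s)\<^sup>2" using Y4 s(2) by (simp add: Yn power_divide power_mult_distrib power2_eq_square)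
      then have "1 / norm x \<le> 2 * s" by (rule power2_le_imp_le) (use s in simp)
      also have "s = exp t" unfolding s_def bt using exp_double[of t] by (simp add: real_sqrt_abs)
      \<comment> \<open>The 2 from 1/|x| <= 2 |z| is absorbed into exp 1, whence the shift of t0 by
        1 in \<open>T\<close>.\<close>
      also have "2 * exp t \<le> exp 1 * exp t" using exp_ge_add_one_self[of 1] by (intro mult_right_mono) auto
      also have "\<dots> \<le> exp (t0 + 1 + L)" using v by (simp add: mult_exp_exp v_def)
      finally have "1 \<le> exp (t0 + 1 + L) * norm x" using xn by (simp add: pos_divide_le_eq)
      then show "exp (- (t0 + 1 + L)) \<le> norm x"
        unfolding exp_minus[of "t0 + 1 + L"] inverse_eq_divide by (simp add: pos_divide_le_eq mult.commute)
    qed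
    define E where "E = exp (\<kappa> * t)"
    have E: "0 < E" by (simp add: E_def)
    note Qv = Qp[OF v(1)]
    have gt: "g L t = E * (Q v * z)" by (simp add: g_def E_def v_def z_def)
    have g1t: "g1 L t = E * (\<kappa> * (Q v * z) + (Q1 v * z - Q v * (z * w\<^sup>2) / L))"
      unfolding g1_def E_def[symmetric] v_def[symmetric] z_def[symmetric] be(2) ..
    have g2t: "g2 L t = E * (\<kappa>\<^sup>2 * (Q v * z) + 2 * \<kappa> * (Q1 v * z - Q v * (z * w\<^sup>2) / L)
        + (Q2 v * z - 2 * (Q1 v * (z * w\<^sup>2)) / L + Q v * (z * (w ^ 4 - 2 * w ^ 3)) / L\<^sup>2))"
      unfolding g2_def E_def[symmetric] v_def[symmetric] z_def[symmetric] be(2,3) ..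
    have w1: "1 \<le> w\<^sup>2" using w by (simp add: one_le_power)
    define M where "M = N + 2 * w\<^sup>2"
    have M1: "1 \<le> M" using N w1 by (simp add: M_def)
    have Mg: "- M * g L t \<le> 2 * g1 L t - real DIM('a) * g L t"
    proof -
      have "0 \<le> E * (Q v * z * w\<^sup>2)" using E Qv z by simp
      then have "E * (Q v * z * w\<^sup>2) * 1 \<le> E * (Q v * z * w\<^sup>2) * L" using L by (intro mult_left_mono) auto
      then have "E * (Q v * z * w\<^sup>2) / L \<le> E * (Q v * z * w\<^sup>2)" using L by (simp add: pos_divide_le_eq)
      moreover have "0 \<le> E * (\<kappa> * (Q v * z))" "0 \<le> E * (Q1 v * z)" using E Qv z k0 by simp_all
      moreover have "g1 L t = E * (\<kappa> * (Q v * z)) + E * (Q1 v * z) - E * (Q v * z * w\<^sup>2) / L"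
        unfolding g1t by (simp add: algebra_simps)
      ultimately have "- (E * (Q v * z * w\<^sup>2)) \<le> g1 L t" by linarith
      moreover have "- M * g L t = 2 * (- (E * (Q v * z * w\<^sup>2))) - N * g L t" unfolding M_def gt by algebra
      ultimately show ?thesis unfolding N_def by linarith
    qed
    have Md: "M\<^sup>2 * (d L)\<^sup>2 \<le> w ^ 4 / L\<^sup>2"
    proof -
      have "N * 1 \<le> N * w\<^sup>2" using N w1 by (intro mult_left_mono) auto
      then have "M \<le> (N + 2) * w\<^sup>2" by (simp add: M_def algebra_simps)
      then have "M * d L \<le> (N + 2) * w\<^sup>2 * d L" using d[OF L] by (intro mult_right_mono) auto
      also have "\<dots> = w\<^sup>2 / L"
      proof -
        have "n * u * (1 / (n * L)) = u / L" if "n \<noteq> 0" for n u :: real using that by simp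
        from this[of "N + 2" "w\<^sup>2"] show ?thesis unfolding d_def using N by simp
      qed
      finally have "(M * d L)\<^sup>2 \<le> (w\<^sup>2 / L)\<^sup>2" using M1 d[OF L] by (intro power_mono) auto
      then show ?thesis by (simp add: power_mult_distrib power_divide)
    qed
    have hc: "3 * h * c * exp (- t) * Q v \<le> Q2 v + 2 * \<kappa> * Q1 v"
    proof -
      have "3 * h * c * exp (- t) \<le> 3 * h * c * (exp (- v) / X)" using eX h c0 by (intro mult_left_mono) auto
      also have "\<dots> = 72 * h * c / X * (exp (- v) / 24)" by simp
      also have "\<dots> \<le> 1 * (exp (- v) / 24)" using X by (intro mult_right_mono) auto
      finally have "3 * h * c * exp (- t) * Q v \<le> exp (- v) / 24 * Q v" using Qv by (intro mult_right_mono) auto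
      then show ?thesis using Qv by linarith
    qed
    define br where "br = g2 L t - ((real DIM('a))\<^sup>2 / 4 - c) * g L t - 3 * h * c * exp (- t) * g L t - M\<^sup>2 * (d L)\<^sup>2 * g L t"
    have br: "- (E * (3 / L * w ^ 4 * z * (C * Q v powr (1 / p)))) \<le> br"
    proof -
      have 1: "3 / L * w ^ 4 * z * (Q1 v + \<kappa> * Q v + Q v / L) \<le> 3 / L * w ^ 4 * z * (C * Q v powr (1 / p))"
        using Qv v L w z by (intro mult_left_mono) auto
      have "- (3 / L * w ^ 4 * z * (Q1 v + \<kappa> * Q v + Q v / L)) \<le>
        (\<kappa>\<^sup>2 * (Q v * z) + 2 * \<kappa> * (Q1 v * z - Q v * (z * w\<^sup>2) / L) + (Q2 v * z - 2 * (Q1 v * (z * w\<^sup>2)) / L + Q v * (z * (w ^ 4 - 2 * w ^ 3)) / L\<^sup>2))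
         - \<kappa>\<^sup>2 * (Q v * z) - 3 * h * c * exp (- t) * (Q v * z) - M\<^sup>2 * (d L)\<^sup>2 * (Q v * z)" (is "_ \<le> ?r")
        by (rule cutoff_algebra[OF L w _ _ _ k0 hc Md]) (use z Qv in auto)
      with 1 have "- (3 / L * w ^ 4 * z * (C * Q v powr (1 / p))) \<le> ?r" by linarith
      from mult_left_mono[OF this, of E] E
      have "- (E * (3 / L * w ^ 4 * z * (C * Q v powr (1 / p)))) \<le> E * ?r" by simp
      also have "E * ?r = br"
        unfolding br_def N_def[symmetric] k2[symmetric] g2t gt by (simp only: right_diff_distrib mult.left_commute[of E])
      finally show ?thesis .
    qed
    define F where "F = soft_pos (d L ^ 3) a"
    have F: "0 < F" "F \<le> a" using soft_pos_pos[OF d3[OF L] a0] soft_pos_le[OF d3[OF L] a0] by (auto simp: F_def)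
    define G where "G = kelvin_C x * Y\<^sup>2 * b powr (- (N / 4) - 1) * F"
    have G: "0 \<le> G" using kelvin_C_pos[OF x] F by (simp add: G_def)
    have "G * br \<le> laplacian (\<phi> L) x + c / (norm x)\<^sup>2 * \<phi> L x"
      unfolding G_def br_def F_def ab N_def \<phi>_def
      by (rule kelvin_test_pos_part[OF e x h A B[unfolded ab] d[OF L] less_imp_le[OF c0] g t_def M1 _ Mg])
        (use gt E Qv z in auto)
    moreover have "- (G * (E * (3 / L * w ^ 4 * z * (C * Q v powr (1 / p))))) \<le> G * br"
      using mult_left_mono[OF br G] by simp
    ultimately have 1: "- laplacian (\<phi> L) x - c / (norm x)\<^sup>2 * \<phi> L x \<le> G * (E * (3 / L * w ^ 4 * z * (C * Q v powr (1 / p))))"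
      by linarith
    \<comment> \<open>The geometric factor of phi, leaving the profile and the cutoff. Writing each
      of \<open>Z\<close> and \<open>z\<close> as its 1/p-th times its q-th power isolates
      phi^(1/p); \<open>weight_bound\<close> then treats \<open>Z powr q\<close>, and exp(-q w)
      tames w^4.\<close>
    define Z where "Z = kelvin_C x * (F * (b powr (- (N / 4)) * E))"
    have Z: "0 < Z" using kelvin_C_pos[OF x] F E b0 by (simp add: Z_def)
    have phi: "\<phi> L x = Z * (Q v * z)"
    proof -
      have tb: "ln b / 2 = t" by (simp add: t_def ab)
      show ?thesis
        unfolding \<phi>_def kelvin_test_def ab[symmetric] F_def[symmetric] tb gt
        by (simp add: Z_def N_def)
    qed
    have bb: "b powr (- (N / 4)) = b powr (- (N / 4) - 1) * b"
      using b0 powr_add[of b "- (N / 4) - 1" 1] by simp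
    have "G * (E * (3 / L * w ^ 4 * z * (C * Q v powr (1 / p)))) = Z * (Y\<^sup>2 / b) * (3 * C / L) * (w ^ 4 * z) * Q v powr (1 / p)"
      unfolding G_def Z_def bb using b0 by simp
    also have "\<dots> = (Z powr (1 / p) * (Q v powr (1 / p) * z powr (1 / p))) * (3 * C / L * (Z powr q * (Y\<^sup>2 / b)) * (w ^ 4 * z powr q))"
    proof -
      have "u = u powr (1 / p) * u powr q" if "0 < u" for u :: real
        using that by (simp add: powr_add[symmetric] q_def)
      from this[OF Z] this[OF z] have "Z * (Y\<^sup>2 / b) * (3 * C / L) * (w ^ 4 * z) * Q v powr (1 / p) =
        (Z powr (1 / p) * Z powr q) * (Y\<^sup>2 / b) * (3 * C / L) * (w ^ 4 * (z powr (1 / p) * z powr q)) * Q v powr (1 / p)"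
        by simp
      then show ?thesis by (simp only: mult_ac)
    qed
    also have "Z powr (1 / p) * (Q v powr (1 / p) * z powr (1 / p)) = \<phi> L x powr (1 / p)"
      unfolding phi using Z Qv z by (simp add: powr_mult)
    also have "\<phi> L x powr (1 / p) * (3 * C / L * (Z powr q * (Y\<^sup>2 / b)) * (w ^ 4 * z powr q))
      \<le> \<phi> L x powr (1 / p) * (K / L * norm x powr (- (N * q)))"
    proof (rule mult_left_mono)
      have wz: "w ^ 4 * z powr q \<le> 24 / q ^ 4"
        unfolding be(1) exp_neg_powr using power_exp_scaled[of w q 4] w q by (simp add: fact_numeral)
      have "Z \<le> Y powr (N / 2 - 1) * (sqrt b * (b powr (- (N / 4)) * E))"
      proof -
        have "F \<le> sqrt b" using F as by (simp add: s_def)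
        then show ?thesis unfolding Z_def kelvin_C_def N_def[symmetric] ab(3)[symmetric]
          using E by (intro mult_left_mono mult_right_mono) auto
      qed
      then have "Z powr q \<le> (Y powr (N / 2 - 1) * (sqrt b * (b powr (- (N / 4)) * E))) powr q"
        using Z q by (intro powr_mono2) auto
      then have "Z powr q * (Y\<^sup>2 / b) \<le> (Y powr (N / 2 - 1) * (sqrt b * (b powr (- (N / 4)) * E))) powr q * (Y\<^sup>2 / b)"
        using b0 by (intro mult_right_mono) auto
      also have "\<dots> \<le> (1 / 4) powr (q * (1 / 2 - N / 4 + \<kappa> / 2) - 1) * Y powr (N * q / 2)"
        using weight_bound[OF B(2) Y1 Y4 q k0 k1 qa] unfolding E_def t_def ab(2)[symmetric] .
      also have "Y powr (N * q / 2) = norm x powr (- (N * q))"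
      proof -
        have "Y = norm x powr (- 2)" using xn by (simp add: Yn powr_minus inverse_eq_divide)
        then show ?thesis by (simp add: powr_powr)
      qed
      finally have zz: "Z powr q * (Y\<^sup>2 / b) \<le> (1 / 4) powr (q * (1 / 2 - N / 4 + \<kappa> / 2) - 1) * norm x powr (- (N * q))" .
      have "3 * C / L * (Z powr q * (Y\<^sup>2 / b)) * (w ^ 4 * z powr q) \<le>
        3 * C / L * ((1 / 4) powr (q * (1 / 2 - N / 4 + \<kappa> / 2) - 1) * norm x powr (- (N * q))) * (24 / q ^ 4)"
        using C0 L b0 w by (intro mult_mono wz zz mult_nonneg_nonneg) auto
      also have "\<dots> = K / L * norm x powr (- (N * q))" by (simp add: K_def mult_ac)
      finally show "3 * C / L * (Z powr q * (Y\<^sup>2 / b)) * (w ^ 4 * z powr q) \<le> K / L * norm x powr (- (N * q))" .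
    qed simp
    finally show "- laplacian (\<phi> L) x - c / (norm x)\<^sup>2 * \<phi> L x \<le>
        \<phi> L x powr (1 / p) * (K / L * norm x powr (- (N * q)))" using 1 by linarith
  qed
  \<comment> \<open>At zeros of phi the right-hand side is 0, so the Laplacian must be shown to
    vanish there, also on the boundary of the support.\<close>
  have main0: "- laplacian (\<phi> L) x - c / (norm x)\<^sup>2 * \<phi> L x \<le>
        \<phi> L x powr (1 / p) * (K / L * norm x powr (- (N * q)))"
    if L: "1 \<le> L" for L x
  proof (cases "\<phi> L x = 0")
    case True
    have "laplacian (\<phi> L) x = 0"
    proof (cases "x \<in> tsupport (\<phi> L)")
      case xs: True
      from tf(3)[OF L xs] have x: "x \<noteq> 0" "0 < kelvin_B e h x" by auto
      have "soft_pos (d L ^ 3) (kelvin_A e h x) = 0 \<or> g L (ln (kelvin_B e h x) / 2) = 0"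
        using True kelvin_C_pos[OF x(1)] x(2) by (auto simp: \<phi>_def kelvin_test_def)
      then have "kelvin_A e h x \<le> 0 \<or> g L (ln (kelvin_B e h x) / 2) = 0"
        using soft_pos_pos[OF d3[OF L], of "kelvin_A e h x"] by force
      moreover have "g L t = 0 \<Longrightarrow> g1 L t = 0 \<and> g2 L t = 0" for t
      proof -
        assume g0: "g L t = 0"
        have "\<not> (0 < t - t0 \<and> t - t0 < L)"
        proof
          assume v: "0 < t - t0 \<and> t - t0 < L"
          then have "0 < 1 - (t - t0) / L" using L by (simp add: field_simps)
          then have "0 < bexp (1 - (t - t0) / L)" by (simp add: bexp_def)
          then show False using g0 Qp[of "t - t0"] v by (simp add: g_def)
        qed
        then show ?thesis using gz[OF L] by blast
      qed
      ultimately show ?thesis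
        unfolding \<phi>_def by (intro kelvin_test_vanish(1)[OF e x d3[OF L] g]) blast
    qed (rule laplacian_outside)
    then show ?thesis using True by simp
  qed (rule main[OF L])
  \<comment> \<open>z = exp(t0 + 1) e has v = 1, inside the part of the profile that survives for
    every large \<open>L\<close>.\<close>
  obtain y where y: "kelvin_A e h y = exp (t0 + 1)" "ln (kelvin_B e h y) / 2 = ln (exp (t0 + 1))" "y \<noteq> 0"
    using kelvin_axis_point[OF e h exp_gt_zero] by blast
  \<comment> \<open>A minorant without \<open>L\<close>: smoothing parameter 1 and no cutoff.
    Smaller smoothing parameters only increase \<open>soft_pos\<close>, and for L >= 4 the cutoff is
    at least \<open>bexp (1 / 2)\<close> where t - t0 < 2.\<close>
  define \<psi> where "\<psi> = kelvin_test e h (soft_pos 1) (\<lambda>t. exp (\<kappa> * t) * Q (t - t0))"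
  define V where "V = {x \<in> - {0::'a}. 0 < kelvin_B e h x}"
  have cB: "continuous_on (- {0}) (kelvin_B e h)" and cA: "continuous_on (- {0}) (kelvin_A e h)"
    by (auto intro!: smooth_on_continuous smooth_kelvin_B smooth_kelvin_A)
  have V: "open V" "0 \<notin> V"
    using continuous_open_preimage[OF cB, of "{0<..}"] by (simp_all add: V_def vimage_def Int_def open_Compl)
  have "0 < (kelvin_A e h y)\<^sup>2" unfolding y by simp
  then have "0 < kelvin_B e h y" using kelvin_A_square_le[OF e, of h y] by linarith
  then have yV: "y \<in> V" using y by (simp add: V_def)
  have "smooth_on V \<psi>"
    unfolding \<psi>_def
  proof (rule smooth_kelvin_test[OF V])
    show "smooth_on V (\<lambda>x. soft_pos 1 (kelvin_A e h x))"
      unfolding soft_pos_def divide_inverse by (intro smooth_on_mult smooth_on_bexp smooth_kelvin_A smooth_on_const V)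
    have BV: "0 < kelvin_B e h x" if "x \<in> V" for x using that by (simp add: V_def)
    show "smooth_on V (\<lambda>x. exp (\<kappa> * (ln (kelvin_B e h x) / 2)) * Q (ln (kelvin_B e h x) / 2 - t0))"
      unfolding divide_inverse 
      by (intro smooth_on_mult smooth_on_exp Qs smooth_on_diff smooth_on_const smooth_on_ln smooth_kelvin_B V BV)
  qed (simp add: V_def)
  then have c\<psi>: "continuous_on V \<psi>" by (rule smooth_on_continuous)
  have py: "0 < \<psi> y"
    using kelvin_C_pos[OF y(3)] soft_pos_pos[of 1 "kelvin_A e h y"] \<open>0 < kelvin_B e h y\<close> Qp[of 1] y(1)
    unfolding \<psi>_def kelvin_test_def y(2) by simp
  define V' where "V' = {x \<in> V. \<psi> y / 2 < \<psi> x} \<inter> {x \<in> - {0}. kelvin_B e h x < exp (2 * (t0 + 2))}"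
  have "open V'"
    unfolding V'_def
  proof (rule open_Int)
    show "open {x \<in> V. \<psi> y / 2 < \<psi> x}"
      using continuous_open_preimage[OF c\<psi> V(1), of "{\<psi> y / 2<..}"] by (simp add: vimage_def Int_def)
    show "open {x \<in> - {0}. kelvin_B e h x < exp (2 * (t0 + 2))}"
      using continuous_open_preimage[OF cB, of "{..<exp (2 * (t0 + 2))}"] by (simp add: vimage_def Int_def open_Compl)
  qed
  moreover have "y \<in> V'"
  proof -
    have "kelvin_B e h y = exp (2 * (t0 + 1))" using y(2) \<open>0 < kelvin_B e h y\<close> by (metis exp_ln ln_exp nonzero_mult_div_cancel_left times_divide_eq_right zero_neq_numeral)
    then show ?thesis using yV py y by (simp add: V'_def)
  qed
  ultimately obtain \<rho> where \<rho>: "0 < \<rho>" "ball y \<rho> \<subseteq> V'" using open_contains_ball by blast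
  define \<eta> where "\<eta> = \<psi> y / 2 * bexp (1 / 2)"
  have b2: "0 < bexp (1 / 2)" by (simp add: bexp_def)
  have eta: "0 < \<eta>" using py b2 by (simp add: \<eta>_def)
  have low: "\<eta> \<le> \<phi> L x" if L: "4 \<le> L" and x: "x \<in> ball y \<rho>" for L x
  proof -
    have xV: "x \<noteq> 0" "0 < kelvin_B e h x" "\<psi> y / 2 < \<psi> x" "kelvin_B e h x < exp (2 * (t0 + 2))"
      using subsetD[OF \<rho>(2) x] by (auto simp: V'_def V_def)
    define t where "t = ln (kelvin_B e h x) / 2"
    have "ln (kelvin_B e h x) < 2 * (t0 + 2)" using xV by (metis exp_gt_zero ln_exp ln_less_cancel_iff)
    then have "t - t0 < 2" by (simp add: t_def)
    then have z: "bexp (1 / 2) \<le> bexp (1 - (t - t0) / L)"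
      using L by (intro bexp_mono) (simp add: field_simps)
    have Qn: "0 \<le> Q v" for v using Qp[of v] Qz[of v] by (cases "0 < v") auto
    have f: "0 \<le> soft_pos 1 (kelvin_A e h x)" "soft_pos 1 (kelvin_A e h x) \<le> soft_pos (d L ^ 3) (kelvin_A e h x)"
    proof -
      show "0 \<le> soft_pos 1 (kelvin_A e h x)" by (rule soft_pos_nonneg) simp
      show "soft_pos 1 (kelvin_A e h x) \<le> soft_pos (d L ^ 3) (kelvin_A e h x)"
      proof (cases "kelvin_A e h x \<le> 0")
        case True
        then show ?thesis using soft_pos_zero[of 1] soft_pos_zero[of "d L ^ 3"] d3[of L] L by simp
      next
        case False
        have "1 * 1 \<le> (N + 2) * L" using L N by (intro mult_mono) auto
        then have d1: "d L \<le> 1" unfolding d_def by (simp add: divide_le_eq_1)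
        have "0 < d L" using d[of L] L by simp
        then have "d L ^ 3 \<le> 1" using d1 by (intro power_le_one) auto
        then have "kelvin_A e h x / 1 \<le> kelvin_A e h x / d L ^ 3"
          using False d3[of L] L by (intro divide_left_mono) auto
        then show ?thesis unfolding soft_pos_def using False by (intro mult_left_mono bexp_mono) auto
      qed
    qed
    define P where "P = kelvin_C x * (kelvin_B e h x powr (- (real DIM('a) / 4)) * (exp (\<kappa> * t) * Q (t - t0)))"
    have P: "0 \<le> P" using kelvin_C_pos[OF xV(1)] Qn by (simp add: P_def)
    have "\<eta> \<le> \<psi> x * bexp (1 / 2)" unfolding \<eta>_def using xV b2 by (intro mult_right_mono) auto
    also have "\<dots> = P * soft_pos 1 (kelvin_A e h x) * bexp (1 / 2)" by (simp add: \<psi>_def kelvin_test_def P_def t_def)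
    also have "\<dots> \<le> P * soft_pos (d L ^ 3) (kelvin_A e h x) * bexp (1 - (t - t0) / L)"
      using f P z b2 by (intro mult_mono mult_nonneg_nonneg) auto
    also have "\<dots> = \<phi> L x" by (simp add: \<phi>_def kelvin_test_def P_def g_def t_def)
    finally show ?thesis .
  qed
  have ballD: "ball y \<rho> \<subseteq> D"
  proof
    fix x assume "x \<in> ball y \<rho>"
    then have "\<phi> 4 x \<noteq> 0" using low[of 4 x] eta by auto
    then have "x \<in> tsupport (\<phi> 4)" using outside_tsupport by blast
    then show "x \<in> D" using tf(1)[of 4] by (auto simp: test_fun_def)
  qed
  show ?thesis
    unfolding N_def[symmetric] q_def[symmetric]
  proof (rule exI[of _ y], rule exI[of _ \<rho>], rule exI[of _ \<eta>], rule exI[of _ K], rule exI[of _ "t0 + 1"], intro conjI allI impI)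
    fix L :: real assume L: "4 \<le> L"
    then have L1: "1 \<le> L" by simp
    show "\<exists>\<phi>. test_fun D \<phi> \<and> (\<forall>x. 0 \<le> \<phi> x) \<and> (\<forall>x\<in>ball y \<rho>. \<eta> \<le> \<phi> x) \<and>
     (\<forall>x. \<phi> x \<noteq> 0 \<longrightarrow> exp (- (t0 + 1 + L)) \<le> norm x \<and> norm x \<le> 1) \<and>
     (\<forall>x. - laplacian \<phi> x - c / (norm x)\<^sup>2 * \<phi> x \<le> \<phi> x powr (1 / p) * (K / L * norm x powr (- (N * q))))"
      using tf(1)[OF L1] nn[OF L1] low[OF L] supp[OF L1] main0[OF L1]
      by (intro exI[of _ "\<phi> L"]) blast
  qed (use \<rho> eta K ballD in auto)
qed

section \<open>Vanishing of weak supersolutions\<close>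

text \<open>The linear term is reduced to the p-th power by v <= 1 + v^p on the compact
  support.\<close>

lemma Lp_loc_mult_integrable:
  fixes u \<psi> :: "'a::euclidean_space \<Rightarrow> real"
  assumes u: "Lp_loc p D u" and u0: "\<forall>x\<in>D. 0 \<le> u x" and p: "1 < p"
    and K: "compact K" "K \<subseteq> D" and \<psi>: "continuous_on UNIV \<psi>" "\<And>x. x \<notin> K \<Longrightarrow> \<psi> x = 0"
  shows "integrable lebesgue (\<lambda>x. indicator D x *\<^sub>R (u x powr p * \<psi> x))"
    and "integrable lebesgue (\<lambda>x. indicator D x *\<^sub>R (u x * \<psi> x))"
proof -
  have um: "u \<in> borel_measurable lebesgue" and ui: "integrable lebesgue (\<lambda>x. indicator K x *\<^sub>R \<bar>u x\<bar> powr p)"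
    using u K by (auto simp: Lp_loc_def set_integrable_def)
  have pm: "\<psi> \<in> borel_measurable lebesgue"
    using measurable_completion[of \<psi> lborel borel] borel_measurable_continuous_onI[OF \<psi>(1)] by simp
  obtain M where M: "\<And>x. \<bar>\<psi> x\<bar> \<le> M" "0 \<le> M"
  proof -
    have "bounded (\<psi> ` K)"
      by (intro compact_imp_bounded compact_continuous_image[OF continuous_on_subset[OF \<psi>(1)]] K) simp
    then obtain M where "M > 0" "\<And>x. x \<in> K \<Longrightarrow> norm (\<psi> x) \<le> M"
      unfolding bounded_pos by auto
    then have "\<bar>\<psi> x\<bar> \<le> M" for x using \<psi>(2)[of x] by (cases "x \<in> K") auto
    then show ?thesis using \<open>M > 0\<close> by (intro that[of M]) auto
  qed
  have Km: "K \<in> sets lebesgue" using K(1) by (simp add: borel_compact)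
  have i1: "integrable lebesgue (\<lambda>x. M * (indicator K x *\<^sub>R \<bar>u x\<bar> powr p))" using ui by simp
  have "integrable lebesgue (\<lambda>x. indicator K x :: real)"
    using Km emeasure_compact_finite[OF K(1)] K(1) by (intro integrable_real_indicator) (auto simp: borel_compact)
  then have i2: "integrable lebesgue (\<lambda>x. M * (indicator K x + indicator K x *\<^sub>R \<bar>u x\<bar> powr p))" using ui by simp
  have e1: "indicator D x *\<^sub>R (u x powr p * \<psi> x) = indicator K x *\<^sub>R (\<bar>u x\<bar> powr p * \<psi> x)"
    and e2: "indicator D x *\<^sub>R (u x * \<psi> x) = indicator K x *\<^sub>R (\<bar>u x\<bar> * \<psi> x)" for x
    using K(2) \<psi>(2)[of x] u0 by (auto simp: indicator_def)
  show "integrable lebesgue (\<lambda>x. indicator D x *\<^sub>R (u x powr p * \<psi> x))"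
    unfolding e1
  proof (rule Bochner_Integration.integrable_bound[OF i1])
    show "(\<lambda>x. indicator K x *\<^sub>R (\<bar>u x\<bar> powr p * \<psi> x)) \<in> borel_measurable lebesgue"
      using um pm Km by measurable
    show "AE x in lebesgue. norm (indicator K x *\<^sub>R (\<bar>u x\<bar> powr p * \<psi> x)) \<le> norm (M * (indicator K x *\<^sub>R \<bar>u x\<bar> powr p))"
      using M by (intro AE_I2) (auto simp: indicator_def abs_mult mult.commute intro!: mult_right_mono)
  qed
  show "integrable lebesgue (\<lambda>x. indicator D x *\<^sub>R (u x * \<psi> x))"
    unfolding e2
  proof (rule Bochner_Integration.integrable_bound[OF i2])
    show "(\<lambda>x. indicator K x *\<^sub>R (\<bar>u x\<bar> * \<psi> x)) \<in> borel_measurable lebesgue"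
      using um pm Km by measurable
    have v: "v \<le> 1 + v powr p" if "0 \<le> v" for v :: real
    proof (cases "v \<le> 1")
      case False
      then have "v powr 1 \<le> v powr p" using p by (intro powr_mono) auto
      then show ?thesis using False by simp
    qed (smt (verit) powr_ge_zero)
    have "\<bar>u x\<bar> * \<bar>\<psi> x\<bar> \<le> M * (1 + \<bar>u x\<bar> powr p)" for x
    proof -
      have "\<bar>u x\<bar> * \<bar>\<psi> x\<bar> \<le> (1 + \<bar>u x\<bar> powr p) * M" using v[of "\<bar>u x\<bar>"] M by (intro mult_mono) auto
      then show ?thesis by (simp add: mult.commute)
    qed
    then show "AE x in lebesgue. norm (indicator K x *\<^sub>R (\<bar>u x\<bar> * \<psi> x)) \<le> norm (M * (indicator K x + indicator K x *\<^sub>R \<bar>u x\<bar> powr p))"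
      using M by (intro AE_I2) (auto simp: indicator_def abs_mult)
  qed
qed

definition weak_supersolution :: "real \<Rightarrow> real \<Rightarrow> 'a::euclidean_space set \<Rightarrow> ('a \<Rightarrow> real) \<Rightarrow> bool" where
  "weak_supersolution c p D u \<longleftrightarrow> Lp_loc p D u \<and> (\<forall>x\<in>D. 0 \<le> u x) \<and>
     (\<forall>\<phi>. test_fun D \<phi> \<and> (\<forall>x. \<phi> x \<ge> 0) \<longrightarrow>
       (LINT x:D|lebesgue. u x powr p * \<phi> x)
         \<le> (LINT x:D|lebesgue. u x * (- laplacian \<phi> x - c / (norm x)\<^sup>2 * \<phi> x)))"

lemma test_operator_continuous:
  assumes D: "open D" "0 \<notin> D" and \<phi>: "test_fun D \<phi>"
  shows "continuous_on UNIV (\<lambda>x. - laplacian \<phi> x - c / (norm x)\<^sup>2 * \<phi> x)"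
    and "x \<notin> tsupport \<phi> \<Longrightarrow> - laplacian \<phi> x - c / (norm x)\<^sup>2 * \<phi> x = 0"
proof -
  have "continuous_on UNIV (\<lambda>x. \<phi> x * (c * inverse ((norm x)\<^sup>2)))"
    using D by (intro test_fun_mult_continuous_on[OF D(1) \<phi>] continuous_intros) auto
  moreover have "continuous_on UNIV (laplacian \<phi>)"
    using \<phi> continuous_laplacian unfolding test_fun_def by blast
  ultimately have "continuous_on UNIV (\<lambda>x. - laplacian \<phi> x - \<phi> x * (c * inverse ((norm x)\<^sup>2)))"
    by (intro continuous_on_diff continuous_on_minus)
  then show "continuous_on UNIV (\<lambda>x. - laplacian \<phi> x - c / (norm x)\<^sup>2 * \<phi> x)"
    by (simp add: divide_inverse mult_ac)
  show "x \<notin> tsupport \<phi> \<Longrightarrow> - laplacian \<phi> x - c / (norm x)\<^sup>2 * \<phi> x = 0"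
    by (simp add: laplacian_outside outside_tsupport)
qed

lemma weak_supersolution_integrable:
  assumes D: "open D" "0 \<notin> D" and p: "1 < p" and u: "weak_supersolution c p D u" and \<phi>: "test_fun D \<phi>"
  shows "integrable lebesgue (\<lambda>x. indicator D x *\<^sub>R (u x powr p * \<phi> x))"
    and "integrable lebesgue (\<lambda>x. indicator D x *\<^sub>R (u x * (- laplacian \<phi> x - c / (norm x)\<^sup>2 * \<phi> x)))"
proof -
  have K: "compact (tsupport \<phi>)" "tsupport \<phi> \<subseteq> D" and c: "continuous_on UNIV \<phi>"
    using \<phi> smooth_on_continuous by (auto simp: test_fun_def)
  have u': "Lp_loc p D u" "\<forall>x\<in>D. 0 \<le> u x" using u by (auto simp: weak_supersolution_def)
  show "integrable lebesgue (\<lambda>x. indicator D x *\<^sub>R (u x powr p * \<phi> x))"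
    by (rule Lp_loc_mult_integrable(1)[OF u' p K c]) (rule outside_tsupport)
  show "integrable lebesgue (\<lambda>x. indicator D x *\<^sub>R (u x * (- laplacian \<phi> x - c / (norm x)\<^sup>2 * \<phi> x)))"
    by (rule Lp_loc_mult_integrable(2)[OF u' p K test_operator_continuous[OF D \<phi>]])
qed

lemma AE_zero_of_integral_nonneg:
  fixes f :: "'a \<Rightarrow> real"
  assumes f: "integrable M f" "AE x in M. f x \<le> 0" "0 \<le> (LINT x|M. f x)"
  shows "AE x in M. f x = 0"
proof -
  have "0 \<le> (LINT x|M. - f x)" using f by (intro integral_nonneg_AE) auto
  then have "(LINT x|M. - f x) = 0" using f by simp
  then have "AE x in M. - f x = 0"
    using integral_nonneg_eq_0_iff_AE[of M "\<lambda>x. - f x"] f by auto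
  then show ?thesis by simp
qed

section \<open>Hopf bumps and the spreading of zeros\<close>

definition hopf_bump :: "'a::euclidean_space \<Rightarrow> real \<Rightarrow> real \<Rightarrow> 'a \<Rightarrow> real" where
  "hopf_bump a S k x = bexp ((S\<^sup>2 - (norm (x - a))\<^sup>2) / k)"

lemma hopf_bump_test_fun:
  assumes S: "0 < S" and k: "0 < k" and D: "cball a S \<subseteq> D"
  shows "test_fun D (hopf_bump a S k)" "x \<notin> ball a S \<Longrightarrow> hopf_bump a S k x = 0"
proof -
  have n: "(norm (x - a))\<^sup>2 = x \<bullet> x - (x \<bullet> (2 *\<^sub>R a)) + a \<bullet> a" for x
    by (simp add: power2_norm_eq_inner inner_diff_left inner_diff_right inner_commute)
  have "smooth_on UNIV (\<lambda>x. bexp ((S\<^sup>2 - (x \<bullet> x - (x \<bullet> (2 *\<^sub>R a)) + a \<bullet> a)) * inverse k))"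
    by (intro smooth_on_bexp smooth_on_mult smooth_on_diff smooth_on_add smooth_on_const smooth_on_inner smooth_on_inner_self open_UNIV)
  then have s: "smooth_on UNIV (hopf_bump a S k)"
    unfolding hopf_bump_def[abs_def] n divide_inverse .
  have z: "hopf_bump a S k x = 0" if "x \<notin> ball a S" for x
  proof -
    have "S \<le> norm (x - a)" using that by (simp add: dist_norm norm_minus_commute)
    then have "S\<^sup>2 \<le> (norm (x - a))\<^sup>2" using S by (intro power_mono) auto
    then show ?thesis using k by (simp add: hopf_bump_def bexp_def divide_le_0_iff)
  qed
  then show "x \<notin> ball a S \<Longrightarrow> hopf_bump a S k x = 0" by blast
  have z': "hopf_bump a S k x = 0" if "x \<notin> cball a S" for x using z that by auto
  show "test_fun D (hopf_bump a S k)"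
    unfolding test_fun_def
    using s compact_tsupport[of "cball a S" "hopf_bump a S k", OF compact_cball z']
      tsupport_subset[of "cball a S" "hopf_bump a S k", OF closed_cball z'] D by blast
qed

text \<open>With v = (S^2 - |x-a|^2)/k and y = |x-a|^2 the Laplacian is a positive factor times 4 y
  (1 - 2 v) - 2 N k v^2. The first bound on \<open>k\<close> makes v <= 1/4; the second, with k v <=
  S^2, makes N k v^2 at most s^2/2.\<close>

lemma hopf_bump_subharmonic:
  fixes a :: "'a::euclidean_space"
  assumes s: "0 < s" "s \<le> norm (x - a)" and S: "norm (x - a) < S" and k: "4 * S\<^sup>2 \<le> k" "2 * real DIM('a) * S ^ 4 / s\<^sup>2 \<le> k"
  shows "0 < laplacian (hopf_bump a S k) x"
proof -
  define N where "N = real DIM('a)"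
  have S0: "0 < S" using s S by linarith
  then have k0: "0 < k" using k(1) by (smt (verit) zero_less_power)
  have g: "has_grad_lap UNIV (\<lambda>x. (x \<bullet> x + x \<bullet> (- (2 *\<^sub>R a))) + a \<bullet> a) (\<lambda>x. (2 *\<^sub>R x + - (2 *\<^sub>R a)) + 0) (\<lambda>x. (2 * real DIM('a) + 0) + 0)"
    by (intro has_grad_lap_add has_grad_lap_inner_self has_grad_lap_inner has_grad_lap_const open_UNIV)
  have l: "((\<lambda>y. (S\<^sup>2 - y) / k) has_real_derivative - (1 / k)) (at y)" for y
    by (rule DERIV_cong[OF DERIV_cdivide[OF DERIV_diff[OF DERIV_const DERIV_ident]]]) simp
  have d: "((\<lambda>y. bexp ((S\<^sup>2 - y) / k)) has_real_derivative - bexp1 ((S\<^sup>2 - y) / k) / k) (at y)"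
    "((\<lambda>y. - bexp1 ((S\<^sup>2 - y) / k) / k) has_real_derivative bexp2 ((S\<^sup>2 - y) / k) / k\<^sup>2) (at y)" for y
    by (rule DERIV_cong[OF DERIV_chain2[OF bexp_DERIV l]], simp,
        rule DERIV_cong[OF DERIV_cdivide[OF DERIV_minus[OF DERIV_chain2[OF bexp1_DERIV l]]]], simp add: power2_eq_square)
  have n: "x \<bullet> x + x \<bullet> (- (2 *\<^sub>R a)) + a \<bullet> a = (norm (x - a))\<^sup>2" for x
    by (simp add: power2_norm_eq_inner inner_diff_left inner_diff_right inner_commute)
  define y where "y = (norm (x - a))\<^sup>2"
  have gg: "(2 *\<^sub>R x + - (2 *\<^sub>R a) + 0) \<bullet> (2 *\<^sub>R x + - (2 *\<^sub>R a) + 0) = 4 * y"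
    by (simp add: y_def power2_norm_eq_inner inner_diff_left inner_diff_right inner_commute algebra_simps)
  have lap: "laplacian (hopf_bump a S k) x = (- bexp1 ((S\<^sup>2 - y) / k) / k) * (2 * N) + bexp2 ((S\<^sup>2 - y) / k) / k\<^sup>2 * (4 * y)"
  proof -
    have "has_grad_lap UNIV (hopf_bump a S k) (\<lambda>x. (- bexp1 ((S\<^sup>2 - (x \<bullet> x + x \<bullet> (- (2 *\<^sub>R a)) + a \<bullet> a)) / k) / k) *\<^sub>R ((2 *\<^sub>R x + - (2 *\<^sub>R a)) + 0))
      (\<lambda>x. (- bexp1 ((S\<^sup>2 - (x \<bullet> x + x \<bullet> (- (2 *\<^sub>R a)) + a \<bullet> a)) / k) / k) * ((2 * real DIM('a) + 0) + 0) +
         bexp2 ((S\<^sup>2 - (x \<bullet> x + x \<bullet> (- (2 *\<^sub>R a)) + a \<bullet> a)) / k) / k\<^sup>2 * (((2 *\<^sub>R x + - (2 *\<^sub>R a)) + 0) \<bullet> ((2 *\<^sub>R x + - (2 *\<^sub>R a)) + 0)))"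
      using has_grad_lap_compose[OF g, where S = UNIV, OF d] by (simp add: hopf_bump_def[abs_def] n[symmetric])
    from has_grad_lap_laplacian[OF this UNIV_I, of x] show ?thesis
      unfolding gg n y_def[symmetric] by (simp add: N_def)
  qed
  have y: "s\<^sup>2 \<le> y" "y < S\<^sup>2" unfolding y_def using s S by (auto intro!: power_mono power_strict_mono)
  define v where "v = (S\<^sup>2 - y) / k"
  have v: "0 < v" using y k0 by (simp add: v_def)
  have y0: "0 \<le> y" by (simp add: y_def)
  have kv: "k * v \<le> S\<^sup>2" using k0 y0 by (simp add: v_def)
  note be = bexp_estimates[OF v]
  have E: "0 < bexp v" by (simp add: be(1))
  have "v \<le> 1 / 4"
  proof -
    have "4 * (k * v) \<le> k" using kv k(1) by linarith
    then have "k * (4 * v) \<le> k * 1" by simp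
    then show ?thesis using k0 by simp
  qed
  then have "y * (1 / 2) \<le> y * (1 - 2 * v)" using y0 by (intro mult_left_mono) auto
  moreover have "N * (k * v\<^sup>2) \<le> s\<^sup>2 / 2"
  proof -
    have "(k * v)\<^sup>2 \<le> (S\<^sup>2)\<^sup>2" using kv k0 v by (intro power_mono) auto
    then have "k * (k * v\<^sup>2) \<le> S ^ 4" by (simp add: power_mult_distrib power2_eq_square power4_eq_xxxx mult_ac)
    then have "2 * N * (k * (k * v\<^sup>2)) \<le> 2 * N * S ^ 4" by (intro mult_left_mono) (auto simp: N_def)
    also have "\<dots> \<le> k * s\<^sup>2" using k(2) s by (simp add: pos_divide_le_eq N_def)
    finally have "k * (2 * N * (k * v\<^sup>2)) \<le> k * s\<^sup>2" by (simp add: mult_ac)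
    then show ?thesis using k0 by simp
  qed
  moreover have "0 < s\<^sup>2" using s by simp
  ultimately have "0 < 4 * y * (1 - 2 * v) - 2 * N * (k * v\<^sup>2)" using y by linarith
  then have "0 < bexp v / (k\<^sup>2 * v ^ 4) * (4 * y * (1 - 2 * v) - 2 * N * (k * v\<^sup>2))"
    using E k0 v by simp
  also have "\<dots> = laplacian (hopf_bump a S k) x"
    unfolding lap v_def[symmetric] be(2,3) using k0 v
    by (simp add: field_simps power2_eq_square power3_eq_cube power4_eq_xxxx)
  finally show ?thesis .
qed

text \<open>A strong maximum principle for weak supersolutions. Tested with a Hopf bump, the
  operator is negative on the annulus while u vanishes on the inner ball, so an integral known to be
  nonnegative has a nonpositive integrand; it vanishes almost everywhere, and so does u on the
  annulus.\<close>

lemma vanishing_spreads: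
  fixes u :: "'a::euclidean_space \<Rightarrow> real"
  assumes D: "open D" "0 \<notin> D" and p: "1 < p" and c: "0 \<le> c" and u: "weak_supersolution c p D u"
    and s: "0 < s" "s < S" and DS: "cball a S \<subseteq> D" and z: "AE x in lebesgue. x \<in> ball a s \<longrightarrow> u x = 0"
  shows "AE x in lebesgue. x \<in> ball a S \<longrightarrow> u x = 0"
proof -
  define k where "k = 4 * S\<^sup>2 + 2 * real DIM('a) * S ^ 4 / s\<^sup>2"
  have S: "0 < S" using s by simp
  have k: "0 < k" "4 * S\<^sup>2 \<le> k" "2 * real DIM('a) * S ^ 4 / s\<^sup>2 \<le> k"
    using S by (auto simp: k_def add_pos_nonneg)
  define \<phi> where "\<phi> = hopf_bump a S k"
  have t: "test_fun D \<phi>" and z\<phi>: "\<And>x. x \<notin> ball a S \<Longrightarrow> \<phi> x = 0"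
    unfolding \<phi>_def using hopf_bump_test_fun[OF S k(1) DS] by blast+
  have n: "0 \<le> \<phi> x" for x by (simp add: \<phi>_def hopf_bump_def bexp_nonneg)
  define \<psi> where "\<psi> x = - laplacian \<phi> x - c / (norm x)\<^sup>2 * \<phi> x" for x
  have u0: "\<And>x. x \<in> D \<Longrightarrow> 0 \<le> u x" using u by (auto simp: weak_supersolution_def)
  have neg: "\<psi> x < 0" if "s \<le> norm (x - a)" "norm (x - a) < S" for x
  proof -
    have "0 < laplacian \<phi> x" unfolding \<phi>_def by (rule hopf_bump_subharmonic[OF s(1) that k(2,3)])
    moreover have "0 \<le> c / (norm x)\<^sup>2 * \<phi> x" using c n by simp
    ultimately show ?thesis by (simp add: \<psi>_def)
  qed
  have zz: "\<psi> x = 0" if "x \<notin> cball a S" for x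
    unfolding \<psi>_def
  proof (rule test_operator_continuous(2)[OF D t])
    have "tsupport \<phi> \<subseteq> cball a S" by (rule tsupport_subset) (use z\<phi> in auto)
    then show "x \<notin> tsupport \<phi>" using that by blast
  qed
  \<comment> \<open>The sign of psi is established only off this sphere, a null set.\<close>
  have nS: "AE x in lebesgue. x \<notin> sphere a S"
    by (intro AE_not_in) (simp add: negligible_iff_null_sets[symmetric] negligible_sphere)
  have "AE x in lebesgue. indicator D x *\<^sub>R (u x * \<psi> x) = 0"
  proof (rule AE_zero_of_integral_nonneg)
    show "integrable lebesgue (\<lambda>x. indicator D x *\<^sub>R (u x * \<psi> x))"
      unfolding \<psi>_def by (rule weak_supersolution_integrable(2)[OF D p u t])
    have "0 \<le> (LINT x:D|lebesgue. u x powr p * \<phi> x)"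
      unfolding set_lebesgue_integral_def using n by (intro integral_nonneg_AE AE_I2) simp
    also have "\<dots> \<le> (LINT x:D|lebesgue. u x * \<psi> x)"
      using u t n unfolding weak_supersolution_def \<psi>_def by blast
    finally show "0 \<le> (LINT x|lebesgue. indicator D x *\<^sub>R (u x * \<psi> x))"
      by (simp add: set_lebesgue_integral_def)
    show "AE x in lebesgue. indicator D x *\<^sub>R (u x * \<psi> x) \<le> 0"
      using z nS
    proof eventually_elim
      case (elim x)
      consider "x \<in> ball a s" | "s \<le> norm (x - a)" "norm (x - a) < S" | "x \<notin> cball a S"
        using elim by (force simp: dist_norm norm_minus_commute)
      then show ?case
      proof cases
        case 2
        then show ?thesis using neg[OF 2] u0[of x] by (auto simp: indicator_def mult_nonneg_nonpos)
      qed (use elim zz in auto)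
    qed
  qed
  then show ?thesis
    using z
  proof eventually_elim
    case (elim x)
    show ?case
    proof
      assume x: "x \<in> ball a S"
      show "u x = 0"
      proof (cases "x \<in> ball a s")
        case False
        then have "\<psi> x < 0" using x neg[of x] by (auto simp: dist_norm norm_minus_commute)
        moreover have "x \<in> D" using x DS by auto
        ultimately show ?thesis using elim by simp
      qed (use elim in auto)
    qed
  qed
qed

section \<open>The scale-invariant weight on annuli, and vanishing on a first ball\<close>

lemma dyadic_weight:
  fixes x :: "'a::euclidean_space"
  assumes x: "x \<noteq> 0" "norm x \<le> 1" "(1 / 2) ^ n \<le> norm x"
  shows "norm x powr (- real DIM('a)) \<le> (\<Sum>j\<le>n. 2 ^ (Suc j * DIM('a)) * indicator (cball 0 ((1 / 2) ^ j)) x)"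
proof -
  \<comment> \<open>The dyadic shell containing x; its single term already dominates the weight. If
    the maximum is attained at \<open>n\<close>, the assumed lower bound on the norm replaces
    maximality.\<close>
  define j where "j = (GREATEST j. j \<le> n \<and> norm x \<le> (1 / 2) ^ j)"
  have 0: "0 \<le> n \<and> norm x \<le> (1 / 2) ^ 0" using x by simp
  have j: "j \<le> n" "norm x \<le> (1 / 2) ^ j"
    using GreatestI_nat[of "\<lambda>j. j \<le> n \<and> norm x \<le> (1 / 2) ^ j" 0 n] 0 by (auto simp: j_def)
  have "(1 / 2) ^ Suc j \<le> norm x"
  proof (cases "Suc j \<le> n")
    case True
    then show ?thesis
      using Greatest_le_nat[of "\<lambda>j. j \<le> n \<and> norm x \<le> (1 / 2) ^ j" "Suc j" n] unfolding j_def[symmetric]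
      by (meson Suc_n_not_le_n linear)
  next
    case False
    then have "j = n" using j by simp
    moreover have "(1 / 2) ^ Suc n \<le> (1 / 2 :: real) ^ n" by simp
    ultimately show ?thesis using x(3) by (simp only: order_trans)
  qed
  then have "norm x powr (- real DIM('a)) \<le> ((1 / 2) ^ Suc j) powr (- real DIM('a))"
    by (intro powr_mono2') auto
  also have "\<dots> = 2 ^ (Suc j * DIM('a))"
    by (simp add: powr_minus powr_realpow power_mult power_divide del: power_Suc mult_Suc)
  also have "\<dots> = 2 ^ (Suc j * DIM('a)) * indicator (cball 0 ((1 / 2) ^ j)) x" using j by simp
  also have "\<dots> \<le> (\<Sum>j\<le>n. 2 ^ (Suc j * DIM('a)) * indicator (cball 0 ((1 / 2) ^ j)) x)"
    using j by (intro member_le_sum) auto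
  finally show ?thesis .
qed

text \<open>Each dyadic ball contributes the same amount, since the factor 2^(j N) cancels its
  volume. The integral is linear in the number of shells, that is, in the logarithm of the ratio of
  radii, without polar coordinates.\<close>

lemma dyadic_integral:
  "integrable lebesgue (\<lambda>x::'a::euclidean_space. \<Sum>j\<le>n. 2 ^ (Suc j * DIM('a)) * indicator (cball 0 ((1 / 2) ^ j)) x :: real)"
  "(LINT x|lebesgue. (\<Sum>j\<le>n. 2 ^ (Suc j * DIM('a)) * indicator (cball (0::'a) ((1 / 2) ^ j)) x)) = real (Suc n) * (2 ^ DIM('a) * unit_ball_vol (real DIM('a)))"
proof -
  have i: "integrable lebesgue (\<lambda>x::'a. indicator (cball 0 r) x :: real)" for r
    using emeasure_compact_finite[OF compact_cball] by (intro integrable_real_indicator) auto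
  then show "integrable lebesgue (\<lambda>x::'a. \<Sum>j\<le>n. 2 ^ (Suc j * DIM('a)) * indicator (cball 0 ((1 / 2) ^ j)) x :: real)"
    by (intro Bochner_Integration.integrable_sum integrable_mult_right)
  have m: "2 ^ (Suc j * DIM('a)) * measure lebesgue (cball (0::'a) ((1 / 2) ^ j)) = 2 ^ DIM('a) * unit_ball_vol (real DIM('a))" for j
  proof -
    have "measure lebesgue (cball (0::'a) ((1 / 2) ^ j)) = unit_ball_vol (real DIM('a)) * ((1 / 2) ^ j) ^ DIM('a)"
      using content_cball[of "(1 / 2) ^ j" "0::'a"] by simp
    moreover have "(2::real) ^ (Suc j * DIM('a)) * ((1 / 2) ^ j) ^ DIM('a) = 2 ^ DIM('a)"
      by (simp add: power_mult[symmetric] power_add power_divide)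
    ultimately show ?thesis by (simp only: mult_ac)
  qed
  show "(LINT x|lebesgue. (\<Sum>j\<le>n. 2 ^ (Suc j * DIM('a)) * indicator (cball (0::'a) ((1 / 2) ^ j)) x)) = real (Suc n) * (2 ^ DIM('a) * unit_ball_vol (real DIM('a)))"
    using i m by (subst Bochner_Integration.integral_sum) simp_all
qed

text \<open>1/q is the exponent conjugate to p. The defect contributes (K/L)^(1/q) and the weight a
  factor of order L, giving L^(1 - 1/q), which tends to 0.\<close>

lemma vanishing_ball:
  fixes e :: "'a::euclidean_space"
  assumes e: "norm e = 1" and h: "0 < h" and R: "0 < R" "R \<le> 1 / h" and D: "open D" "0 \<notin> D"
    and De: "{x. 0 < norm x \<and> norm x < R \<and> h * (norm x)\<^sup>2 \<le> x \<bullet> e} \<subseteq> D"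
    and c: "real DIM('a) - 1 < c" "c \<le> (real DIM('a))\<^sup>2 / 4"
    and p: "1 < p" "p_half_sphere (real DIM('a)) c \<le> p" and N3: "3 \<le> DIM('a)"
    and u: "weak_supersolution c p D u"
  shows "\<exists>y \<rho>. 0 < \<rho> \<and> ball y \<rho> \<subseteq> D \<and> (AE x in lebesgue. x \<in> ball y \<rho> \<longrightarrow> u x = 0)"
proof -
  define N where "N = real DIM('a)"
  define q where "q = 1 - 1 / p"
  have q: "0 < q" "q < 1" using p by (simp_all add: q_def)
  obtain y \<rho> \<eta> K T where \<rho>: "0 < \<rho>" and \<eta>: "0 < \<eta>" and K: "0 \<le> K" and b: "ball y \<rho> \<subseteq> D"
    and fam: "\<forall>L\<ge>4. \<exists>\<phi>. test_fun D \<phi> \<and>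
     (\<forall>x. 0 \<le> \<phi> x) \<and> (\<forall>x\<in>ball y \<rho>. \<eta> \<le> \<phi> x) \<and>
     (\<forall>x. \<phi> x \<noteq> 0 \<longrightarrow> exp (- (T + L)) \<le> norm x \<and> norm x \<le> 1) \<and>
     (\<forall>x. - laplacian \<phi> x - c / (norm x)\<^sup>2 * \<phi> x \<le> \<phi> x powr (1 / p) * (K / L * norm x powr (- (N * q))))"
    using capacity_test_functions[OF e h R D(1) De c p N3] unfolding N_def[symmetric] q_def[symmetric]
    by (elim exE conjE) (rule that)
  have u0: "\<And>x. x \<in> D \<Longrightarrow> 0 \<le> u x" and um: "u \<in> borel_measurable lebesgue"
    using u by (auto simp: weak_supersolution_def Lp_loc_def)
  \<comment> \<open>Half the radius, because u^p is integrable only on compact subsets of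
    \<open>D\<close>.\<close>
  define J where "J = (LINT x|lebesgue. indicator (ball y (\<rho> / 2)) x *\<^sub>R u x powr p)"
  have b2: "cball y (\<rho> / 2) \<subseteq> ball y \<rho>" using \<rho> by (auto simp: subset_eq)
  have iJ: "integrable lebesgue (\<lambda>x. indicator (ball y (\<rho> / 2)) x *\<^sub>R u x powr p)"
  proof -
    have "set_integrable lebesgue (cball y (\<rho> / 2)) (\<lambda>x. \<bar>u x\<bar> powr p)"
      using u b b2 unfolding weak_supersolution_def Lp_loc_def by (meson compact_cball order_trans)
    then have "set_integrable lebesgue (ball y (\<rho> / 2)) (\<lambda>x. \<bar>u x\<bar> powr p)"
      by (rule set_integrable_subset) auto
    moreover have "indicator (ball y (\<rho> / 2)) x *\<^sub>R \<bar>u x\<bar> powr p = indicator (ball y (\<rho> / 2)) x *\<^sub>R u x powr p" for x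
      using u0[of x] b b2 by (auto simp: indicator_def subset_eq)
    ultimately show ?thesis unfolding set_integrable_def by (simp only:)
  qed
  define H where "H = 2 ^ DIM('a) * unit_ball_vol (real DIM('a))"
  have H: "0 \<le> H" by (simp add: H_def)
  have est: "\<eta> * J \<le> K powr (1 / q) * (2 * \<bar>T\<bar> + 4) * H * L powr (1 - 1 / q)" if L: "4 \<le> L" for L
  proof -
    obtain \<phi> where t: "test_fun D \<phi>" and n: "\<And>x. 0 \<le> \<phi> x" and low: "\<And>x. x \<in> ball y \<rho> \<Longrightarrow> \<eta> \<le> \<phi> x"
      and supp: "\<And>x. \<phi> x \<noteq> 0 \<Longrightarrow> exp (- (T + L)) \<le> norm x \<and> norm x \<le> 1"
      and op: "\<And>x. - laplacian \<phi> x - c / (norm x)\<^sup>2 * \<phi> x \<le> \<phi> x powr (1 / p) * (K / L * norm x powr (- (N * q)))"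
      using fam L by blast
    \<comment> \<open>Enough shells to reach the inner radius exp(-(T + L)); the factor 2 comes from
      ln 2 >= 1/2.\<close>
    define m where "m = nat \<lceil>2 * (\<bar>T\<bar> + L)\<rceil>"
    have m: "2 * (\<bar>T\<bar> + L) \<le> real m" "real m \<le> 2 * (\<bar>T\<bar> + L) + 1" using L by (auto simp: m_def)
    have mm: "(1 / 2) ^ m \<le> exp (- (T + L))"
    proof -
      have "2 * (T + L) \<le> 2 * (\<bar>T\<bar> + L)" by simp
      then have "2 * (T + L) \<le> real m" using m(1) by (rule order_trans)
      then have "T + L \<le> real m * (1 / 2)" by simp
      also have "\<dots> \<le> real m * ln 2"
        using ln_2_less_1 ln2_ge_two_thirds by (intro mult_left_mono) auto
      finally have "exp (- (real m * ln 2)) \<le> exp (- (T + L))" by simp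
      moreover have "exp (- (real m * ln 2)) = (1 / 2) ^ m"
        by (simp add: exp_minus exp_of_nat_mult power_divide inverse_eq_divide power_one_over)
      ultimately show ?thesis by simp
    qed
    define S where "S x = (\<Sum>j\<le>m. 2 ^ (Suc j * DIM('a)) * indicator (cball 0 ((1 / 2) ^ j)) x :: real)" for x :: 'a
    have S0: "0 \<le> S x" for x unfolding S_def by (intro sum_nonneg) simp
    have iS: "integrable lebesgue S" "(LINT x|lebesgue. S x) = real (Suc m) * H"
      unfolding S_def[abs_def] H_def by (rule dyadic_integral)+
    define \<psi> where "\<psi> x = - laplacian \<phi> x - c / (norm x)\<^sup>2 * \<phi> x" for x
    define I where "I = (LINT x|lebesgue. indicator D x *\<^sub>R (u x powr p * \<phi> x))"
    have i1: "integrable lebesgue (\<lambda>x. indicator D x *\<^sub>R (u x powr p * \<phi> x))"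
      and i2: "integrable lebesgue (\<lambda>x. indicator D x *\<^sub>R (u x * \<psi> x))"
      unfolding \<psi>_def by (rule weak_supersolution_integrable[OF D p(1) u t])+
    define W where "W = (K / L) powr (1 / q)"
    have pw: "indicator D x *\<^sub>R (u x * \<psi> x) \<le> 1 / p * (indicator D x *\<^sub>R (u x powr p * \<phi> x)) + q * W * S x" for x
    proof (cases "x \<in> D")
      case xD: True
      show ?thesis
      proof (cases "\<phi> x = 0")
        case True
        then have "\<psi> x \<le> 0" using op[of x] by (simp add: \<psi>_def)
        then have "u x * \<psi> x \<le> 0" using u0[OF xD] by (simp add: mult_nonneg_nonpos)
        moreover have "0 \<le> q * W * S x" using q S0 by (simp add: W_def)
        ultimately show ?thesis using xD True by simp
      next
        case False
        define B where "B = K / L * norm x powr (- (N * q))"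
        have B: "0 \<le> B" using K L by (simp add: B_def)
        have nx: "(1 / 2) ^ m \<le> norm x" "norm x \<le> 1" using supp[OF False] mm by auto
        have "x \<noteq> 0" using nx(1) by (metis norm_zero not_less zero_less_divide_1_iff zero_less_numeral zero_less_power)
        have "u x * \<psi> x \<le> u x * (\<phi> x powr (1 / p) * B)"
          unfolding \<psi>_def B_def using op[of x] u0[OF xD] by (intro mult_left_mono) auto
        also have "\<dots> = (u x * \<phi> x powr (1 / p)) * B" by simp
        also have "\<dots> \<le> (u x * \<phi> x powr (1 / p)) powr p / p + B powr (1 / q) / (1 / q)"
          using p q u0[OF xD] n[of x] B by (intro Youngs_inequality) (auto simp: q_def)
        also have "(u x * \<phi> x powr (1 / p)) powr p = u x powr p * \<phi> x"
          using u0[OF xD] n[of x] p by (simp add: powr_mult powr_powr)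
        also have "B powr (1 / q) = W * norm x powr (- N)"
          unfolding B_def W_def using K L q by (subst powr_mult) (auto simp: powr_powr)
        also have "u x powr p * \<phi> x / p + W * norm x powr (- N) / (1 / q) = 1 / p * (u x powr p * \<phi> x) + q * W * norm x powr (- N)"
          by simp
        also have "\<dots> \<le> 1 / p * (u x powr p * \<phi> x) + q * W * S x"
          using dyadic_weight[OF \<open>x \<noteq> 0\<close> nx(2,1)] q unfolding S_def N_def
          by (intro add_left_mono mult_left_mono) (auto simp: W_def)
        finally show ?thesis using xD by simp
      qed
    next
      case False
      then show ?thesis using q S0[of x] by (simp add: W_def)
    qed
    have "I \<le> (LINT x|lebesgue. indicator D x *\<^sub>R (u x * \<psi> x))"
      using u t n unfolding weak_supersolution_def I_def \<psi>_def set_lebesgue_integral_def by blast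
    also have "\<dots> \<le> (LINT x|lebesgue. 1 / p * (indicator D x *\<^sub>R (u x powr p * \<phi> x)) + q * W * S x)"
      by (rule integral_mono[OF i2 _ pw]) (use i1 iS in auto)
    also have "\<dots> = 1 / p * I + q * W * (real (Suc m) * H)"
      unfolding I_def using i1 iS by simp
    \<comment> \<open>The part I/p produced by Young's inequality is moved to the left;
      \<open>I\<close> is finite by \<open>i1\<close>.\<close>
    finally have "q * I \<le> q * (W * (real (Suc m) * H))" by (simp add: q_def algebra_simps)
    then have I: "I \<le> W * (real (Suc m) * H)" using q by simp
    have "\<eta> * J = (LINT x|lebesgue. \<eta> * (indicator (ball y (\<rho> / 2)) x *\<^sub>R u x powr p))"
      unfolding J_def by simp
    also have "\<dots> \<le> I"
      unfolding I_def
    proof (rule integral_mono[OF _ i1])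
      show "integrable lebesgue (\<lambda>x. \<eta> * (indicator (ball y (\<rho> / 2)) x *\<^sub>R u x powr p))" using iJ by simp
      fix x
      show "\<eta> * (indicator (ball y (\<rho> / 2)) x *\<^sub>R u x powr p) \<le> indicator D x *\<^sub>R (u x powr p * \<phi> x)"
      proof (cases "x \<in> ball y (\<rho> / 2)")
        case True
        then have "x \<in> cball y (\<rho> / 2)" by simp
        then have x: "x \<in> ball y \<rho>" "x \<in> D" using b b2 by blast+
        have "\<eta> * u x powr p \<le> \<phi> x * u x powr p" using low[OF x(1)] by (intro mult_right_mono) auto
        then show ?thesis using True x by (simp add: mult.commute)
      qed (use n in auto)
    qed
    also note I
    also have "W * (real (Suc m) * H) \<le> (K powr (1 / q) * L powr (- (1 / q))) * ((2 * \<bar>T\<bar> + 4) * L * H)"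
    proof (intro mult_mono mult_right_mono H)
      have "(K / L) powr (1 / q) = K powr (1 / q) / L powr (1 / q)" using K L by (intro powr_divide)
      then show "W \<le> K powr (1 / q) * L powr (- (1 / q))" by (simp add: W_def powr_minus divide_inverse)
      have "2 * \<bar>T\<bar> * 1 \<le> 2 * \<bar>T\<bar> * L" using L by (intro mult_left_mono) auto
      then show "real (Suc m) \<le> (2 * \<bar>T\<bar> + 4) * L" using m L by (simp add: algebra_simps)
    qed (use H L in auto)
    also have "\<dots> = K powr (1 / q) * (2 * \<bar>T\<bar> + 4) * H * L powr (1 - 1 / q)"
    proof -
      have "L powr (1 - 1 / q) = L powr (- (1 / q)) * L" using L powr_add[of L "- (1 / q)" 1] by simp
      then show ?thesis by (simp only: mult_ac)
    qed
    finally show ?thesis .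
  qed
  have "((\<lambda>L. K powr (1 / q) * (2 * \<bar>T\<bar> + 4) * H * L powr (1 - 1 / q)) \<longlongrightarrow> K powr (1 / q) * (2 * \<bar>T\<bar> + 4) * H * 0) at_top"
  proof (intro tendsto_mult_left tendsto_neg_powr filterlim_ident)
    show "1 - 1 / q < 0" using q by (simp add: field_simps)
  qed
  then have "\<eta> * J \<le> K powr (1 / q) * (2 * \<bar>T\<bar> + 4) * H * 0"
    by (rule tendsto_lowerbound) (use est in \<open>auto intro: eventually_at_top_linorderI[of 4]\<close>)
  then have "J \<le> 0" using \<eta> by (simp add: mult_le_0_iff)
  then have "AE x in lebesgue. - (indicator (ball y (\<rho> / 2)) x *\<^sub>R u x powr p) = 0"
    using iJ by (intro AE_zero_of_integral_nonneg) (auto simp: J_def)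
  then have "AE x in lebesgue. x \<in> ball y (\<rho> / 2) \<longrightarrow> u x = 0"
    by eventually_elim auto
  moreover have "ball y (\<rho> / 2) \<subseteq> D" using b b2 ball_subset_cball by blast
  moreover have "0 < \<rho> / 2" using \<rho> by simp
  ultimately show ?thesis by blast
qed

text \<open>The largest open set on which u vanishes almost everywhere is also relatively closed in
  \<open>D\<close>, by \<open>vanishing_spreads\<close>; connectedness finishes.\<close>

lemma vanishing_everywhere:
  fixes u :: "'a::euclidean_space \<Rightarrow> real"
  assumes D: "open D" "0 \<notin> D" "connected D" and p: "1 < p" and c: "0 \<le> c" and u: "weak_supersolution c p D u"
    and b: "0 < \<rho>" "ball y \<rho> \<subseteq> D" "AE x in lebesgue. x \<in> ball y \<rho> \<longrightarrow> u x = 0"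
  shows "AE x in lebesgue. x \<in> D \<longrightarrow> u x = 0"
proof -
  define V where "V B \<longleftrightarrow> open B \<and> (AE x in lebesgue. x \<in> B \<longrightarrow> u x = 0)" for B
  define Z where "Z = \<Union>{B. V B}"
  have oZ: "open Z" unfolding Z_def V_def by blast
  have oD: "open (D - Z)"
    unfolding open_contains_ball
  proof
    fix x assume x: "x \<in> D - Z"
    obtain d where d: "0 < d" "cball x d \<subseteq> D" using D(1) x open_contains_cball by blast
    \<comment> \<open>If z within d/3 of x belonged to \<open>Z\<close>, vanishing would spread to
      the ball of radius 2d/3 about z, which contains x and stays in
      \<open>cball x d\<close>.\<close>
    have "ball x (d / 3) \<subseteq> D - Z"
    proof
      fix z assume z: "z \<in> ball x (d / 3)"
      have "z \<notin> Z"
      proof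
        assume "z \<in> Z"
        then obtain B where B: "V B" "z \<in> B" by (auto simp: Z_def)
        then obtain s where s: "0 < s" "ball z s \<subseteq> B" unfolding V_def using open_contains_ball by blast
        define s' where "s' = min s (d / 3)"
        have s': "0 < s'" "s' < 2 * d / 3" using s d by (auto simp: s'_def)
        have "cball z (2 * d / 3) \<subseteq> cball x d"
          using z by (intro cball_subset_cball_iff[THEN iffD2]) (simp add: dist_commute field_simps)
        then have "cball z (2 * d / 3) \<subseteq> D" using d by blast
        moreover have "AE x in lebesgue. x \<in> ball z s' \<longrightarrow> u x = 0"
        proof -
          have "ball z s' \<subseteq> B" using s unfolding s'_def by (meson min.cobounded1 subset_ball subset_trans)
          with B(1) show ?thesis unfolding V_def by (auto elim!: eventually_mono)
        qed
        ultimately have "AE x in lebesgue. x \<in> ball z (2 * d / 3) \<longrightarrow> u x = 0"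
          by (intro vanishing_spreads[OF D(1,2) p c u s'])
        then have "V (ball z (2 * d / 3))" by (simp add: V_def)
        moreover have "x \<in> ball z (2 * d / 3)" using z d by (simp add: dist_commute)
        ultimately have "x \<in> Z" unfolding Z_def by blast
        then show False using x by blast
      qed
      moreover have "z \<in> D" using z d by (auto simp: subset_eq)
      ultimately show "z \<in> D - Z" by blast
    qed
    then show "\<exists>e>0. ball x e \<subseteq> D - Z" using d by (intro exI[of _ "d / 3"]) auto
  qed
  have "y \<in> D \<inter> Z" using b unfolding Z_def V_def by (auto intro!: exI[of _ "ball y \<rho>"])
  then have "D \<subseteq> Z"
    using D(3) oZ oD unfolding connected_def by blast
  \<comment> \<open>Lindelof's theorem reduces the union to countably many null exceptional
    sets.\<close>
  obtain F' where F': "F' \<subseteq> {B. V B}" "countable F'" "\<Union>F' = \<Union>{B. V B}"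
    using Lindelof[of "{B. V B}"] unfolding V_def by blast
  have "AE x in lebesgue. \<forall>B\<in>F'. x \<in> B \<longrightarrow> u x = 0"
    using F'(1) by (subst AE_ball_countable[OF F'(2)]) (auto simp: V_def)
  then show ?thesis
    using \<open>D \<subseteq> Z\<close> F'(3) unfolding Z_def by (auto elim!: eventually_mono)
qed

section \<open>Boundary geometry\<close>

lemma has_derivative_linear_bound:
  fixes f :: "'a::real_normed_vector \<Rightarrow> 'b::real_normed_vector"
  assumes "(f has_derivative D) (at a)"
  shows "\<exists>M\<ge>1. \<exists>\<delta>>0. \<forall>x. norm (x - a) < \<delta> \<longrightarrow> norm (f x - f a) \<le> M * norm (x - a)"
proof -
  have D: "bounded_linear D" and "\<exists>d>0. \<forall>y. norm (y - a) < d \<longrightarrow> norm (f y - f a - D (y - a)) \<le> 1 * norm (y - a)"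
    using assms[unfolded has_derivative_at_alt] zero_less_one by blast+
  then obtain d where d: "0 < d" "\<And>y. norm (y - a) < d \<Longrightarrow> norm (f y - f a - D (y - a)) \<le> norm (y - a)" by auto
  obtain K where K: "0 \<le> K" "\<And>x. norm (D x) \<le> norm x * K" using bounded_linear.nonneg_bounded[OF D] by blast
  have "norm (f x - f a) \<le> (1 + K) * norm (x - a)" if "norm (x - a) < d" for x
  proof -
    have "norm (f x - f a) \<le> norm (f x - f a - D (x - a)) + norm (D (x - a))"
      using norm_triangle_ineq[of "f x - f a - D (x - a)" "D (x - a)"] by simp
    also have "\<dots> \<le> norm (x - a) + norm (x - a) * K" using d(2)[OF that] K(2) by (rule add_mono)
    finally show ?thesis by (simp add: algebra_simps)
  qed
  then show ?thesis using d(1) K(1) by (intro exI[of _ "1 + K"] conjI exI[of _ d]) auto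
qed

lemma smooth_on_gradient:
  fixes \<rho> :: "'a::euclidean_space \<Rightarrow> real"
  assumes "open U" "smooth_on U \<rho>"
  obtains G where "\<And>x. x \<in> U \<Longrightarrow> (\<rho> has_derivative (\<lambda>v. G x \<bullet> v)) (at x)"
    and "\<And>x. x \<in> U \<Longrightarrow> \<exists>D. (G has_derivative D) (at x)"
proof
  define G where "G x = (\<Sum>b\<in>Basis. pd \<rho> b x *\<^sub>R b)" for x
  fix x assume x: "x \<in> U"
  have d: "(\<rho> has_derivative (\<lambda>v. pd \<rho> v x)) (at x)" by (rule smooth_on_has_derivative[OF assms x])
  have "pd \<rho> v x = G x \<bullet> v" for v
  proof -
    have "pd \<rho> (\<Sum>b\<in>Basis. (v \<bullet> b) *\<^sub>R b) x = (\<Sum>b\<in>Basis. (v \<bullet> b) *\<^sub>R pd \<rho> b x)"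
      by (simp only: linear_sum[OF has_derivative_linear[OF d]] linear_cmul[OF has_derivative_linear[OF d]])
    then have "pd \<rho> v x = (\<Sum>b\<in>Basis. (v \<bullet> b) *\<^sub>R pd \<rho> b x)" unfolding euclidean_representation .
    then show ?thesis by (simp add: G_def inner_sum_left inner_sum_right inner_commute mult.commute)
  qed
  then show "(\<rho> has_derivative (\<lambda>v. G x \<bullet> v)) (at x)" using d by simp
  have "(G has_derivative (\<lambda>v. \<Sum>b\<in>Basis. pd (pd \<rho> b) v x *\<^sub>R b)) (at x)"
    unfolding G_def[abs_def]
    by (intro has_derivative_sum has_derivative_scaleR_left smooth_on_has_derivative[OF assms(1) _ x] smooth_on_pd assms)
  then show "\<exists>D. (G has_derivative D) (at x)" by blast
qed

text \<open>e is the inner unit normal at the origin. A quadratic bound on the defining function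
  gives tangent balls on both sides; small intersections with balls are star-shaped about a point on
  the normal.\<close>

lemma smooth_domain_boundary:
  fixes \<Omega> :: "'a::euclidean_space set"
  assumes sd: "smooth_domain \<Omega>" and 0: "0 \<in> frontier \<Omega>"
  obtains e h R where "norm e = 1" "0 < h" "0 < R" "R \<le> 1 / h"
    "{x. 0 < norm x \<and> norm x < R \<and> h * (norm x)\<^sup>2 \<le> x \<bullet> e} \<subseteq> \<Omega>"
    "\<And>x. x \<in> \<Omega> \<Longrightarrow> norm x < R \<Longrightarrow> - h * (norm x)\<^sup>2 < x \<bullet> e"
    "\<And>r. 0 < r \<Longrightarrow> r < R \<Longrightarrow> connected (\<Omega> \<inter> ball 0 r)"
proof -
  have O: "open \<Omega>" using sd by (simp add: smooth_domain_def)
  obtain U \<rho> where U: "open U" "0 \<in> U" "smooth_on U \<rho>" "\<Omega> \<inter> U = {x \<in> U. \<rho> x < 0}"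
    and nz: "frechet_derivative \<rho> (at 0) \<noteq> (\<lambda>_. 0)"
    using sd 0 unfolding smooth_domain_def by blast
  obtain G where G: "\<And>x. x \<in> U \<Longrightarrow> (\<rho> has_derivative (\<lambda>v. G x \<bullet> v)) (at x)"
    and G': "\<And>x. x \<in> U \<Longrightarrow> \<exists>D. (G has_derivative D) (at x)"
    using smooth_on_gradient[OF U(1,3)] by blast
  define g where "g = norm (G 0)"
  have "G 0 \<noteq> 0" using nz frechet_derivative_at[OF G[OF U(2)]] by auto
  then have g: "0 < g" by (simp add: g_def)
  define e where "e = (- 1 / g) *\<^sub>R G 0"
  have e: "norm e = 1" and G0: "G 0 = (- g) *\<^sub>R e" using g by (simp_all add: e_def g_def)
  obtain M \<delta>0 where M: "1 \<le> M" "0 < \<delta>0" "\<And>x. norm x < \<delta>0 \<Longrightarrow> norm (G x - G 0) \<le> M * norm x"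
  proof -
    obtain D where "(G has_derivative D) (at 0)" using G'[OF U(2)] by blast
    then show ?thesis using has_derivative_linear_bound[of G D 0] that by (auto simp only: diff_zero)
  qed
  obtain \<delta>1 where d1: "0 < \<delta>1" "ball 0 \<delta>1 \<subseteq> U" using U open_contains_ball by blast
  define \<delta> where "\<delta> = min \<delta>0 \<delta>1"
  have \<delta>: "0 < \<delta>" "\<And>x. norm x < \<delta> \<Longrightarrow> x \<in> U" "\<And>x. norm x < \<delta> \<Longrightarrow> norm (G x - G 0) \<le> M * norm x"
    using M d1 by (auto simp: \<delta>_def)
  have \<Omega>U: "x \<in> \<Omega> \<longleftrightarrow> \<rho> x < 0" if "x \<in> U" for x using U(4) that by blast
  have n0: "0 \<notin> \<Omega>" using 0 O by (simp add: frontier_def interior_open)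
  \<comment> \<open>Otherwise a neighbourhood of 0 would miss the domain, contradicting 0 in its
    closure.\<close>
  have "\<not> 0 < \<rho> 0"
  proof
    assume p: "0 < \<rho> 0"
    have "open {x \<in> U. 0 < \<rho> x}"
      using continuous_open_preimage[OF smooth_on_continuous[OF U(3)] U(1), of "{0<..}"] by (simp add: vimage_def Int_def)
    moreover have "0 \<in> closure \<Omega>" using 0 by (simp add: frontier_def)
    ultimately have "{x \<in> U. 0 < \<rho> x} \<inter> \<Omega> \<noteq> {}"
      using p U(2) open_Int_closure_eq_empty[of "{x \<in> U. 0 < \<rho> x}" \<Omega>] by blast
    then show False using \<Omega>U by force
  qed
  then have r0: "\<rho> 0 = 0" using n0 \<Omega>U[OF U(2)] by linarith
  have seg: "((\<lambda>t. \<rho> (a + t *\<^sub>R v)) has_real_derivative G (a + t *\<^sub>R v) \<bullet> v) (at t)" if "a + t *\<^sub>R v \<in> U" for a v t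
  proof -
    have "((\<lambda>t. a + t *\<^sub>R v) has_derivative (\<lambda>s. s *\<^sub>R v)) (at t)"
      by (auto intro!: derivative_eq_intros)
    from has_derivative_compose[OF this G[OF that]]
    have "((\<lambda>t. \<rho> (a + t *\<^sub>R v)) has_derivative (\<lambda>s. G (a + t *\<^sub>R v) \<bullet> (s *\<^sub>R v))) (at t)" .
    then show ?thesis by (simp add: has_field_derivative_def mult.commute[of _ "G (a + t *\<^sub>R v) \<bullet> v"])
  qed
  \<comment> \<open>The mean value theorem along the segment from 0, with the linear bound on G - G
    0, replaces a second-order expansion.\<close>
  have taylor: "\<bar>\<rho> x + g * (x \<bullet> e)\<bar> \<le> M * (norm x)\<^sup>2" if x: "norm x < \<delta>" for x
  proof -
    have nt: "norm (t *\<^sub>R x) < \<delta>" if "0 \<le> t" "t \<le> 1" for t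
      using that x mult_left_le_one_le[of "norm x" t] by simp
    have "\<exists>z>0. z < 1 \<and> \<rho> (0 + 1 *\<^sub>R x) - \<rho> (0 + 0 *\<^sub>R x) = (1 - 0) * (G (0 + z *\<^sub>R x) \<bullet> x)"
    proof (rule MVT2)
      fix t :: real assume t: "0 \<le> t" "t \<le> 1"
      show "((\<lambda>t. \<rho> (0 + t *\<^sub>R x)) has_real_derivative G (0 + t *\<^sub>R x) \<bullet> x) (at t)"
        by (rule seg) (use \<delta>(2)[OF nt[OF t]] in simp)
    qed simp
    then obtain z where z: "0 < z" "z < 1" "\<rho> x = G (z *\<^sub>R x) \<bullet> x" using r0 by auto
    have "\<rho> x + g * (x \<bullet> e) = (G (z *\<^sub>R x) - G 0) \<bullet> x" by (simp add: z(3) G0 inner_diff_left inner_add_left inner_commute[of x e])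
    also have "\<bar>\<dots>\<bar> \<le> norm (G (z *\<^sub>R x) - G 0) * norm x" by (rule Cauchy_Schwarz_ineq2)
    also have "\<dots> \<le> (M * norm (z *\<^sub>R x)) * norm x" using \<delta>(3)[OF nt] z by (intro mult_right_mono) auto
    also have "\<dots> \<le> (M * norm x) * norm x" using z M mult_left_le_one_le[of "norm x" z] by (intro mult_right_mono mult_left_mono) auto
    finally show ?thesis by (simp add: power2_eq_square)
  qed
  \<comment> \<open>M + 1 rather than M makes both comparisons strict away from the origin.\<close>
  define h where "h = (M + 1) / g"
  have h: "0 < h" "g * h = M + 1" using g M by (simp_all add: h_def)
  \<comment> \<open>1/(4 h) puts points with normal component at least r/4 into the domain; g/(16 M)
    keeps the gradient so close to its value at 0 that rho decreases towards the star centre from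
    all other points.\<close>
  define R where "R = min \<delta> (min (1 / (4 * h)) (g / (16 * M)))"
  have R: "0 < R" "R \<le> \<delta>" "R \<le> 1 / (4 * h)" "R \<le> g / (16 * M)" using \<delta> h g M by (auto simp: R_def)
  have "1 / (4 * h) \<le> 1 / h" using h by (simp add: field_simps)
  then have Rh: "R \<le> 1 / h" using R by linarith
  have inside: "x \<in> \<Omega>" if "0 < norm x" "norm x < R" "h * (norm x)\<^sup>2 \<le> x \<bullet> e" for x
  proof -
    have "g * (h * (norm x)\<^sup>2) \<le> g * (x \<bullet> e)" using that g by simp
    then have "(M + 1) * (norm x)\<^sup>2 \<le> g * (x \<bullet> e)" using h by (simp add: mult.assoc[symmetric])
    moreover have "\<rho> x + g * (x \<bullet> e) \<le> M * (norm x)\<^sup>2" using taylor[of x] that R by linarith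
    moreover have "0 < (norm x)\<^sup>2" using that by simp
    moreover have "(M + 1) * (norm x)\<^sup>2 = M * (norm x)\<^sup>2 + (norm x)\<^sup>2" by (simp add: algebra_simps)
    ultimately have "\<rho> x < 0" by linarith
    then show ?thesis using \<Omega>U \<delta> that R by auto
  qed
  have outside: "- h * (norm x)\<^sup>2 < x \<bullet> e" if "x \<in> \<Omega>" "norm x < R" for x
  proof -
    have "\<rho> x < 0" using \<Omega>U[of x] \<delta>(2)[of x] that R by auto
    moreover have "- (M * (norm x)\<^sup>2) \<le> \<rho> x + g * (x \<bullet> e)" using taylor[of x] that R by linarith
    ultimately have "- (M * (norm x)\<^sup>2) < g * (x \<bullet> e)" by linarith
    moreover have "g * (- h * (norm x)\<^sup>2) = - ((M + 1) * (norm x)\<^sup>2)"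
      unfolding h(2)[symmetric] by simp
    moreover have "(M + 1) * (norm x)\<^sup>2 = M * (norm x)\<^sup>2 + (norm x)\<^sup>2" by (simp add: algebra_simps)
    moreover have "0 \<le> (norm x)\<^sup>2" by simp
    ultimately have "g * (- h * (norm x)\<^sup>2) < g * (x \<bullet> e)" by linarith
    then show ?thesis unfolding mult_less_cancel_left_pos[OF g] .
  qed
  have conn: "connected (\<Omega> \<inter> ball 0 r)" if r: "0 < r" "r < R" for r
  proof (rule starlike_imp_connected)
    define z where "z = (r / 2) *\<^sub>R e"
    have ee: "e \<bullet> e = 1" using e by (simp add: norm_eq_1)
    have ze: "z \<bullet> e = r / 2" by (simp add: z_def ee)
    have nz: "norm z = r / 2" using e r by (simp add: z_def)
    have hr: "h * r \<le> 1 / 4"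
    proof -
      have "h * r \<le> h * (1 / (4 * h))" using r R h by (intro mult_left_mono) auto
      then show ?thesis using h by simp
    qed
    have high: "w \<in> \<Omega>" if "norm w < r" "r / 4 \<le> w \<bullet> e" for w
    proof (rule inside)
      have "w \<bullet> e \<noteq> 0" using that r by linarith
      then show "0 < norm w" by auto
      show "norm w < R" using that r by simp
      have "(norm w)\<^sup>2 \<le> r\<^sup>2" using that by (intro power_mono) auto
      then have "h * (norm w)\<^sup>2 \<le> h * r * r" using h by (simp add: power2_eq_square mult.assoc)
      also have "\<dots> \<le> 1 / 4 * r" using hr r by (intro mult_right_mono) auto
      finally show "h * (norm w)\<^sup>2 \<le> w \<bullet> e" using that by simp
    qed
    have zin: "z \<in> \<Omega> \<inter> ball 0 r" using high[of z] nz ze r by simp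
    show "starlike (\<Omega> \<inter> ball 0 r)"
      unfolding starlike_def
    proof (intro bexI[of _ z] ballI subsetI)
      fix x w assume x: "x \<in> \<Omega> \<inter> ball 0 r" and w: "w \<in> closed_segment z x"
      have wb: "w \<in> ball 0 r" using closed_segment_subset[of z "ball 0 r" x] zin x w convex_ball by blast
      obtain t where t: "0 \<le> t" "t \<le> 1" "w = x + t *\<^sub>R (z - x)"
      proof -
        obtain u where "0 \<le> u" "u \<le> 1" "w = (1 - u) *\<^sub>R z + u *\<^sub>R x" using w by (auto simp: closed_segment_def)
        then show ?thesis by (intro that[of "1 - u"]) (auto simp: algebra_simps)
      qed
      have "w \<in> \<Omega>"
      proof (cases "r / 4 \<le> x \<bullet> e")
        case True
        have "w \<bullet> e = x \<bullet> e + t * (r / 2 - x \<bullet> e)" by (simp add: t(3) inner_add_left inner_diff_left ze)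
        also have "\<dots> = (1 - t) * (x \<bullet> e) + t * (r / 2)" by (simp add: algebra_simps)
        also have "\<dots> \<ge> (1 - t) * (r / 4) + t * (r / 4)" using t True r by (intro add_mono mult_left_mono) auto
        also have "(1 - t) * (r / 4) + t * (r / 4) = r / 4"
        proof -
          have "(1 - t) * q + t * q = q" for q :: real by (simp add: left_diff_distrib)
          then show ?thesis .
        qed
        finally have "r / 4 \<le> w \<bullet> e" .
        then show ?thesis using high wb by simp
      next
        case False
        have sb: "norm (x + s *\<^sub>R (z - x)) < r" if "0 \<le> s" "s \<le> 1" for s
        proof -
          have "x + s *\<^sub>R (z - x) = (1 - s) *\<^sub>R x + s *\<^sub>R z" by (simp add: algebra_simps)
          then have "x + s *\<^sub>R (z - x) \<in> ball 0 r"
            using convexD[OF convex_ball[of 0 r], of x z "1 - s" s] x zin that by simp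
          then show ?thesis by simp
        qed
        \<comment> \<open>Low points are treated by monotonicity: along the segment towards z the
          derivative is at most - g (r/4 - x.e), negative in this case, so rho stays below its value
          at x.\<close>
        have "\<rho> (x + t *\<^sub>R (z - x)) \<le> \<rho> (x + 0 *\<^sub>R (z - x))"
        proof (rule DERIV_nonpos_imp_nonincreasing[OF t(1)])
          fix s assume s: "0 \<le> s" "s \<le> t"
          define y where "y = x + s *\<^sub>R (z - x)"
          have y: "norm y < r" using sb[of s] s t by (simp add: y_def)
          have yd: "norm y < \<delta>" using y r R by linarith
          have "G y \<bullet> (z - x) = G 0 \<bullet> (z - x) + (G y - G 0) \<bullet> (z - x)" by (simp add: inner_diff_left)
          also have "G 0 \<bullet> (z - x) = - g * (r / 2 - x \<bullet> e)" by (simp add: G0 inner_diff_right inner_commute[of e z] inner_commute[of e x] ze algebra_simps)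
          also have "(G y - G 0) \<bullet> (z - x) \<le> norm (G y - G 0) * norm (z - x)" by (rule norm_cauchy_schwarz)
          also have "\<dots> \<le> (M * r) * (2 * r)"
          proof (intro mult_mono)
            have "M * norm y \<le> M * r" using y M by (intro mult_left_mono) auto
            then show "norm (G y - G 0) \<le> M * r" using \<delta>(3)[OF yd] by linarith
            have "norm x < r" using x by simp
            then show "norm (z - x) \<le> 2 * r" using norm_triangle_ineq4[of z x] nz r by linarith
          qed (use M r in auto)
          also have "(M * r) * (2 * r) \<le> g * (r / 4)"
          proof -
            have "r \<le> g / (16 * M)" using r R by linarith
            then have "16 * M * r \<le> g" using M by (simp add: field_simps)
            then have "16 * M * r * r \<le> g * r" using r by (intro mult_right_mono) auto
            moreover have "0 \<le> M * r * r" using M r by simp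
            ultimately show ?thesis by simp
          qed
          finally have "G y \<bullet> (z - x) \<le> - g * (r / 2 - x \<bullet> e) + g * (r / 4)" by simp
          also have "\<dots> = - g * (r / 4 - x \<bullet> e)" by (simp add: algebra_simps)
          also have "\<dots> \<le> 0" using False g by (simp add: mult_nonneg_nonneg)
          finally have "G y \<bullet> (z - x) \<le> 0" .
          then show "\<exists>y. ((\<lambda>t. \<rho> (x + t *\<^sub>R (z - x))) has_real_derivative y) (at s) \<and> y \<le> 0"
            using seg[of x s "z - x"] \<delta>(2)[OF yd] unfolding y_def by blast
        qed
        moreover have "\<rho> x < 0" using \<Omega>U[of x] \<delta>(2)[of x] x r R by auto
        ultimately have "\<rho> w < 0" by (simp add: t(3))
        then show ?thesis using \<Omega>U[of w] \<delta>(2)[of w] wb r R by auto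
      qed
      then show "w \<in> \<Omega> \<inter> ball 0 r" using wb by blast
    qed (rule zin)
  qed
  show ?thesis
    by (rule that[OF e h(1) R(1) Rh _ outside conn]) (use inside in auto)
qed

theorem theorem0p2:
  fixes \<Omega> :: "'a::euclidean_space set"
  assumes "DIM('a) \<ge> 3"
    and "smooth_domain \<Omega>"
    and "0 \<in> frontier \<Omega>"
  shows "\<exists>r0>0.
     (\<forall>r. 0 < r \<and> r < r0 \<longrightarrow> hardy_mu (\<Omega> \<inter> ball 0 r) = (real DIM('a))\<^sup>2 / 4) \<and>
     (\<forall>r c p u. 0 < r \<longrightarrow> r < r0 \<longrightarrow>
        real DIM('a) - 1 < c \<longrightarrow> c \<le> (real DIM('a))\<^sup>2 / 4 \<longrightarrow> p > 1 \<longrightarrow>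
        Lp_loc p (\<Omega> \<inter> ball 0 r) u \<longrightarrow>
        (\<forall>x\<in>\<Omega> \<inter> ball 0 r. u x \<ge> 0) \<longrightarrow>
        (\<forall>\<phi>. test_fun (\<Omega> \<inter> ball 0 r) \<phi> \<and> (\<forall>x. \<phi> x \<ge> 0) \<longrightarrow>
           (LINT x:\<Omega> \<inter> ball 0 r|lebesgue. u x powr p * \<phi> x)
             \<le> (LINT x:\<Omega> \<inter> ball 0 r|lebesgue.
                   u x * (- laplacian \<phi> x - c / (norm x)\<^sup>2 * \<phi> x))) \<longrightarrow>
        p \<ge> p_half_sphere (real DIM('a)) c \<longrightarrow>
        (AE x in lebesgue. x \<in> \<Omega> \<inter> ball 0 r \<longrightarrow> u x = 0))"
proof -
  obtain e h R where e: "norm e = 1" and h: "0 < h" and R: "0 < R" "R \<le> 1 / h"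
    and inside: "{x. 0 < norm x \<and> norm x < R \<and> h * (norm x)\<^sup>2 \<le> x \<bullet> e} \<subseteq> \<Omega>"
    and outside: "\<And>x. x \<in> \<Omega> \<Longrightarrow> norm x < R \<Longrightarrow> - h * (norm x)\<^sup>2 < x \<bullet> e"
    and conn: "\<And>r. 0 < r \<Longrightarrow> r < R \<Longrightarrow> connected (\<Omega> \<inter> ball 0 r)"
    using smooth_domain_boundary[OF assms(2,3)] by blast
  obtain r1 where r1: "0 < r1" and low: "\<And>U \<phi>. open U \<Longrightarrow>
      (\<forall>x\<in>U. x \<noteq> 0 \<and> norm x < r1 \<and> - h * (norm x)\<^sup>2 < x \<bullet> e) \<Longrightarrow> test_fun U \<phi> \<Longrightarrow>
     (real DIM('a))\<^sup>2 / 4 * (LINT x|lebesgue. (\<phi> x)\<^sup>2 / (norm x)\<^sup>2) \<le> (LINT x|lebesgue. grad_sq \<phi> x)"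
    using hardy_lower_domain[OF e h] by blast
  have O: "open \<Omega>" using assms(2) by (simp add: smooth_domain_def)
  have n0: "0 \<notin> \<Omega>" using assms(3) O by (simp add: frontier_def interior_open)
  have Dr: "open (\<Omega> \<inter> ball 0 r)" "0 \<notin> \<Omega> \<inter> ball 0 r" for r using O n0 by auto
  have inr: "{x. 0 < norm x \<and> norm x < r \<and> h * (norm x)\<^sup>2 \<le> x \<bullet> e} \<subseteq> \<Omega> \<inter> ball 0 r" if "r < R" for r
    using inside that by auto
  show ?thesis
  proof (intro exI[of _ "min R r1"] conjI allI impI)
    show "0 < min R r1" using R r1 by simp
  next
    fix r assume r: "0 < r \<and> r < min R r1"
    define D where "D = \<Omega> \<inter> ball 0 r"
    define Q where "Q = {(LINT x|lebesgue. grad_sq u x) / (LINT x|lebesgue. u x ^ 2 / (norm x)\<^sup>2) |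
                      u. test_fun D u \<and> (\<exists>x. u x \<noteq> 0)}"
    \<comment> \<open>Positivity excludes the default value 0 of division by zero, so the bounds on
      the integrals pass to the quotients.\<close>
    have den: "0 < (LINT x|lebesgue. u x ^ 2 / (norm x)\<^sup>2)" if u: "test_fun D u" "u x \<noteq> 0" for u x
    proof (rule continuous_integral_pos[where U = UNIV and x = x])
      have c: "continuous_on D (\<lambda>x. inverse ((norm x)\<^sup>2))"
        using Dr[of r] by (intro continuous_intros) (auto simp: D_def)
      have oD: "open D" using Dr by (simp add: D_def)
      show "continuous_on UNIV (\<lambda>x. u x ^ 2 / (norm x)\<^sup>2)"
        using test_fun_mult_continuous_on[OF oD test_fun_square[OF u(1)] c] by (simp add: divide_inverse)
      show "integrable lebesgue (\<lambda>x. u x ^ 2 / (norm x)\<^sup>2)"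
        using test_fun_mult_continuous[OF oD test_fun_square[OF u(1)] c] by (simp add: divide_inverse)
      have "x \<in> D" using u outside_tsupport[of x u] by (auto simp: test_fun_def)
      then have "x \<noteq> 0" using Dr[of r] by (auto simp: D_def)
      then show "0 < (u x)\<^sup>2 / (norm x)\<^sup>2" using u by simp
    qed auto
    have lower: "(real DIM('a))\<^sup>2 / 4 \<le> q" if "q \<in> Q" for q
    proof -
      obtain u x where q: "q = (LINT x|lebesgue. grad_sq u x) / (LINT x|lebesgue. u x ^ 2 / (norm x)\<^sup>2)"
        and u: "test_fun D u" "u x \<noteq> 0" using \<open>q \<in> Q\<close> by (auto simp: Q_def)
      have "(real DIM('a))\<^sup>2 / 4 * (LINT x|lebesgue. (u x)\<^sup>2 / (norm x)\<^sup>2) \<le> (LINT x|lebesgue. grad_sq u x)"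
      proof (rule low[OF _ _ u(1)])
        show "\<forall>x\<in>D. x \<noteq> 0 \<and> norm x < r1 \<and> - h * (norm x)\<^sup>2 < x \<bullet> e"
          using outside n0 r by (auto simp: D_def)
      qed (use Dr in \<open>simp add: D_def\<close>)
      then show ?thesis using den[OF u] by (simp add: q pos_le_divide_eq)
    qed
    have upper: "\<exists>q\<in>Q. q \<le> (real DIM('a))\<^sup>2 / 4 + \<epsilon>" if eps: "0 < \<epsilon>" for \<epsilon>
    proof -
      have "r \<le> 1 / h" using r R by linarith
      then obtain \<phi> x where \<phi>: "test_fun D \<phi>" "\<phi> x \<noteq> 0"
        "(LINT x|lebesgue. grad_sq \<phi> x) \<le> ((real DIM('a))\<^sup>2 / 4 + \<epsilon>) * (LINT x|lebesgue. (\<phi> x)\<^sup>2 / (norm x)\<^sup>2)"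
        using hardy_upper_domain[OF e h _ _ Dr inr eps, of r] r unfolding D_def by auto
      then show ?thesis using den[OF \<phi>(1,2)] unfolding Q_def
        by (intro bexI[of _ "(LINT x|lebesgue. grad_sq \<phi> x) / (LINT x|lebesgue. \<phi> x ^ 2 / (norm x)\<^sup>2)"])
          (auto simp: pos_divide_le_eq)
    qed
    have ne: "Q \<noteq> {}" using upper[of 1] by auto
    have bd: "bdd_below Q" using lower by (rule bdd_belowI)
    have "hardy_mu D = Inf Q" by (simp add: hardy_mu_def Q_def)
    moreover have "(real DIM('a))\<^sup>2 / 4 \<le> Inf Q" by (rule cInf_greatest[OF ne lower])
    moreover have "Inf Q \<le> (real DIM('a))\<^sup>2 / 4"
    proof (rule field_le_epsilon)
      fix \<epsilon> :: real assume "0 < \<epsilon>"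
      then show "Inf Q \<le> (real DIM('a))\<^sup>2 / 4 + \<epsilon>" using upper cInf_lower2[OF _ _ bd] by blast
    qed
    ultimately show "hardy_mu (\<Omega> \<inter> ball 0 r) = (real DIM('a))\<^sup>2 / 4" by (simp add: D_def)
  next
    fix r c p :: real and u :: "'a \<Rightarrow> real"
    assume r: "0 < r" "r < min R r1" and c: "real DIM('a) - 1 < c" "c \<le> (real DIM('a))\<^sup>2 / 4" and p: "1 < p"
      and u: "Lp_loc p (\<Omega> \<inter> ball 0 r) u" "\<forall>x\<in>\<Omega> \<inter> ball 0 r. 0 \<le> u x"
        "\<forall>\<phi>. test_fun (\<Omega> \<inter> ball 0 r) \<phi> \<and> (\<forall>x. \<phi> x \<ge> 0) \<longrightarrow>
           (LINT x:\<Omega> \<inter> ball 0 r|lebesgue. u x powr p * \<phi> x)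
             \<le> (LINT x:\<Omega> \<inter> ball 0 r|lebesgue. u x * (- laplacian \<phi> x - c / (norm x)\<^sup>2 * \<phi> x))"
      and ps: "p_half_sphere (real DIM('a)) c \<le> p"
    have ws: "weak_supersolution c p (\<Omega> \<inter> ball 0 r) u" using u by (simp add: weak_supersolution_def)
    have rh: "r \<le> 1 / h" "r < R" using r R by auto
    obtain y \<rho> where y: "0 < \<rho>" "ball y \<rho> \<subseteq> \<Omega> \<inter> ball 0 r" "AE x in lebesgue. x \<in> ball y \<rho> \<longrightarrow> u x = 0"
      using vanishing_ball[OF e h r(1) rh(1) Dr inr[OF rh(2)] c p ps assms(1) ws] by blast
    have "0 \<le> c" using c assms(1) by simp
    then show "AE x in lebesgue. x \<in> \<Omega> \<inter> ball 0 r \<longrightarrow> u x = 0"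
      by (rule vanishing_everywhere[OF Dr conn[OF r(1) rh(2)] p _ ws y])
  qed
qed

end
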